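(* Let $(\mathcal M,\mathcal H_\mu)$ and $(\mathcal N,\mathcal H_\nu)$ be $\mathbb Z_2$-graded von Neumann algebras with cyclic vectors $\xi_\mu,\xi_\nu$ and even vector states $\mu,\nu$ (setting and notation as in the context). Let $\Psi:\mathcal M\to\mathcal N$ be a positive linear map that is grading-equivariant, i.e. $\Psi\circ\gamma_\mu=\gamma_\nu\circ\Psi$, and such that $\nu\circ\Psi=\mu$. Then the twisted dual $\Psi^{\wr}=\kappa_\mu\circ\Psi'\circ\kappa_\nu|_{\mathcal N^{\wr}}:\mathcal N^{\wr}\to\mathcal M^{\wr}$ is positive, even, with unit norm, and is given by $$\Psi^{\wr}=\eta_\mu\circ\Psi'\circ\eta_\nu^{-1}|_{\mathcal N^{\wr}}=\eta_\mu^{-1}\circ\Psi'\circ\eta_\nu|_{\mathcal N^{\wr}}.$$ In addition: (a) if $\Psi$ is $n$-positive for some $n\in\mathbb N$, then so is $\Psi^{\wr}$; (b) if $\Psi$ is completely positive, then so is $\Psi^{\wr}$; (c) if $\Psi$ is unit preserving, while $\xi_\mu$ and $\xi_\nu$ are separating for $\mathcal M$ and $\mathcal N$ respectively, then $\Psi^{\wr\wr}:=(\Psi^{\wr})^{\wr}:\mathcal M\to\mathcal N$ is well-defined and $\Psi^{\wr\wr}=\Psi$.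
   Context: $(\mathcal M,\mathcal H_\mu)$ and $(\mathcal N,\mathcal H_\nu)$ are von Neumann algebras acting on the indicated Hilbert spaces, with cyclic (unit) vectors $\xi_\mu$, $\xi_\nu$, and states $\mu(a)=\langle a\xi_\mu,\xi_\mu\rangle$ on $\mathcal M$, $\nu(b)=\langle b\xi_\nu,\xi_\nu\rangle$ on $\mathcal N$. They carry $\mathbb Z_2$-gradings, i.e. $*$-automorphisms $\theta_\mu$, $\theta_\nu$ with square the identity, and $\mu\circ\theta_\mu=\mu$, $\nu\circ\theta_\nu=\nu$. $\Gamma_\mu$ is the self-adjoint unitary on $\mathcal H_\mu$ determined by $\Gamma_\mu a\xi_\mu=\theta_\mu(a)\xi_\mu$ ($a\in\mathcal M$), and similarly $\Gamma_\nu$. The gradings extend to $\gamma_\mu=\Gamma_\mu(\cdot)\Gamma_\mu$ on $\mathcal B(\mathcal H_\mu)$ and $\gamma_\nu=\Gamma_\nu(\cdot)\Gamma_\nu$ on $\mathcal B(\mathcal H_\nu)$. For a self-adjoint unitary $\Gamma$ on $\mathcal H$, each $a\in\mathcal B(\mathcal H)$ is uniquely $a=a_++a_-$ with $\Gamma a_\pm\Gamma=\pm a_\pm$; put $\kappa_\Gamma(a)=a_++\Gamma a_-$ (a linear bijection with $\kappa_\Gamma^{-1}=\kappa_\Gamma$) and $\eta_\Gamma(a)=a_++i\,\Gamma a_-$ (a $*$-automorphism of $\mathcal B(\mathcal H)$). Write $\kappa_\mu,\eta_\mu$ for $\Gamma=\Gamma_\mu$ and $\kappa_\nu,\eta_\nu$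 for $\Gamma=\Gamma_\nu$. The twisted commutants are $\mathcal M^{\wr}=\kappa_\mu(\mathcal M')$ and $\mathcal N^{\wr}=\kappa_\nu(\mathcal N')$; they are von Neumann algebras, invariant under $\gamma_\mu$, resp. $\gamma_\nu$, and graded by the restrictions of these. "Even" for $\Psi^{\wr}$ means $\Psi^{\wr}\circ\gamma_\nu=\gamma_\mu\circ\Psi^{\wr}$. One has $\mathcal M^{\wr\wr}=\mathcal M$, $\mathcal N^{\wr\wr}=\mathcal N$. The dual $\Psi':\mathcal N'\to\mathcal M'$ of a positive linear $\Psi:\mathcal M\to\mathcal N$ with $\nu\circ\Psi=\mu$ is determined by $\langle\Psi'(b')a\xi_\mu,\xi_\mu\rangle=\langle b'\Psi(a)\xi_\nu,\xi_\nu\rangle$ for all $a\in\mathcal M$, $b'\in\mathcal N'$. The twisted dual is $\Psi^{\wr}=\kappa_\mu\circ\Psi'\circ\kappa_\nu|_{\mathcal N^{\wr}}$; equivalently, it is determined by $\langle\Psi^{\wr}(b)a\xi_\mu,\xi_\mu\rangle=\langle b\Psi(a)\xi_\nu,\xi_\nu\rangle$ for $a\in\mathcal M$, $b\in\mathcal N^{\wr}$. In (c), $(\Psi^{\wr})^{\wr}$ is the twisted dual obtained by the same construction applied to $\Psi^{\wr}:\mathcal N^{\wr}\to\mathcal M^{\wr}$ with the vectors $\xi_\nu,\xi_\mu$, i.e. $\kappa_\nu\circ(\Psi^{\wr})'\circ\kappa_\mu|_{\mathcal M}$. *)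

theory Defs
  imports "HOL-Analysis.Analysis"
begin

class scaleC =
  fixes scaleC :: "complex \<Rightarrow> 'a \<Rightarrow> 'a"  (infixr "*\<^sub>C" 75)

class complex_vector = real_vector + scaleC +
  assumes scaleC_add_right: "c *\<^sub>C (x + y) = c *\<^sub>C x + c *\<^sub>C y"
    and scaleC_add_left: "(c + d) *\<^sub>C x = c *\<^sub>C x + d *\<^sub>C x"
    and scaleC_scaleC: "c *\<^sub>C d *\<^sub>C x = (c * d) *\<^sub>C x"
    and scaleR_scaleC: "r *\<^sub>R x = complex_of_real r *\<^sub>C x"

text \<open>
  The Hermitian form \<open>cinner\<close> is linear in its first argument.  Its real part is the real inner
  product of the library class, so definiteness and \<open>norm x = sqrt (Re (cinner x x))\<close> are inherited.
\<close>

class complex_inner = complex_vector + real_inner +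
  fixes cinner :: "'a \<Rightarrow> 'a \<Rightarrow> complex"
  assumes cinner_add_left: "cinner (x + y) z = cinner x z + cinner y z"
    and cinner_scaleC_left: "cinner (c *\<^sub>C x) y = c * cinner x y"
    and cinner_commute: "cinner x y = cnj (cinner y x)"
    and Re_cinner: "Re (cinner x y) = inner x y"

class chilbert_space = complex_inner + complete_space

lemma scaleC_one: "1 *\<^sub>C x = (x :: 'a :: complex_vector)"
  using scaleR_scaleC[of 1 x] by simp

lemma norm_scaleC: "norm (c *\<^sub>C x) = cmod c * norm (x :: 'a :: complex_inner)"
proof -
  have *: "cinner (c *\<^sub>C x) (c *\<^sub>C x) = (c * cnj c) * cinner x x"
    by (metis cinner_scaleC_left cinner_commute complex_cnj_mult mult.assoc mult.commute)
  have "inner (c *\<^sub>C x) (c *\<^sub>C x) = Re ((c * cnj c) * cinner x x)"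
    by (metis * Re_cinner)
  also have "\<dots> = (cmod c)\<^sup>2 * inner x x"
    by (simp add: complex_norm_square[symmetric] Re_cinner flip: of_real_power)
  finally show ?thesis
    by (simp add: norm_eq_sqrt_inner real_sqrt_mult)
qed

typedef (overloaded) 'h bop =
  "{f :: 'h :: complex_inner \<Rightarrow> 'h. bounded_linear f \<and> (\<forall>c x. f (c *\<^sub>C x) = c *\<^sub>C f x)}"
  morphisms bop_apply Bop
proof
  show "(\<lambda>x. 0) \<in> {f :: 'h \<Rightarrow> 'h. bounded_linear f \<and> (\<forall>c x. f (c *\<^sub>C x) = c *\<^sub>C f x)}"
    by (simp, metis add_cancel_right_right scaleC_add_right)
qed

setup_lifting type_definition_bop

notation bop_apply (infixr "\<cdot>" 75)

lemma bounded_linear_bop: "bounded_linear (bop_apply a)"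
  using bop_apply by blast

lemma bop_scaleC: "a \<cdot> (c *\<^sub>C x) = c *\<^sub>C (a \<cdot> x)"
  using bop_apply by blast

lemma bop_eqI: "(\<And>x. a \<cdot> x = b \<cdot> x) \<Longrightarrow> a = b"
  by (simp add: bop_apply_inject[symmetric] ext)

lemma scaleC_zero_right [simp]: "c *\<^sub>C (0 :: 'a :: complex_vector) = 0"
  by (metis add_cancel_right_right scaleC_add_right)

lemma scaleC_minus_right: "c *\<^sub>C (- x) = - (c *\<^sub>C (x :: 'a :: complex_vector))"
  by (metis add.right_inverse add_eq_0_iff scaleC_add_right scaleC_zero_right)

lemma scaleC_diff_right: "c *\<^sub>C (x - y) = c *\<^sub>C x - c *\<^sub>C (y :: 'a :: complex_vector)"
  by (metis diff_conv_add_uminus scaleC_add_right scaleC_minus_right)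

lemma bounded_linear_scaleC: "bounded_linear (\<lambda>x :: 'a :: complex_inner. c *\<^sub>C x)"
  by (rule bounded_linear_intro[where K = "cmod c"])
     (simp_all add: scaleC_add_right scaleR_scaleC scaleC_scaleC norm_scaleC mult.commute)

instantiation bop :: (complex_inner) complex_vector
begin

lift_definition zero_bop :: "'a bop" is "\<lambda>x. 0" by simp
lift_definition plus_bop :: "'a bop \<Rightarrow> 'a bop \<Rightarrow> 'a bop" is "\<lambda>f g x. f x + g x"
  by (simp add: bounded_linear_add scaleC_add_right)
lift_definition minus_bop :: "'a bop \<Rightarrow> 'a bop \<Rightarrow> 'a bop" is "\<lambda>f g x. f x - g x"
  by (simp add: bounded_linear_sub scaleC_diff_right)
lift_definition uminus_bop :: "'a bop \<Rightarrow> 'a bop" is "\<lambda>f x. - f x"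
  by (simp add: bounded_linear_minus scaleC_minus_right)
lift_definition scaleR_bop :: "real \<Rightarrow> 'a bop \<Rightarrow> 'a bop" is "\<lambda>r f x. r *\<^sub>R f x"
  by (simp add: bounded_linear_scaleR_right[THEN bounded_linear_compose] scaleR_scaleC
      scaleC_scaleC mult.commute bounded_linear_compose[OF bounded_linear_scaleC])
lift_definition scaleC_bop :: "complex \<Rightarrow> 'a bop \<Rightarrow> 'a bop" is "\<lambda>c f x. c *\<^sub>C f x"
  by (simp add: scaleC_scaleC mult.commute bounded_linear_compose[OF bounded_linear_scaleC])

instance
proof
  fix x y z :: "'a bop" and a b :: real and c d :: complex
  show "x + y + z = x + (y + z)" "x + y = y + x" "0 + x = x" "- x + x = 0" "x - y = x + - y"
    by (transfer; simp add: algebra_simps)+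
  show "a *\<^sub>R (x + y) = a *\<^sub>R x + a *\<^sub>R y" "(a + b) *\<^sub>R x = a *\<^sub>R x + b *\<^sub>R x"
    "a *\<^sub>R b *\<^sub>R x = (a * b) *\<^sub>R x" "1 *\<^sub>R x = x"
    by (transfer; simp add: algebra_simps)+
  show "c *\<^sub>C (x + y) = c *\<^sub>C x + c *\<^sub>C y" "(c + d) *\<^sub>C x = c *\<^sub>C x + d *\<^sub>C x"
    "c *\<^sub>C d *\<^sub>C x = (c * d) *\<^sub>C x"
    by (transfer; simp add: scaleC_add_right scaleC_add_left scaleC_scaleC)+
  show "a *\<^sub>R x = complex_of_real a *\<^sub>C x"
    by transfer (simp add: fun_eq_iff scaleR_scaleC)
qed

end

instantiation bop :: (complex_inner) "{real_normed_algebra, monoid_mult}"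
begin

lift_definition one_bop :: "'a bop" is "\<lambda>x. x" by simp
lift_definition times_bop :: "'a bop \<Rightarrow> 'a bop \<Rightarrow> 'a bop" is "\<lambda>f g x. f (g x)"
  by (simp add: bounded_linear_compose)
lift_definition norm_bop :: "'a bop \<Rightarrow> real" is onorm .
definition dist_bop :: "'a bop \<Rightarrow> 'a bop \<Rightarrow> real" where "dist_bop a b = norm (a - b)"
definition sgn_bop :: "'a bop \<Rightarrow> 'a bop" where "sgn_bop a = a /\<^sub>R norm a"
definition [code del]:
  "(uniformity :: ('a bop \<times> 'a bop) filter) = (INF e\<in>{0 <..}. principal {(x, y). dist x y < e})"
definition open_bop :: "'a bop set \<Rightarrow> bool" where [code del]:
  "open_bop S = (\<forall>x\<in>S. \<forall>\<^sub>F (x', y) in uniformity. x' = x \<longrightarrow> y \<in> S)"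

instance
proof
  fix a b c :: "'a bop" and r :: real
  show "dist a b = norm (a - b)" by (fact dist_bop_def)
  show "sgn a = a /\<^sub>R norm a" by (fact sgn_bop_def)
  show "(uniformity :: ('a bop \<times> 'a bop) filter) = (INF e\<in>{0 <..}. principal {(x, y). dist x y < e})"
    by (fact uniformity_bop_def)
  show "open S \<longleftrightarrow> (\<forall>x\<in>S. \<forall>\<^sub>F (x', y) in uniformity. x' = x \<longrightarrow> y \<in> S)" for S :: "'a bop set"
    by (fact open_bop_def)
  show "norm a = 0 \<longleftrightarrow> a = 0"
    by transfer (auto simp: onorm_eq_0)
  show "norm (a + b) \<le> norm a + norm b"
    by transfer (simp add: onorm_triangle)
  show "norm (r *\<^sub>R a) = \<bar>r\<bar> * norm a"
    by transfer (simp add: onorm_scaleR)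
  show "norm (a * b) \<le> norm a * norm b"
    by transfer (use onorm_compose in \<open>fastforce simp: o_def\<close>)
  show "(a + b) * c = a * c + b * c" "a * b * c = a * (b * c)" "1 * a = a" "a * 1 = a"
    by (transfer; simp)+
  show "a * (b + c) = a * b + a * c"
    by transfer (auto simp: linear_add bounded_linear.linear)
  show "r *\<^sub>R a * b = r *\<^sub>R (a * b)"
    by (transfer; simp)
  show "a * r *\<^sub>R b = r *\<^sub>R (a * b)"
    by transfer (auto simp: linear_cmul bounded_linear.linear)
qed

end

definition adj :: "'h :: chilbert_space bop \<Rightarrow> 'h bop" where
  "adj a = (THE b. \<forall>x y. cinner (a \<cdot> x) y = cinner x (b \<cdot> y))"

definition self_adjoint_unitary :: "'h :: chilbert_space bop \<Rightarrow> bool" where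
  "self_adjoint_unitary \<Gamma> \<longleftrightarrow> adj \<Gamma> = \<Gamma> \<and> \<Gamma> * \<Gamma> = 1"

definition vector_state :: "'h :: complex_inner \<Rightarrow> 'h bop \<Rightarrow> complex" where
  "vector_state \<xi> a = cinner (a \<cdot> \<xi>) \<xi>"

definition commutant :: "'h :: complex_inner bop set \<Rightarrow> 'h bop set" where
  "commutant M = {b. \<forall>a\<in>M. a * b = b * a}"

definition von_neumann_algebra :: "'h :: chilbert_space bop set \<Rightarrow> bool" where
  "von_neumann_algebra M \<longleftrightarrow> (\<forall>a\<in>M. adj a \<in> M) \<and> commutant (commutant M) = M"

definition cyclic_vector :: "'h :: complex_inner bop set \<Rightarrow> 'h \<Rightarrow> bool" where
  "cyclic_vector M \<xi> \<longleftrightarrow> closure ((\<lambda>a. a \<cdot> \<xi>) ` M) = UNIV"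

definition separating_vector :: "'h :: complex_inner bop set \<Rightarrow> 'h \<Rightarrow> bool" where
  "separating_vector M \<xi> \<longleftrightarrow> (\<forall>a\<in>M. a \<cdot> \<xi> = 0 \<longrightarrow> a = 0)"

definition linear_map_on :: "'h :: complex_inner bop set \<Rightarrow> ('h bop \<Rightarrow> 'k :: complex_inner bop) \<Rightarrow> bool" where
  "linear_map_on M \<Phi> \<longleftrightarrow>
    (\<forall>a\<in>M. \<forall>b\<in>M. \<Phi> (a + b) = \<Phi> a + \<Phi> b) \<and> (\<forall>a\<in>M. \<forall>c. \<Phi> (c *\<^sub>C a) = c *\<^sub>C \<Phi> a)"

definition star_automorphism :: "'h :: chilbert_space bop set \<Rightarrow> ('h bop \<Rightarrow> 'h bop) \<Rightarrow> bool" where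
  "star_automorphism M \<theta> \<longleftrightarrow> bij_betw \<theta> M M \<and> linear_map_on M \<theta> \<and>
    (\<forall>a\<in>M. \<forall>b\<in>M. \<theta> (a * b) = \<theta> a * \<theta> b) \<and> (\<forall>a\<in>M. \<theta> (adj a) = adj (\<theta> a))"

definition positive_op :: "'h :: complex_inner bop \<Rightarrow> bool" where
  "positive_op a \<longleftrightarrow> (\<forall>x. cinner (a \<cdot> x) x \<in> \<real>\<^sub>\<ge>\<^sub>0)"

definition positive_map ::
    "'h :: complex_inner bop set \<Rightarrow> 'k :: complex_inner bop set \<Rightarrow> ('h bop \<Rightarrow> 'k bop) \<Rightarrow> bool" where
  "positive_map M N \<Phi> \<longleftrightarrow> \<Phi> ` M \<subseteq> N \<and> linear_map_on M \<Phi> \<and>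
    (\<forall>a\<in>M. positive_op a \<longrightarrow> positive_op (\<Phi> a))"

text \<open>
  An \<open>n \<times> n\<close> matrix \<open>A\<close> of operators, with indices below \<open>n\<close>, acts on the \<open>n\<close>-fold direct sum by
  \<open>(A x)\<^sub>i = (\<Sum>j<n. A\<^sub>i\<^sub>j x\<^sub>j)\<close>; positivity of this operator is the condition below.
\<close>

definition positive_matrix :: "nat \<Rightarrow> (nat \<Rightarrow> nat \<Rightarrow> 'h :: complex_inner bop) \<Rightarrow> bool" where
  "positive_matrix n A \<longleftrightarrow>
    (\<forall>x :: nat \<Rightarrow> 'h. (\<Sum>i<n. cinner (\<Sum>j<n. A i j \<cdot> x j) (x i)) \<in> \<real>\<^sub>\<ge>\<^sub>0)"

definition n_positive ::
    "nat \<Rightarrow> 'h :: complex_inner bop set \<Rightarrow> ('h bop \<Rightarrow> 'k :: complex_inner bop) \<Rightarrow> bool" where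
  "n_positive n M \<Phi> \<longleftrightarrow>
    (\<forall>A. (\<forall>i<n. \<forall>j<n. A i j \<in> M) \<and> positive_matrix n A \<longrightarrow> positive_matrix n (\<lambda>i j. \<Phi> (A i j)))"

definition completely_positive ::
    "'h :: complex_inner bop set \<Rightarrow> ('h bop \<Rightarrow> 'k :: complex_inner bop) \<Rightarrow> bool" where
  "completely_positive M \<Phi> \<longleftrightarrow> (\<forall>n\<ge>1. n_positive n M \<Phi>)"

text \<open>The supremum is taken in the extended reals, so an unbounded map has norm \<open>\<infinity>\<close>.\<close>

definition map_norm :: "'h :: complex_inner bop set \<Rightarrow> ('h bop \<Rightarrow> 'k :: complex_inner bop) \<Rightarrow> ereal" where
  "map_norm M \<Phi> = (SUP a\<in>{a \<in> M. norm a \<le> 1}. ereal (norm (\<Phi> a)))"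

definition graded_vn_algebra ::
    "'h :: chilbert_space bop set \<Rightarrow> ('h bop \<Rightarrow> 'h bop) \<Rightarrow> 'h \<Rightarrow> bool" where
  "graded_vn_algebra M \<theta> \<xi> \<longleftrightarrow> von_neumann_algebra M \<and>
    star_automorphism M \<theta> \<and> (\<forall>a\<in>M. \<theta> (\<theta> a) = a) \<and>
    norm \<xi> = 1 \<and> cyclic_vector M \<xi> \<and> (\<forall>a\<in>M. vector_state \<xi> (\<theta> a) = vector_state \<xi> a)"

definition grading_unitary ::
    "'h :: chilbert_space bop set \<Rightarrow> ('h bop \<Rightarrow> 'h bop) \<Rightarrow> 'h \<Rightarrow> 'h bop" where
  "grading_unitary M \<theta> \<xi> =
    (THE \<Gamma>. self_adjoint_unitary \<Gamma> \<and> (\<forall>a\<in>M. \<Gamma> \<cdot> a \<cdot> \<xi> = \<theta> a \<cdot> \<xi>))"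

definition grading :: "'h :: complex_inner bop \<Rightarrow> 'h bop \<Rightarrow> 'h bop" where
  "grading \<Gamma> a = \<Gamma> * a * \<Gamma>"

text \<open>
  For a self-adjoint unitary \<open>\<Gamma>\<close>, the following are the unique \<open>a\<^sub>+\<close>, \<open>a\<^sub>-\<close> with
  \<open>a = a\<^sub>+ + a\<^sub>-\<close> and \<open>\<Gamma> a\<^sub>+ \<Gamma> = a\<^sub>+\<close>, \<open>\<Gamma> a\<^sub>- \<Gamma> = - a\<^sub>-\<close>.
\<close>

definition even_part :: "'h :: complex_inner bop \<Rightarrow> 'h bop \<Rightarrow> 'h bop" where
  "even_part \<Gamma> a = (1 / 2) *\<^sub>R (a + grading \<Gamma> a)"

definition odd_part :: "'h :: complex_inner bop \<Rightarrow> 'h bop \<Rightarrow> 'h bop" where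
  "odd_part \<Gamma> a = (1 / 2) *\<^sub>R (a - grading \<Gamma> a)"

definition kappa :: "'h :: complex_inner bop \<Rightarrow> 'h bop \<Rightarrow> 'h bop" where
  "kappa \<Gamma> a = even_part \<Gamma> a + \<Gamma> * odd_part \<Gamma> a"

definition eta :: "'h :: complex_inner bop \<Rightarrow> 'h bop \<Rightarrow> 'h bop" where
  "eta \<Gamma> a = even_part \<Gamma> a + \<i> *\<^sub>C (\<Gamma> * odd_part \<Gamma> a)"

definition twisted_commutant :: "'h :: complex_inner bop \<Rightarrow> 'h bop set \<Rightarrow> 'h bop set" where
  "twisted_commutant \<Gamma> M = kappa \<Gamma> ` commutant M"

text \<open>
  \<open>is_dual_value M \<xi> \<zeta> \<Psi> b' c\<close> says that \<open>c\<close> is the value at \<open>b'\<close> of the dual of \<open>\<Psi> : M \<rightarrow> N\<close>,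
  where \<open>\<xi>\<close>, \<open>\<zeta>\<close> are the vectors belonging to \<open>M\<close>, \<open>N\<close>.  It is meant for \<open>b'\<close> in \<open>commutant N\<close>;
  outside that set \<open>dual_map\<close> is irrelevant.
\<close>

definition is_dual_value :: "'h :: chilbert_space bop set \<Rightarrow> 'h \<Rightarrow> 'k :: chilbert_space \<Rightarrow>
    ('h bop \<Rightarrow> 'k bop) \<Rightarrow> 'k bop \<Rightarrow> 'h bop \<Rightarrow> bool" where
  "is_dual_value M \<xi> \<zeta> \<Psi> b' c \<longleftrightarrow>
    c \<in> commutant M \<and> (\<forall>a\<in>M. cinner (c \<cdot> a \<cdot> \<xi>) \<xi> = cinner (b' \<cdot> \<Psi> a \<cdot> \<zeta>) \<zeta>)"

definition dual_map :: "'h :: chilbert_space bop set \<Rightarrow> 'h \<Rightarrow> 'k :: chilbert_space \<Rightarrow>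
    ('h bop \<Rightarrow> 'k bop) \<Rightarrow> 'k bop \<Rightarrow> 'h bop" where
  "dual_map M \<xi> \<zeta> \<Psi> b' = (THE c. is_dual_value M \<xi> \<zeta> \<Psi> b' c)"

definition twisted_dual :: "'h :: chilbert_space bop set \<Rightarrow> 'h bop \<Rightarrow> 'h \<Rightarrow>
    'k :: chilbert_space bop \<Rightarrow> 'k \<Rightarrow> ('h bop \<Rightarrow> 'k bop) \<Rightarrow> 'k bop \<Rightarrow> 'h bop" where
  "twisted_dual M \<Gamma>\<^sub>M \<xi> \<Gamma>\<^sub>N \<zeta> \<Psi> = kappa \<Gamma>\<^sub>M \<circ> dual_map M \<xi> \<zeta> \<Psi> \<circ> kappa \<Gamma>\<^sub>N"

end

theory Submission
  imports Defs
begin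

text \<open>
  The value of the dual map at a positive \<open>b\<close> in the commutant of \<open>N\<close> is a Radon--Nikodym derivative:
  the form \<open>(a, c) \<mapsto> \<langle>b \<Psi>(c\<^sup>* a) \<xi>\<^sub>\<nu>, \<xi>\<^sub>\<nu>\<rangle>\<close> on \<open>M\<close> is positive and dominated by
  \<open>\<parallel>b\<parallel> \<langle>a \<xi>\<^sub>\<mu>, c \<xi>\<^sub>\<mu>\<rangle>\<close>, hence is given by a bounded operator in the commutant of \<open>M\<close>.  Since the
  commutant of \<open>N\<close> is spanned by its positive elements, the dual is defined everywhere.

  Positivity of this form, as well as \<open>n\<close>-positivity of the dual, is an instance of one statement
  (\<open>commuting_product_nonneg\<close>): if \<open>A\<close>, \<open>B\<close> are positive operator matrices and the entries of \<open>A\<close>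
  commute with those of \<open>B\<close>, then \<open>\<Sum>\<^sub>i\<^sub>j B\<^sub>i\<^sub>j A\<^sub>i\<^sub>j\<close> is positive.  It is applied to a positive
  matrix \<open>B\<close> over the commutant of \<open>N\<close> and to \<open>A\<^sub>i\<^sub>j = \<Psi>(a\<^sub>i\<^sup>* a\<^sub>j)\<close>.  Square roots are avoided
  by expanding \<open>A\<close> into a strongly convergent series of squares of Hermitian matrices.

  The grading unitaries fix \<open>\<xi>\<^sub>\<mu>\<close> and \<open>\<xi>\<^sub>\<nu>\<close>, so the dual of an equivariant map is equivariant and
  respects even and odd parts.  Consequently \<open>twist \<Gamma>\<^sub>\<mu> c \<circ> dual \<circ> twist \<Gamma>\<^sub>\<nu> d\<close>, where
  \<open>twist \<Gamma> c a = a\<^sub>+ + c \<Gamma> a\<^sub>-\<close>, depends on \<open>c d\<close> only.  For \<open>c = d = 1\<close> this is the twisted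
  dual, and for \<open>(c, d) = (\<i>, - \<i>)\<close> or \<open>(- \<i>, \<i>)\<close> it is the formula in terms of \<open>eta\<close>.  As
  \<open>eta\<close> is implemented by a unitary, the twisted dual inherits \<open>n\<close>-positivity from the dual.
  Moreover \<open>kappa\<close> and \<open>eta\<close> map an invariant von Neumann algebra onto the same set, so twisted
  commutants are von Neumann algebras, and twisting commutes with passage to the commutant.

  The twisted dual is positive and unital, so its norm is \<open>1\<close> by the Russo--Dye theorem
  (\<open>positive_unital_contractive\<close>).  This is proved directly for contractions: the Fejer kernel of
  a contraction \<open>a\<close> is a positive operator, and its Fourier coefficients of orders \<open>0\<close> and \<open>1\<close> are
  \<open>1\<close> and, up to a factor that tends to \<open>1\<close>, \<open>a\<close>.

  If the vectors are separating, they are cyclic for the commutants and thus for the twisted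
  commutants.  The construction then applies to the twisted dual, and the twisted dual of the latter
  is identified with \<open>\<Psi>\<close> by the uniqueness of dual values.
\<close>

section \<open>The Hermitian form\<close>

lemma cinner_add_right: "cinner x (y + z) = cinner x y + cinner x (z :: 'a :: complex_inner)"
  by (metis cinner_add_left cinner_commute complex_cnj_add)

lemma cinner_scaleC_right: "cinner x (c *\<^sub>C y) = cnj c * cinner x (y :: 'a :: complex_inner)"
  by (metis cinner_commute cinner_scaleC_left complex_cnj_mult)

lemma cinner_zero_left [simp]: "cinner 0 (y :: 'a :: complex_inner) = 0"
  by (metis add_cancel_right_right cinner_add_left)

lemma cinner_zero_right [simp]: "cinner (x :: 'a :: complex_inner) 0 = 0"
  by (metis add_cancel_right_right cinner_add_right)

lemma cinner_minus_left: "cinner (- x) y = - cinner x (y :: 'a :: complex_inner)"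
  by (metis add.right_inverse add_eq_0_iff cinner_add_left cinner_zero_left)

lemma cinner_minus_right: "cinner x (- y) = - cinner x (y :: 'a :: complex_inner)"
  by (metis add.right_inverse add_eq_0_iff cinner_add_right cinner_zero_right)

lemma cinner_diff_left: "cinner (x - z) y = cinner x y - cinner z (y :: 'a :: complex_inner)"
  by (metis cinner_add_left cinner_minus_left diff_conv_add_uminus)

lemma cinner_diff_right: "cinner y (x - z) = cinner y x - cinner y (z :: 'a :: complex_inner)"
  by (metis cinner_add_right cinner_minus_right diff_conv_add_uminus)

lemma cinner_sum_left: "cinner (\<Sum>i\<in>I. f i) y = (\<Sum>i\<in>I. cinner (f i) (y :: 'a :: complex_inner))"
  by (induction I rule: infinite_finite_induct) (auto simp: cinner_add_left)

lemma cinner_sum_right: "cinner y (\<Sum>i\<in>I. f i) = (\<Sum>i\<in>I. cinner (y :: 'a :: complex_inner) (f i))"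
  by (induction I rule: infinite_finite_induct) (auto simp: cinner_add_right)

lemma cinner_scaleR_left: "cinner (r *\<^sub>R x) y = of_real r * cinner x (y :: 'a :: complex_inner)"
  by (simp add: scaleR_scaleC cinner_scaleC_left)

lemma cinner_scaleR_right: "cinner x (r *\<^sub>R y) = of_real r * cinner x (y :: 'a :: complex_inner)"
  by (simp add: scaleR_scaleC cinner_scaleC_right)

lemmas cinner_simps = cinner_add_left cinner_add_right cinner_diff_left cinner_diff_right
  cinner_minus_left cinner_minus_right cinner_scaleC_left cinner_scaleC_right
  cinner_scaleR_left cinner_scaleR_right

lemma cinner_self: "cinner x x = of_real ((norm (x :: 'a :: complex_inner))\<^sup>2)"
proof -
  have "Im (cinner x x) = 0"
    using arg_cong[OF cinner_commute[of x x], of Im] by simp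
  thus ?thesis
    by (simp add: complex_eq_iff Re_cinner power2_norm_eq_inner)
qed

lemma cinner_ext: "(\<And>y. cinner x y = cinner x' y) \<Longrightarrow> x = (x' :: 'a :: complex_inner)"
  by (metis cinner_diff_left cinner_self eq_iff_diff_eq_0 norm_eq_zero of_real_eq_0_iff
      power_eq_0_iff)

text \<open>
  A positive semidefinite binary form is Hermitian and satisfies the Cauchy--Schwarz inequality.
  The statement concerns only the four coefficients, so that it applies to forms on any space.
\<close>

lemma nonneg_binary_form:
  assumes nonneg: "\<And>\<alpha> \<beta>. \<alpha> * cnj \<alpha> * A + \<alpha> * cnj \<beta> * p + \<beta> * cnj \<alpha> * q + \<beta> * cnj \<beta> * B \<in> \<real>\<^sub>\<ge>\<^sub>0"
  shows "q = cnj p" and "(cmod p)\<^sup>2 \<le> Re A * Re B"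
proof -
  have A: "Re A \<ge> 0" "Im A = 0"
    using nonneg[of 1 0] by (auto simp: complex_nonneg_Reals_iff)
  have B: "Re B \<ge> 0" "Im B = 0"
    using nonneg[of 0 1] by (auto simp: complex_nonneg_Reals_iff)
  have "Im p + Im q = 0"
    using nonneg[of 1 1] A B by (auto simp: complex_nonneg_Reals_iff)
  moreover have "Re q = Re p"
    using nonneg[of 1 \<i>] A B by (auto simp: complex_nonneg_Reals_iff)
  ultimately show q: "q = cnj p"
    by (simp add: complex_eq_iff)
  define P where "P = (cmod p)\<^sup>2"
  have Pp: "cnj p * p = of_real P" "p * cnj p = of_real P"
    by (simp_all add: P_def complex_norm_square mult.commute del: of_real_power)
  have *: "t\<^sup>2 * P * Re A + 2 * t * P + Re B \<ge> 0" for t :: real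
  proof -
    have "of_real t * cnj p * cnj (of_real t * cnj p) * A + of_real t * cnj p * cnj 1 * p
        + 1 * cnj (of_real t * cnj p) * q + 1 * cnj 1 * B
      = of_real (t\<^sup>2) * (cnj p * p) * A + of_real t * (cnj p * p) + of_real t * (p * cnj p) + B"
      by (simp add: q power2_eq_square algebra_simps)
    also have "Re \<dots> = t\<^sup>2 * P * Re A + 2 * t * P + Re B"
      by (simp add: Pp flip: of_real_mult of_real_add)
    finally show ?thesis
      using nonneg[of "of_real t * cnj p" 1] by (auto simp: complex_nonneg_Reals_iff)
  qed
  have "P \<ge> 0"
    by (simp add: P_def)
  show "P \<le> Re A * Re B"
  proof (cases "Re A = 0")
    case True
    have "2 * (- (Re B + 1) / (2 * P)) * P + Re B \<ge> 0"
      using *[of "- (Re B + 1) / (2 * P)"] True by simp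
    hence "P = 0"
      using \<open>P \<ge> 0\<close> by (cases "P = 0") (auto simp: field_simps)
    thus ?thesis
      using True by simp
  next
    case False
    hence "Re A > 0"
      using A by simp
    have "(- 1 / Re A)\<^sup>2 * P * Re A + 2 * (- 1 / Re A) * P + Re B = Re B - P / Re A"
      using \<open>Re A > 0\<close> by (simp add: field_simps power2_eq_square)
    hence "P / Re A \<le> Re B"
      using *[of "- 1 / Re A"] by simp
    thus ?thesis
      using \<open>Re A > 0\<close> by (simp add: field_simps)
  qed
qed

lemma nonneg_form_Cauchy_Schwarz:
  fixes s :: "'v :: complex_vector \<Rightarrow> 'v \<Rightarrow> complex"
  assumes S: "\<And>x y. x \<in> S \<Longrightarrow> y \<in> S \<Longrightarrow> x + y \<in> S" "\<And>c x. x \<in> S \<Longrightarrow> c *\<^sub>C x \<in> S"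
    and add: "\<And>x y z. x \<in> S \<Longrightarrow> y \<in> S \<Longrightarrow> z \<in> S \<Longrightarrow> s (x + y) z = s x z + s y z"
      "\<And>x y z. x \<in> S \<Longrightarrow> y \<in> S \<Longrightarrow> z \<in> S \<Longrightarrow> s z (x + y) = s z x + s z y"
    and scale: "\<And>c x y. x \<in> S \<Longrightarrow> y \<in> S \<Longrightarrow> s (c *\<^sub>C x) y = c * s x y"
      "\<And>c x y. x \<in> S \<Longrightarrow> y \<in> S \<Longrightarrow> s x (c *\<^sub>C y) = cnj c * s x y"
    and nonneg: "\<And>x. x \<in> S \<Longrightarrow> s x x \<in> \<real>\<^sub>\<ge>\<^sub>0"
    and xy: "x \<in> S" "y \<in> S"
  shows "(cmod (s x y))\<^sup>2 \<le> Re (s x x) * Re (s y y)"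
proof (rule nonneg_binary_form(2)[where q = "s y x"])
  fix \<alpha> \<beta> :: complex
  have "s (\<alpha> *\<^sub>C x + \<beta> *\<^sub>C y) (\<alpha> *\<^sub>C x + \<beta> *\<^sub>C y) =
      \<alpha> * cnj \<alpha> * s x x + \<alpha> * cnj \<beta> * s x y + \<beta> * cnj \<alpha> * s y x + \<beta> * cnj \<beta> * s y y"
    using xy by (simp add: S add scale algebra_simps)
  thus "\<alpha> * cnj \<alpha> * s x x + \<alpha> * cnj \<beta> * s x y + \<beta> * cnj \<alpha> * s y x + \<beta> * cnj \<beta> * s y y \<in> \<real>\<^sub>\<ge>\<^sub>0"
    using nonneg[of "\<alpha> *\<^sub>C x + \<beta> *\<^sub>C y"] xy S by simp
qed

lemma cmod_cinner_le: "cmod (cinner x y) \<le> norm x * norm (y :: 'a :: complex_inner)"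
proof -
  have "(cmod (cinner x y))\<^sup>2 \<le> Re (cinner x x) * Re (cinner y y)"
    by (rule nonneg_form_Cauchy_Schwarz[where S = UNIV]) (auto simp: cinner_simps cinner_self)
  thus ?thesis
    by (simp add: cinner_self power_mult_distrib[symmetric] abs_le_square_iff[symmetric])
qed

lemma bounded_bilinear_cinner: "bounded_bilinear (cinner :: 'a :: complex_inner \<Rightarrow> 'a \<Rightarrow> complex)"
proof
  show "\<exists>K. \<forall>a b :: 'a. norm (cinner a b) \<le> norm a * norm b * K"
    by (rule exI[of _ 1]) (simp add: cmod_cinner_le)
qed (simp_all add: cinner_simps scaleR_conv_of_real)

lemmas tendsto_cinner = bounded_bilinear.tendsto[OF bounded_bilinear_cinner]

section \<open>Bounded operators\<close>

lemmas bop_apply_simps [simp] = zero_bop.rep_eq plus_bop.rep_eq minus_bop.rep_eq uminus_bop.rep_eq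
  scaleR_bop.rep_eq scaleC_bop.rep_eq one_bop.rep_eq times_bop.rep_eq

lemma bop_add_right: "(a :: 'h :: complex_inner bop) \<cdot> (x + y) = a \<cdot> x + a \<cdot> y"
  by (rule linear_add[OF bounded_linear.linear[OF bounded_linear_bop]])

lemma bop_diff_right: "(a :: 'h :: complex_inner bop) \<cdot> (x - y) = a \<cdot> x - a \<cdot> y"
  by (rule linear_diff[OF bounded_linear.linear[OF bounded_linear_bop]])

lemma bop_minus_right: "(a :: 'h :: complex_inner bop) \<cdot> (- x) = - (a \<cdot> x)"
  by (rule linear_neg[OF bounded_linear.linear[OF bounded_linear_bop]])

lemma bop_zero_right [simp]: "(a :: 'h :: complex_inner bop) \<cdot> 0 = 0"
  by (rule linear_0[OF bounded_linear.linear[OF bounded_linear_bop]])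

lemma bop_scaleR: "(a :: 'h :: complex_inner bop) \<cdot> (r *\<^sub>R x) = r *\<^sub>R (a \<cdot> x)"
  by (rule linear_cmul[OF bounded_linear.linear[OF bounded_linear_bop]])

lemma bop_sum_right: "(a :: 'h :: complex_inner bop) \<cdot> (\<Sum>i\<in>I. f i) = (\<Sum>i\<in>I. a \<cdot> f i)"
  by (rule linear_sum[OF bounded_linear.linear[OF bounded_linear_bop]])

lemma sum_bop_apply: "(\<Sum>i\<in>I. f i :: 'h :: complex_inner bop) \<cdot> x = (\<Sum>i\<in>I. f i \<cdot> x)"
  by (induction I rule: infinite_finite_induct) auto

lemmas bop_linear_simps = bop_add_right bop_diff_right bop_minus_right bop_scaleC bop_scaleR
  bop_sum_right

lemma bop_mult_scaleC_left [simp]: "(c *\<^sub>C a) * b = c *\<^sub>C (a * (b :: 'h :: complex_inner bop))"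
  by (rule bop_eqI) simp

lemma bop_mult_scaleC_right [simp]: "a * (c *\<^sub>C b) = c *\<^sub>C (a * (b :: 'h :: complex_inner bop))"
  by (rule bop_eqI) (simp add: bop_scaleC)

lemma norm_bop_apply_le: "norm (a \<cdot> x) \<le> norm a * norm (x :: 'h :: complex_inner)"
  by (simp add: norm_bop.rep_eq onorm bounded_linear_bop)

lemma norm_bop_leI:
  assumes "\<And>x. norm ((a :: 'h :: complex_inner bop) \<cdot> x) \<le> K * norm x" "0 \<le> K"
  shows "norm a \<le> K"
  using assms by (simp add: norm_bop.rep_eq onorm_bound)

lemma scaleC_minus_left: "(- c) *\<^sub>C x = - (c *\<^sub>C (x :: 'a :: complex_vector))"
  using scaleC_add_left[of "- c" c x] scaleC_add_left[of 0 0 x] by (simp add: eq_neg_iff_add_eq_0)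

lemma scaleC_of_real: "complex_of_real r *\<^sub>C x = r *\<^sub>R (x :: 'a :: complex_vector)"
  by (simp add: scaleR_scaleC)

lemma bop_exists:
  fixes g :: "'h :: complex_inner \<Rightarrow> 'h"
  assumes "\<And>x y. g (x + y) = g x + g y" "\<And>c x. g (c *\<^sub>C x) = c *\<^sub>C g x"
    "\<And>x. norm (g x) \<le> K * norm x"
  shows "\<exists>T. \<forall>x. T \<cdot> x = g x"
proof -
  have "bounded_linear g"
    using assms by (intro bounded_linear_intro[where K = K])
      (auto simp: scaleR_scaleC mult.commute)
  thus ?thesis
    using assms(2) Bop_inverse[of g] by (intro exI[of _ "Bop g"]) auto
qed

section \<open>The Riesz representation theorem\<close>

text \<open>
  The vector representing \<open>f\<close> is the limit of a minimising sequence for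
  \<open>\<parallel>u a\<parallel>\<^sup>2 - 2 f a\<close>.  The functional is given on a space of parameters \<open>a\<close> for the vectors
  \<open>u a\<close>, so that the statement covers functionals on all of the space (\<open>u\<close> the identity) as well as
  those on orbits \<open>M \<xi>\<close> (\<open>u a = a \<cdot> \<xi>\<close>), and no completeness or density of the range of \<open>u\<close> is
  required.
\<close>

lemma riesz_real:
  fixes u :: "'i :: real_vector \<Rightarrow> 'h :: {real_inner, complete_space}" and f :: "'i \<Rightarrow> real"
  assumes I: "0 \<in> I" "\<And>a b. a \<in> I \<Longrightarrow> b \<in> I \<Longrightarrow> a + b \<in> I" "\<And>r a. a \<in> I \<Longrightarrow> r *\<^sub>R a \<in> I"
    and u: "\<And>a b. a \<in> I \<Longrightarrow> b \<in> I \<Longrightarrow> u (a + b) = u a + u b" "\<And>r a. a \<in> I \<Longrightarrow> u (r *\<^sub>R a) = r *\<^sub>R u a"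
    and f: "\<And>a b. a \<in> I \<Longrightarrow> b \<in> I \<Longrightarrow> f (a + b) = f a + f b" "\<And>r a. a \<in> I \<Longrightarrow> f (r *\<^sub>R a) = r * f a"
    and bound: "\<And>a. a \<in> I \<Longrightarrow> \<bar>f a\<bar> \<le> K * norm (u a)"
  obtains z where "z \<in> closure (u ` I)" "\<And>a. a \<in> I \<Longrightarrow> f a = inner (u a) z" "norm z \<le> \<bar>K\<bar>"
proof -
  define J where "J = (\<lambda>a. (norm (u a))\<^sup>2 - 2 * f a)"
  define m where "m = Inf (J ` I)"
  have J_lower: "- K\<^sup>2 \<le> J a" if "a \<in> I" for a
  proof -
    have "0 \<le> (norm (u a) - K)\<^sup>2"
      by simp
    thus ?thesis
      using bound[OF that] by (simp add: J_def power2_eq_square algebra_simps)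
  qed
  have bdd: "bdd_below (J ` I)"
    using J_lower by (intro bdd_belowI[of _ "- K\<^sup>2"]) auto
  have m_le: "m \<le> J a" if "a \<in> I" for a
    unfolding m_def using that bdd by (intro cInf_lower) auto
  have "\<exists>a\<in>I. J a < m + 1 / (Suc k)" for k
  proof -
    have "Inf (J ` I) < m + 1 / (Suc k)"
      by (simp add: m_def)
    thus ?thesis
      using I(1) bdd by (subst (asm) cInf_less_iff) auto
  qed
  then obtain a where aI: "\<And>k. a k \<in> I" and aJ: "\<And>k. J (a k) < m + 1 / (Suc k)"
    by metis
  have parallelogram: "(norm (u b - u c))\<^sup>2 = 2 * J b + 2 * J c - 4 * J ((1/2) *\<^sub>R (b + c))"
    if "b \<in> I" "c \<in> I" for b c
    using that by (simp add: J_def u f I power2_norm_eq_inner inner_simps algebra_simps inner_commute)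
  have dist_bound: "(norm (u (a k) - u (a l)))\<^sup>2 \<le> 2 / Suc k + 2 / Suc l" for k l
    using parallelogram[OF aI aI, of k l] aJ[of k] aJ[of l]
      m_le[OF I(3)[OF I(2)[OF aI aI]], of "1/2" k l] by simp
  have "Cauchy (\<lambda>k. u (a k))"
  proof (rule metric_CauchyI)
    fix e :: real assume "e > 0"
    obtain L where L: "4 / e\<^sup>2 < real L"
      using reals_Archimedean2 by blast
    have "dist (u (a k)) (u (a l)) < e" if "k \<ge> L" "l \<ge> L" for k l
    proof -
      have "4 < e\<^sup>2 * real L"
        using L \<open>e > 0\<close> by (simp add: field_simps)
      hence Lpos: "real L > 0"
        by (cases "L = 0") auto
      hence small: "4 / real L < e\<^sup>2"
        using \<open>4 < e\<^sup>2 * real L\<close> by (simp add: field_simps)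
      have "2 / Suc k \<le> 2 / real L" "2 / Suc l \<le> 2 / real L"
        using that Lpos by (auto intro!: divide_left_mono)
      hence "(norm (u (a k) - u (a l)))\<^sup>2 < e\<^sup>2"
        using dist_bound[of k l] small by simp
      thus ?thesis
        using \<open>e > 0\<close> by (simp add: dist_norm power_less_imp_less_base)
    qed
    thus "\<exists>L. \<forall>k\<ge>L. \<forall>l\<ge>L. dist (u (a k)) (u (a l)) < e"
      by blast
  qed
  then obtain z where z: "(\<lambda>k. u (a k)) \<longlonglongrightarrow> z"
    using Cauchy_convergent convergentD by blast
  have z_closure: "z \<in> closure (u ` I)"
    using z aI by (auto simp: closure_sequential intro!: exI[of _ "\<lambda>k. u (a k)"])
  have Jm: "(\<lambda>k. J (a k)) \<longlonglongrightarrow> m"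
  proof (rule tendsto_sandwich)
    show "\<forall>\<^sub>F k in sequentially. m \<le> J (a k)"
      by (simp add: m_le aI)
    show "\<forall>\<^sub>F k in sequentially. J (a k) \<le> m + inverse (real (Suc k))"
      using aJ by (intro always_eventually allI less_imp_le) (simp add: inverse_eq_divide)
    show "(\<lambda>k. m + inverse (real (Suc k))) \<longlonglongrightarrow> m"
      using tendsto_add[OF tendsto_const LIMSEQ_inverse_real_of_nat, of m] by simp
  qed simp
  have fz: "f c = inner (u c) z" if c: "c \<in> I" for c
  proof -
    define d where "d = inner z (u c) - f c"
    have quad: "0 \<le> 2 * t * d + t\<^sup>2 * (norm (u c))\<^sup>2" for t
    proof -
      have "m \<le> J (a k) + 2 * t * (inner (u (a k)) (u c) - f c) + t\<^sup>2 * (norm (u c))\<^sup>2" for k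
      proof -
        have "J (a k + t *\<^sub>R c) = J (a k) + 2 * t * (inner (u (a k)) (u c) - f c) + t\<^sup>2 * (norm (u c))\<^sup>2"
          using aI c by (simp add: J_def u f I power2_norm_eq_inner inner_simps algebra_simps
              inner_commute power2_eq_square[of t])
        thus ?thesis
          using m_le[of "a k + t *\<^sub>R c"] I aI c by simp
      qed
      moreover have "(\<lambda>k. J (a k) + 2 * t * (inner (u (a k)) (u c) - f c) + t\<^sup>2 * (norm (u c))\<^sup>2)
          \<longlonglongrightarrow> m + 2 * t * (inner z (u c) - f c) + t\<^sup>2 * (norm (u c))\<^sup>2"
        by (intro tendsto_intros Jm z)
      ultimately have "m \<le> m + 2 * t * (inner z (u c) - f c) + t\<^sup>2 * (norm (u c))\<^sup>2"
        by (intro LIMSEQ_le_const) auto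
      thus ?thesis
        by (simp add: d_def)
    qed
    define q where "q = (norm (u c))\<^sup>2 + 1"
    have q: "q > 0"
      by (simp add: q_def add_nonneg_pos)
    have "0 \<le> 2 * (- d / q) * d + (- d / q)\<^sup>2 * (norm (u c))\<^sup>2"
      by (rule quad)
    also have "\<dots> \<le> 2 * (- d / q) * d + (- d / q)\<^sup>2 * q"
      by (intro add_left_mono mult_left_mono) (auto simp: q_def)
    also have "\<dots> = - d\<^sup>2 / q"
      using q by (simp add: power2_eq_square field_simps)
    finally have "d = 0"
      using q by (simp add: field_simps)
    thus ?thesis
      by (simp add: d_def inner_commute)
  qed
  have "closed {v. inner v z \<le> \<bar>K\<bar> * norm v}"
    by (intro closed_Collect_le continuous_intros)
  moreover have "u ` I \<subseteq> {v. inner v z \<le> \<bar>K\<bar> * norm v}"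
  proof safe
    fix c assume "c \<in> I"
    have "inner (u c) z \<le> K * norm (u c)"
      using bound[OF \<open>c \<in> I\<close>] fz[OF \<open>c \<in> I\<close>] by simp
    also have "\<dots> \<le> \<bar>K\<bar> * norm (u c)"
      by (intro mult_right_mono) auto
    finally show "inner (u c) z \<le> \<bar>K\<bar> * norm (u c)" .
  qed
  ultimately have "inner z z \<le> \<bar>K\<bar> * norm z"
    using z_closure closure_minimal by blast
  hence "norm z * norm z \<le> \<bar>K\<bar> * norm z"
    by (simp add: dot_square_norm power2_eq_square)
  hence "norm z \<le> \<bar>K\<bar>"
    by (cases "norm z = 0") (auto simp: mult_le_cancel_right)
  with z_closure fz show thesis
    by (rule that)
qed

lemma riesz:
  fixes u :: "'i :: complex_vector \<Rightarrow> 'h :: chilbert_space" and f :: "'i \<Rightarrow> complex"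
  assumes I: "0 \<in> I" "\<And>a b. a \<in> I \<Longrightarrow> b \<in> I \<Longrightarrow> a + b \<in> I" "\<And>c a. a \<in> I \<Longrightarrow> c *\<^sub>C a \<in> I"
    and u: "\<And>a b. a \<in> I \<Longrightarrow> b \<in> I \<Longrightarrow> u (a + b) = u a + u b" "\<And>c a. a \<in> I \<Longrightarrow> u (c *\<^sub>C a) = c *\<^sub>C u a"
    and f: "\<And>a b. a \<in> I \<Longrightarrow> b \<in> I \<Longrightarrow> f (a + b) = f a + f b" "\<And>c a. a \<in> I \<Longrightarrow> f (c *\<^sub>C a) = c * f a"
    and bound: "\<And>a. a \<in> I \<Longrightarrow> cmod (f a) \<le> K * norm (u a)"
  obtains z where "z \<in> closure (u ` I)" "\<And>a. a \<in> I \<Longrightarrow> f a = cinner (u a) z" "norm z \<le> \<bar>K\<bar>"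
proof -
  obtain z where z: "z \<in> closure (u ` I)" "\<And>a. a \<in> I \<Longrightarrow> Re (f a) = inner (u a) z" "norm z \<le> \<bar>K\<bar>"
  proof (rule riesz_real[of I u "\<lambda>a. Re (f a)" K])
    show "\<bar>Re (f a)\<bar> \<le> K * norm (u a)" if "a \<in> I" for a
      using bound[OF that] abs_Re_le_cmod[of "f a"] by linarith
  qed (auto simp: I u f scaleR_scaleC)
  have "f a = cinner (u a) z" if "a \<in> I" for a
  proof (rule complex_eqI)
    show "Re (f a) = Re (cinner (u a) z)"
      using z(2)[OF that] by (simp add: Re_cinner)
    show "Im (f a) = Im (cinner (u a) z)"
      using z(2)[OF I(3)[OF that, of "\<i>"]] that by (simp add: f u cinner_scaleC_left flip: Re_cinner)
  qed
  with z show thesis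
    using that by blast
qed

section \<open>Adjoints and commutants\<close>

lemma cinner_ext_right: "(\<And>x. cinner x y = cinner x y') \<Longrightarrow> y = (y' :: 'a :: complex_inner)"
  by (metis cinner_commute cinner_ext)

lemma adjoint_exists: "\<exists>b. \<forall>x y. cinner (a \<cdot> x) y = cinner x (b \<cdot> (y :: 'h :: chilbert_space))"
proof -
  have "\<exists>z. (\<forall>x. cinner (a \<cdot> x) y = cinner x z) \<and> norm z \<le> norm a * norm y" for y
  proof -
    obtain z where "\<And>x. cinner (a \<cdot> x) y = cinner x z" "norm z \<le> \<bar>norm a * norm y\<bar>"
    proof (rule riesz[of UNIV "\<lambda>x. x" "\<lambda>x. cinner (a \<cdot> x) y" "norm a * norm y"])
      show "cmod (cinner (a \<cdot> x) y) \<le> norm a * norm y * norm x" for x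
      proof -
        have "norm (a \<cdot> x) * norm y \<le> (norm a * norm x) * norm y"
          by (intro mult_right_mono norm_bop_apply_le) simp
        thus ?thesis
          using cmod_cinner_le[of "a \<cdot> x" y] by (simp add: mult_ac)
      qed
    qed (auto simp: bop_linear_simps cinner_simps)
    thus ?thesis
      by auto
  qed
  then obtain g where g: "\<And>x y. cinner (a \<cdot> x) y = cinner x (g y)" and
    bound: "\<And>y. norm (g y) \<le> norm a * norm y"
    by metis
  have "\<exists>T. \<forall>x. T \<cdot> x = g x"
  proof (rule bop_exists)
    show "g (x + y) = g x + g y" for x y
      by (rule cinner_ext_right) (simp add: cinner_simps flip: g)
    show "g (c *\<^sub>C x) = c *\<^sub>C g x" for c x
      by (rule cinner_ext_right) (simp add: cinner_simps flip: g)
  qed (rule bound)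
  thus ?thesis
    using g by metis
qed

lemma adj_eqI:
  assumes "\<And>x y. cinner (a \<cdot> x) y = cinner x (b \<cdot> (y :: 'h :: chilbert_space))"
  shows "adj a = b"
  unfolding adj_def
proof (rule the_equality)
  show "c = b" if "\<forall>x y. cinner (a \<cdot> x) y = cinner x (c \<cdot> y)" for c
    using that assms by (metis bop_eqI cinner_ext_right)
qed (use assms in blast)

lemma cinner_adj_right: "cinner x (adj a \<cdot> y) = cinner (a \<cdot> x) (y :: 'h :: chilbert_space)"
  using adjoint_exists[of a] adj_eqI by metis

lemma cinner_adj_left: "cinner (adj a \<cdot> x) y = cinner x (a \<cdot> (y :: 'h :: chilbert_space))"
  by (metis cinner_adj_right cinner_commute)

lemma adj_adj [simp]: "adj (adj a) = (a :: 'h :: chilbert_space bop)"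
  by (rule adj_eqI) (simp add: cinner_adj_left)

lemma adj_mult: "adj (a * b) = adj b * adj (a :: 'h :: chilbert_space bop)"
  by (rule adj_eqI) (simp add: cinner_adj_right)

lemma adj_add: "adj (a + b) = adj a + adj (b :: 'h :: chilbert_space bop)"
  by (rule adj_eqI) (simp add: cinner_adj_right cinner_simps)

lemma adj_diff: "adj (a - b) = adj a - adj (b :: 'h :: chilbert_space bop)"
  by (rule adj_eqI) (simp add: cinner_adj_right cinner_simps)

lemma adj_scaleC: "adj (c *\<^sub>C a) = cnj c *\<^sub>C adj (a :: 'h :: chilbert_space bop)"
  by (rule adj_eqI) (simp add: cinner_adj_right cinner_simps)

lemma adj_scaleR: "adj (r *\<^sub>R a) = r *\<^sub>R adj (a :: 'h :: chilbert_space bop)"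
  by (rule adj_eqI) (simp add: cinner_adj_right cinner_simps)

lemma adj_one [simp]: "adj 1 = (1 :: 'h :: chilbert_space bop)"
  by (rule adj_eqI) simp

lemma commutant_zero: "0 \<in> commutant X"
  by (simp add: commutant_def)

lemma commutant_one: "1 \<in> commutant X"
  by (simp add: commutant_def)

lemma commutant_add: "a \<in> commutant X \<Longrightarrow> b \<in> commutant X \<Longrightarrow> a + b \<in> commutant X"
  by (simp add: commutant_def algebra_simps)

lemma commutant_diff: "a \<in> commutant X \<Longrightarrow> b \<in> commutant X \<Longrightarrow> a - b \<in> commutant X"
  by (simp add: commutant_def algebra_simps)

lemma commutant_mult: "a \<in> commutant X \<Longrightarrow> b \<in> commutant X \<Longrightarrow> a * b \<in> commutant X"
  by (simp add: commutant_def) (metis mult.assoc)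

lemma commutant_scaleC: "a \<in> commutant X \<Longrightarrow> c *\<^sub>C a \<in> commutant X"
  by (simp add: commutant_def)

lemma commutant_scaleR: "a \<in> commutant X \<Longrightarrow> r *\<^sub>R a \<in> commutant X"
  by (simp add: scaleR_scaleC commutant_scaleC)

lemma commutant_sum: "(\<And>i. i \<in> I \<Longrightarrow> f i \<in> commutant X) \<Longrightarrow> (\<Sum>i\<in>I. f i) \<in> commutant X"
  by (induction I rule: infinite_finite_induct) (auto simp: commutant_zero commutant_add)

lemma commutant_power: "a \<in> commutant X \<Longrightarrow> a ^ n \<in> commutant X"
  by (induction n) (auto simp: commutant_one commutant_mult)

lemmas commutant_closed = commutant_zero commutant_one commutant_add commutant_diff commutant_mult
  commutant_scaleC commutant_scaleR commutant_sum commutant_power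

lemma commutantD: "b \<in> commutant X \<Longrightarrow> a \<in> X \<Longrightarrow> a * b = b * a"
  by (simp add: commutant_def)

lemma commutant_apply: "b \<in> commutant X \<Longrightarrow> a \<in> X \<Longrightarrow> b \<cdot> a \<cdot> x = a \<cdot> b \<cdot> x"
  by (metis commutantD times_bop.rep_eq)

lemma subset_bicommutant: "X \<subseteq> commutant (commutant X)"
  by (auto simp: commutant_def)

lemma commutant_antimono: "X \<subseteq> Y \<Longrightarrow> commutant Y \<subseteq> commutant X"
  by (auto simp: commutant_def)

lemma triple_commutant: "commutant (commutant (commutant X)) = commutant X"
  using subset_bicommutant[of "commutant X"] commutant_antimono[OF subset_bicommutant[of X]] by blast

lemma adj_commutant:
  fixes X :: "'h :: chilbert_space bop set"
  assumes "\<And>a. a \<in> X \<Longrightarrow> adj a \<in> X" "b \<in> commutant X"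
  shows "adj b \<in> commutant X"
  using assms by (simp add: commutant_def) (metis adj_adj adj_mult)

lemma von_neumann_commutant: "von_neumann_algebra M \<Longrightarrow> von_neumann_algebra (commutant M)"
  by (auto simp: von_neumann_algebra_def triple_commutant intro: adj_commutant)

lemma von_neumann_bicommutant: "von_neumann_algebra M \<Longrightarrow> commutant (commutant M) = M"
  by (simp add: von_neumann_algebra_def)

lemma von_neumann_adj: "von_neumann_algebra M \<Longrightarrow> a \<in> M \<Longrightarrow> adj a \<in> M"
  by (simp add: von_neumann_algebra_def)

lemma
  assumes "von_neumann_algebra M"
  shows von_neumann_zero: "0 \<in> M" and von_neumann_one: "1 \<in> M"
    and von_neumann_add: "a \<in> M \<Longrightarrow> b \<in> M \<Longrightarrow> a + b \<in> M"
    and von_neumann_diff: "a \<in> M \<Longrightarrow> b \<in> M \<Longrightarrow> a - b \<in> M"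
    and von_neumann_mult: "a \<in> M \<Longrightarrow> b \<in> M \<Longrightarrow> a * b \<in> M"
    and von_neumann_scaleC: "a \<in> M \<Longrightarrow> c *\<^sub>C a \<in> M"
    and von_neumann_scaleR: "a \<in> M \<Longrightarrow> r *\<^sub>R a \<in> M"
    and von_neumann_sum: "(\<And>i. i \<in> I \<Longrightarrow> f i \<in> M) \<Longrightarrow> (\<Sum>i\<in>I. f i) \<in> M"
    and von_neumann_power: "a \<in> M \<Longrightarrow> a ^ n \<in> M"
  using commutant_closed(1-7,9)[where X = "commutant M"]
    commutant_sum[of I f "commutant M"]
  by (simp_all add: von_neumann_bicommutant[OF assms])

lemmas von_neumann_closed = von_neumann_zero von_neumann_one von_neumann_add von_neumann_diff
  von_neumann_mult von_neumann_scaleC von_neumann_scaleR von_neumann_sum von_neumann_power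
  von_neumann_adj

section \<open>Cyclic vectors and operators given by forms\<close>

lemma eq_on_cyclic:
  assumes "cyclic_vector M \<xi>" "\<And>a. a \<in> M \<Longrightarrow> cinner x (a \<cdot> \<xi>) = cinner y (a \<cdot> \<xi>)"
  shows "x = y"
proof -
  have "closed {v. inner (x - y) v = 0}"
    by (intro closed_Collect_eq continuous_intros)
  moreover have "(\<lambda>a. a \<cdot> \<xi>) ` M \<subseteq> {v. inner (x - y) v = 0}"
    using assms(2) by (auto simp flip: Re_cinner simp: cinner_diff_left)
  ultimately have "closure ((\<lambda>a. a \<cdot> \<xi>) ` M) \<subseteq> {v. inner (x - y) v = 0}"
    by (rule closure_minimal[rotated])
  hence "x - y \<in> {v. inner (x - y) v = 0}"
    using assms(1) unfolding cyclic_vector_def by blast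
  thus ?thesis
    by simp
qed

lemma bop_eq_on_cyclic:
  assumes "cyclic_vector M \<xi>" "\<And>a. a \<in> M \<Longrightarrow> S \<cdot> a \<cdot> \<xi> = T \<cdot> a \<cdot> \<xi>"
  shows "S = T"
proof (rule bop_eqI)
  fix x
  have "closed {v. S \<cdot> v = T \<cdot> v}"
    by (intro closed_Collect_eq linear_continuous_on bounded_linear_bop)
  moreover have "(\<lambda>a. a \<cdot> \<xi>) ` M \<subseteq> {v. S \<cdot> v = T \<cdot> v}"
    using assms(2) by auto
  ultimately have "closure ((\<lambda>a. a \<cdot> \<xi>) ` M) \<subseteq> {v. S \<cdot> v = T \<cdot> v}"
    by (rule closure_minimal[rotated])
  thus "S \<cdot> x = T \<cdot> x"
    using assms(1) by (auto simp: cyclic_vector_def)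
qed

text \<open>
  The form is given on pairs of operators; the bound makes it descend to the vectors of the orbit
  \<open>M \<xi>\<close>, and density of the orbit gives the operator on the whole space.
\<close>

lemma form_operator_exists:
  fixes M :: "'h :: chilbert_space bop set" and s :: "'h bop \<Rightarrow> 'h bop \<Rightarrow> complex"
  assumes M: "von_neumann_algebra M" and cyc: "cyclic_vector M \<xi>"
    and add: "\<And>x y z. x \<in> M \<Longrightarrow> y \<in> M \<Longrightarrow> z \<in> M \<Longrightarrow> s (x + y) z = s x z + s y z"
      "\<And>x y z. x \<in> M \<Longrightarrow> y \<in> M \<Longrightarrow> z \<in> M \<Longrightarrow> s z (x + y) = s z x + s z y"
    and scale: "\<And>c x y. x \<in> M \<Longrightarrow> y \<in> M \<Longrightarrow> s (c *\<^sub>C x) y = c * s x y"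
      "\<And>c x y. x \<in> M \<Longrightarrow> y \<in> M \<Longrightarrow> s x (c *\<^sub>C y) = cnj c * s x y"
    and bound: "\<And>x y. x \<in> M \<Longrightarrow> y \<in> M \<Longrightarrow> cmod (s x y) \<le> K * norm (x \<cdot> \<xi>) * norm (y \<cdot> \<xi>)"
    and "K \<ge> 0"
  shows "\<exists>T. \<forall>a\<in>M. \<forall>c\<in>M. cinner (T \<cdot> a \<cdot> \<xi>) (c \<cdot> \<xi>) = s a c"
proof -
  have "\<exists>z. (\<forall>c\<in>M. s a c = cinner z (c \<cdot> \<xi>)) \<and> norm z \<le> K * norm (a \<cdot> \<xi>)" if a: "a \<in> M" for a
  proof -
    obtain z where "\<And>c. c \<in> M \<Longrightarrow> cnj (s a c) = cinner (c \<cdot> \<xi>) z" "norm z \<le> \<bar>K * norm (a \<cdot> \<xi>)\<bar>"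
      by (rule riesz[of M "\<lambda>c. c \<cdot> \<xi>" "\<lambda>c. cnj (s a c)" "K * norm (a \<cdot> \<xi>)"])
        (auto simp: von_neumann_closed[OF M] add scale bound a)
    thus ?thesis
      using \<open>K \<ge> 0\<close> by (metis abs_mult abs_norm_cancel abs_of_nonneg cinner_commute complex_cnj_cnj)
  qed
  then obtain t where t: "\<And>a c. a \<in> M \<Longrightarrow> c \<in> M \<Longrightarrow> s a c = cinner (t a) (c \<cdot> \<xi>)"
    and t_bound: "\<And>a. a \<in> M \<Longrightarrow> norm (t a) \<le> K * norm (a \<cdot> \<xi>)"
    by metis
  have t_add: "t (a + b) = t a + t b" if "a \<in> M" "b \<in> M" for a b
    using that by (intro eq_on_cyclic[OF cyc])
      (simp add: cinner_simps add von_neumann_closed[OF M] flip: t)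
  have t_scale: "t (c *\<^sub>C a) = c *\<^sub>C t a" if "a \<in> M" for a c
    using that by (intro eq_on_cyclic[OF cyc])
      (simp add: cinner_simps scale von_neumann_closed[OF M] flip: t)
  have "\<exists>w. (\<forall>a\<in>M. cinner (t a) y = cinner (a \<cdot> \<xi>) w) \<and> norm w \<le> K * norm y" for y
  proof -
    obtain w where "\<And>a. a \<in> M \<Longrightarrow> cinner (t a) y = cinner (a \<cdot> \<xi>) w" "norm w \<le> \<bar>K * norm y\<bar>"
    proof (rule riesz[of M "\<lambda>a. a \<cdot> \<xi>" "\<lambda>a. cinner (t a) y" "K * norm y"])
      show "cmod (cinner (t a) y) \<le> K * norm y * norm (a \<cdot> \<xi>)" if "a \<in> M" for a
      proof -
        have "norm (t a) * norm y \<le> (K * norm (a \<cdot> \<xi>)) * norm y"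
          by (intro mult_right_mono t_bound that) simp
        thus ?thesis
          using cmod_cinner_le[of "t a" y] by (simp add: mult_ac)
      qed
    qed (auto simp: von_neumann_closed[OF M] t_add t_scale cinner_simps)
    thus ?thesis
      using \<open>K \<ge> 0\<close> by (metis abs_mult abs_norm_cancel abs_of_nonneg)
  qed
  then obtain g where g: "\<And>a y. a \<in> M \<Longrightarrow> cinner (t a) y = cinner (a \<cdot> \<xi>) (g y)"
    and g_bound: "\<And>y. norm (g y) \<le> K * norm y"
    by metis
  have "\<exists>G. \<forall>x. G \<cdot> x = g x"
  proof (rule bop_exists)
    have *: "v = w" if "\<And>a. a \<in> M \<Longrightarrow> cinner (a \<cdot> \<xi>) v = cinner (a \<cdot> \<xi>) w" for v w
      using that by (intro eq_on_cyclic[OF cyc]) (metis cinner_commute)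
    show "g (x + y) = g x + g y" for x y
      by (rule *) (simp add: cinner_simps flip: g)
    show "g (c *\<^sub>C x) = c *\<^sub>C g x" for c x
      by (rule *) (simp add: cinner_simps flip: g)
  qed (rule g_bound)
  then obtain G where G: "\<And>x. G \<cdot> x = g x"
    by blast
  have "cinner (adj G \<cdot> a \<cdot> \<xi>) (c \<cdot> \<xi>) = s a c" if "a \<in> M" "c \<in> M" for a c
    using that by (simp add: cinner_adj_left G t flip: g)
  thus ?thesis
    by blast
qed

lemma sum_nonneg_Reals: "(\<And>i. i \<in> I \<Longrightarrow> f i \<in> \<real>\<^sub>\<ge>\<^sub>0) \<Longrightarrow> (\<Sum>i\<in>I. f i) \<in> \<real>\<^sub>\<ge>\<^sub>0"
  by (induction I rule: infinite_finite_induct) auto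

section \<open>Entrywise products of commuting positive matrices\<close>

text \<open>The action of an operator matrix on the \<open>n\<close>-fold direct sum.\<close>

definition matrix_apply ::
    "nat \<Rightarrow> (nat \<Rightarrow> nat \<Rightarrow> 'h :: complex_inner bop) \<Rightarrow> (nat \<Rightarrow> 'h) \<Rightarrow> nat \<Rightarrow> 'h" where
  "matrix_apply n A x i = (\<Sum>j<n. A i j \<cdot> x j)"

text \<open>The real inner product of the \<open>n\<close>-fold direct sum.\<close>

definition tuple_inner :: "nat \<Rightarrow> (nat \<Rightarrow> 'h :: complex_inner) \<Rightarrow> (nat \<Rightarrow> 'h) \<Rightarrow> real" where
  "tuple_inner n x y = (\<Sum>i<n. inner (x i) (y i))"

definition hermitian_matrix :: "nat \<Rightarrow> (nat \<Rightarrow> nat \<Rightarrow> 'h :: complex_inner bop) \<Rightarrow> bool" where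
  "hermitian_matrix n A \<longleftrightarrow>
    (\<forall>i<n. \<forall>j<n. \<forall>u w. cinner (A i j \<cdot> u) w = cinner u (A j i \<cdot> w))"

text \<open>The condition \<open>0 \<le> A \<le> 1\<close> on a Hermitian matrix.\<close>

definition unit_interval_matrix :: "nat \<Rightarrow> (nat \<Rightarrow> nat \<Rightarrow> 'h :: complex_inner bop) \<Rightarrow> bool" where
  "unit_interval_matrix n A \<longleftrightarrow> hermitian_matrix n A \<and>
    (\<forall>x. 0 \<le> tuple_inner n (matrix_apply n A x) x \<and>
      tuple_inner n (matrix_apply n A x) x \<le> tuple_inner n x x)"

text \<open>The matrix \<open>A - A\<^sup>2\<close>.\<close>

definition square_defect ::
    "nat \<Rightarrow> (nat \<Rightarrow> nat \<Rightarrow> 'h :: complex_inner bop) \<Rightarrow> nat \<Rightarrow> nat \<Rightarrow> 'h bop" where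
  "square_defect n A i j = A i j - (\<Sum>l<n. A i l * A l j)"

lemma bop_sum_delta:
  fixes n :: nat
  assumes "j < n"
  shows "(\<Sum>l<n. A l \<cdot> (if l = j then u else 0)) = A j \<cdot> (u :: 'h :: complex_inner)"
proof -
  have "(\<Sum>l<n. A l \<cdot> (if l = j then u else 0)) = (\<Sum>l<n. if l = j then A l \<cdot> u else 0)"
    by (intro sum.cong) auto
  thus ?thesis
    using assms by (subst (asm) sum.delta) auto
qed

lemma cinner_sum_delta:
  fixes n :: nat
  assumes "i < n" "j < n"
  shows "(\<Sum>k<n. cinner (\<Sum>l<n. A k l \<cdot> (if l = j then u else 0)) (if k = i then w else 0))
    = cinner (A i j \<cdot> u) (w :: 'h :: complex_inner)"
proof -
  have "(\<Sum>k<n. cinner (\<Sum>l<n. A k l \<cdot> (if l = j then u else 0)) (if k = i then w else 0))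
    = (\<Sum>k<n. if k = i then cinner (A k j \<cdot> u) w else 0)"
    using assms by (intro sum.cong) (auto simp: bop_sum_delta)
  thus ?thesis
    using assms by (subst (asm) sum.delta) auto
qed

lemma positive_matrix_hermitian:
  fixes A :: "nat \<Rightarrow> nat \<Rightarrow> 'h :: complex_inner bop"
  assumes "positive_matrix n A"
  shows "hermitian_matrix n A"
  unfolding hermitian_matrix_def
proof (intro allI impI)
  fix i j :: nat and u w :: 'h
  assume ij: "i < n" "j < n"
  define q where "q = (\<lambda>x y. \<Sum>k<n. cinner (\<Sum>l<n. A k l \<cdot> x l) (y k))"
  define x where "x = (\<lambda>l. if l = j then u else 0)"
  define y where "y = (\<lambda>l. if l = i then w else 0)"
  have "q y x = cnj (q x y)"
  proof (rule nonneg_binary_form(1)[where A = "q x x" and B = "q y y"])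
    fix \<alpha> \<beta> :: complex
    have "q (\<lambda>l. \<alpha> *\<^sub>C x l + \<beta> *\<^sub>C y l) (\<lambda>l. \<alpha> *\<^sub>C x l + \<beta> *\<^sub>C y l) \<in> \<real>\<^sub>\<ge>\<^sub>0"
      using assms by (simp add: positive_matrix_def q_def)
    also have "q (\<lambda>l. \<alpha> *\<^sub>C x l + \<beta> *\<^sub>C y l) (\<lambda>l. \<alpha> *\<^sub>C x l + \<beta> *\<^sub>C y l)
      = \<alpha> * cnj \<alpha> * q x x + \<alpha> * cnj \<beta> * q x y + \<beta> * cnj \<alpha> * q y x + \<beta> * cnj \<beta> * q y y"
      by (simp add: q_def bop_linear_simps cinner_simps sum.distrib cinner_sum_left sum_distrib_left
          algebra_simps)
    finally show "\<alpha> * cnj \<alpha> * q x x + \<alpha> * cnj \<beta> * q x y + \<beta> * cnj \<alpha> * q y x + \<beta> * cnj \<beta> * q y y \<in> \<real>\<^sub>\<ge>\<^sub>0" .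
  qed
  moreover have "q x y = cinner (A i j \<cdot> u) w" "q y x = cinner (A j i \<cdot> w) u"
    unfolding q_def x_def y_def by (rule cinner_sum_delta; simp add: ij)+
  ultimately show "cinner (A i j \<cdot> u) w = cinner u (A j i \<cdot> w)"
    by (metis cinner_commute complex_cnj_cnj)
qed

lemma tuple_inner_simps:
  "tuple_inner n (\<lambda>i. x i - y i) z = tuple_inner n x z - tuple_inner n y z"
  "tuple_inner n z (\<lambda>i. x i - y i) = tuple_inner n z x - tuple_inner n z y"
  by (simp_all add: tuple_inner_def inner_simps sum_subtractf)

lemma tuple_inner_self: "tuple_inner n x x = (\<Sum>i<n. (norm (x i))\<^sup>2)"
  by (simp add: tuple_inner_def power2_norm_eq_inner)

lemma matrix_apply_diff:
  "matrix_apply n A (\<lambda>i. x i - y i) = (\<lambda>i. matrix_apply n A x i - matrix_apply n A y i)"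
  by (simp add: matrix_apply_def bop_linear_simps sum_subtractf fun_eq_iff)

lemma hermitian_matrix_tuple_inner:
  assumes "hermitian_matrix n A"
  shows "tuple_inner n (matrix_apply n A x) y = tuple_inner n x (matrix_apply n A y)"
proof -
  have "inner (A i j \<cdot> u) w = inner u (A j i \<cdot> w)" if "i < n" "j < n" for i j u w
    using assms that by (simp add: hermitian_matrix_def flip: Re_cinner)
  hence "tuple_inner n (matrix_apply n A x) y = (\<Sum>i<n. \<Sum>j<n. inner (x j) (A j i \<cdot> y i))"
    by (simp add: tuple_inner_def matrix_apply_def inner_sum_left)
  also have "\<dots> = tuple_inner n x (matrix_apply n A y)"
    by (subst sum.swap) (simp add: tuple_inner_def matrix_apply_def inner_sum_right)
  finally show ?thesis .
qed

lemma matrix_apply_square_defect: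
  "matrix_apply n (square_defect n A) x =
    (\<lambda>i. matrix_apply n A x i - matrix_apply n A (matrix_apply n A x) i)"
proof
  fix i
  have "(\<Sum>j<n. \<Sum>l<n. A i l \<cdot> A l j \<cdot> x j) = (\<Sum>l<n. \<Sum>j<n. A i l \<cdot> A l j \<cdot> x j)"
    by (rule sum.swap)
  thus "matrix_apply n (square_defect n A) x i =
      matrix_apply n A x i - matrix_apply n A (matrix_apply n A x) i"
    by (simp add: matrix_apply_def square_defect_def sum_bop_apply bop_sum_right sum_subtractf)
qed

lemma hermitian_square_defect:
  assumes "hermitian_matrix n A"
  shows "hermitian_matrix n (square_defect n A)"
  using assms
  by (simp add: hermitian_matrix_def square_defect_def sum_bop_apply cinner_simps
      cinner_sum_left cinner_sum_right)

lemma tuple_inner_square_defect: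
  assumes "hermitian_matrix n A"
  shows "tuple_inner n (matrix_apply n (square_defect n A) x) x =
    tuple_inner n (matrix_apply n A x) x - tuple_inner n (matrix_apply n A x) (matrix_apply n A x)"
  by (simp add: matrix_apply_square_defect tuple_inner_simps hermitian_matrix_tuple_inner[OF assms])

lemma unit_interval_square_defect:
  assumes "unit_interval_matrix n A"
  shows "unit_interval_matrix n (square_defect n A)"
proof -
  have herm: "hermitian_matrix n A"
    and pos: "\<And>x. 0 \<le> tuple_inner n (matrix_apply n A x) x"
    and le: "\<And>x. tuple_inner n (matrix_apply n A x) x \<le> tuple_inner n x x"
    using assms by (auto simp: unit_interval_matrix_def)
  have "0 \<le> tuple_inner n (matrix_apply n (square_defect n A) x) x" for x
  proof -
    define y where "y = matrix_apply n A x"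
    define z where "z = (\<lambda>i. x i - y i)"
    \<comment> \<open>The identity \<open>A - A\<^sup>2 = (1 - A) A (1 - A) + A (1 - A) A\<close>.\<close>
    have "tuple_inner n (matrix_apply n (square_defect n A) x) x =
        tuple_inner n (matrix_apply n A z) z
        + (tuple_inner n y y - tuple_inner n (matrix_apply n A y) y)"
      using hermitian_matrix_tuple_inner[OF herm, of y x]
      by (simp add: tuple_inner_square_defect[OF herm] z_def matrix_apply_diff tuple_inner_simps
          flip: y_def)
    thus ?thesis
      using pos[of z] le[of y] by simp
  qed
  moreover have "tuple_inner n (matrix_apply n (square_defect n A) x) x \<le> tuple_inner n x x" for x
  proof -
    have "0 \<le> tuple_inner n (matrix_apply n A x) (matrix_apply n A x)"
      by (simp add: tuple_inner_def sum_nonneg)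
    thus ?thesis
      using le[of x] by (simp add: tuple_inner_square_defect[OF herm])
  qed
  ultimately show ?thesis
    using hermitian_square_defect[OF herm] by (simp add: unit_interval_matrix_def)
qed

text \<open>
  The iterates \<open>A\<^sub>k\<^sub>+\<^sub>1 = A\<^sub>k - A\<^sub>k\<^sup>2\<close> tend to \<open>0\<close> strongly, since the squares \<open>A\<^sub>k\<^sup>2\<close> telescope and
  so have convergent sums of diagonal matrix coefficients.
\<close>

lemma square_defect_iterates_tendsto:
  assumes A: "unit_interval_matrix n A" and i: "i < n"
  shows "(\<lambda>k. matrix_apply n ((square_defect n ^^ k) A) x i) \<longlonglongrightarrow> 0"
proof -
  define C where "C = (\<lambda>k. (square_defect n ^^ k) A)"
  have C: "unit_interval_matrix n (C k)" for k
    by (induction k) (auto simp: C_def A unit_interval_square_defect)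
  have CSuc: "C (Suc k) = square_defect n (C k)" for k
    by (simp add: C_def)
  define r where "r = (\<lambda>k. tuple_inner n (matrix_apply n (C k) x) (matrix_apply n (C k) x))"
  have r_nonneg: "0 \<le> r k" for k
    by (simp add: r_def tuple_inner_def sum_nonneg)
  have telescope: "(\<Sum>k<m. r k) = tuple_inner n (matrix_apply n (C 0) x) x
      - tuple_inner n (matrix_apply n (C m) x) x" for m
  proof (induction m)
    case (Suc m)
    thus ?case
      using C[of m] by (simp add: CSuc tuple_inner_square_defect unit_interval_matrix_def r_def)
  qed simp
  have "summable r"
  proof (rule summableI_nonneg_bounded[OF r_nonneg])
    show "(\<Sum>k<m. r k) \<le> tuple_inner n (matrix_apply n (C 0) x) x" for m
      using C[of m] by (simp add: telescope unit_interval_matrix_def)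
  qed
  hence "r \<longlonglongrightarrow> 0"
    by (rule summable_LIMSEQ_zero)
  have "(\<lambda>k. (norm (matrix_apply n (C k) x i))\<^sup>2) \<longlonglongrightarrow> 0"
  proof (rule tendsto_sandwich[OF _ _ tendsto_const \<open>r \<longlonglongrightarrow> 0\<close>])
    have "(norm (matrix_apply n (C k) x i))\<^sup>2 \<le> r k" for k
      unfolding r_def tuple_inner_self
      using i by (intro member_le_sum) auto
    thus "\<forall>\<^sub>F k in sequentially. (norm (matrix_apply n (C k) x i))\<^sup>2 \<le> r k"
      by simp
  qed simp
  hence "(\<lambda>k. sqrt ((norm (matrix_apply n (C k) x i))\<^sup>2)) \<longlonglongrightarrow> sqrt 0"
    by (rule tendsto_real_sqrt)
  thus ?thesis
    by (simp add: C_def tendsto_norm_zero_iff)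
qed

text \<open>
  Replacing \<open>A\<^sub>k\<close> by \<open>A\<^sub>k\<^sub>+\<^sub>1\<close> lowers the sum by that for \<open>A\<^sub>k\<^sup>2\<close>, which is nonnegative: as the entries
  commute, it is the sum over \<open>l\<close> of the quadratic form of \<open>B\<close> at the vectors
  \<open>((A\<^sub>k)\<^sub>l\<^sub>j \<zeta>)\<^sub>j\<close>.
\<close>

lemma commuting_product_nonneg_unit:
  fixes A B :: "nat \<Rightarrow> nat \<Rightarrow> 'h :: complex_inner bop"
  assumes A: "unit_interval_matrix n A" and B: "positive_matrix n B"
    and A_in: "\<And>i j. i < n \<Longrightarrow> j < n \<Longrightarrow> A i j \<in> commutant X"
    and B_in: "\<And>i j. i < n \<Longrightarrow> j < n \<Longrightarrow> B i j \<in> commutant (commutant X)"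
  shows "(\<Sum>i<n. \<Sum>j<n. cinner (B i j \<cdot> A i j \<cdot> \<zeta>) \<zeta>) \<in> \<real>\<^sub>\<ge>\<^sub>0"
proof -
  define C where "C = (\<lambda>k. (square_defect n ^^ k) A)"
  have CSuc: "C (Suc k) = square_defect n (C k)" for k
    by (simp add: C_def)
  have C: "unit_interval_matrix n (C k)" for k
    by (induction k) (auto simp: C_def A unit_interval_square_defect)
  have C_in: "C k i j \<in> commutant X" if "i < n" "j < n" for k i j
    using that
  proof (induction k arbitrary: i j)
    case (Suc k)
    thus ?case
      by (auto simp: CSuc square_defect_def intro!: commutant_closed)
  qed (simp add: C_def A_in)
  define L where "L = (\<lambda>k. \<Sum>i<n. \<Sum>j<n. cinner (B i j \<cdot> C k i j \<cdot> \<zeta>) \<zeta>)"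
  have step: "L k - L (Suc k) \<in> \<real>\<^sub>\<ge>\<^sub>0" for k
  proof -
    have herm: "cinner (C k i j \<cdot> u) w = cinner u (C k j i \<cdot> w)" if "i < n" "j < n" for i j u w
      using C[of k] that by (simp add: unit_interval_matrix_def hermitian_matrix_def)
    have *: "cinner (B i j \<cdot> C k i l \<cdot> v) \<zeta> = cinner (B i j \<cdot> v) (C k l i \<cdot> \<zeta>)"
      if "i < n" "j < n" "l < n" for i j l v
      using that by (simp add: commutant_apply[OF B_in C_in] herm)
    have "L k - L (Suc k) = (\<Sum>i<n. \<Sum>j<n. \<Sum>l<n. cinner (B i j \<cdot> C k i l \<cdot> C k l j \<cdot> \<zeta>) \<zeta>)"
      by (simp add: L_def CSuc square_defect_def sum_bop_apply bop_linear_simps cinner_simps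
          cinner_sum_left sum_subtractf)
    also have "\<dots> = (\<Sum>i<n. \<Sum>j<n. \<Sum>l<n. cinner (B i j \<cdot> C k l j \<cdot> \<zeta>) (C k l i \<cdot> \<zeta>))"
      by (simp add: *)
    also have "\<dots> = (\<Sum>i<n. \<Sum>l<n. \<Sum>j<n. cinner (B i j \<cdot> C k l j \<cdot> \<zeta>) (C k l i \<cdot> \<zeta>))"
      by (intro sum.cong refl sum.swap)
    also have "\<dots> = (\<Sum>l<n. \<Sum>i<n. \<Sum>j<n. cinner (B i j \<cdot> C k l j \<cdot> \<zeta>) (C k l i \<cdot> \<zeta>))"
      by (rule sum.swap)
    also have "\<dots> = (\<Sum>l<n. \<Sum>i<n. cinner (\<Sum>j<n. B i j \<cdot> C k l j \<cdot> \<zeta>) (C k l i \<cdot> \<zeta>))"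
      by (simp add: cinner_sum_left)
    also have "\<dots> \<in> \<real>\<^sub>\<ge>\<^sub>0"
    proof (rule sum_nonneg_Reals)
      show "(\<Sum>i<n. cinner (\<Sum>j<n. B i j \<cdot> C k l j \<cdot> \<zeta>) (C k l i \<cdot> \<zeta>)) \<in> \<real>\<^sub>\<ge>\<^sub>0" for l
        using B unfolding positive_matrix_def by (rule spec)
    qed
    finally show ?thesis .
  qed
  have diff: "L 0 - L k \<in> \<real>\<^sub>\<ge>\<^sub>0" for k
  proof (induction k)
    case (Suc k)
    thus ?case
      using nonneg_Reals_add_I[OF Suc step[of k]] by simp
  qed simp
  have "L \<longlonglongrightarrow> (\<Sum>i<n. \<Sum>j<n. cinner (B i j \<cdot> 0) \<zeta>)"
    unfolding L_def
  proof (intro tendsto_sum tendsto_cinner tendsto_const bounded_linear.tendsto[OF bounded_linear_bop])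
    fix i j assume "i \<in> {..<n}" "j \<in> {..<n}"
    hence "matrix_apply n (C k) (\<lambda>j'. if j' = j then \<zeta> else 0) i = C k i j \<cdot> \<zeta>" for k
      by (simp add: matrix_apply_def bop_sum_delta)
    moreover have "(\<lambda>k. matrix_apply n (C k) (\<lambda>j'. if j' = j then \<zeta> else 0) i) \<longlonglongrightarrow> 0"
      unfolding C_def using \<open>i \<in> {..<n}\<close> by (intro square_defect_iterates_tendsto[OF A]) simp
    ultimately show "(\<lambda>k. C k i j \<cdot> \<zeta>) \<longlonglongrightarrow> 0"
      by simp
  qed
  hence "(\<lambda>k. L 0 - L k) \<longlonglongrightarrow> L 0 - 0"
    by (intro tendsto_diff tendsto_const) simp
  hence "L 0 \<in> \<real>\<^sub>\<ge>\<^sub>0"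
    using closed_sequentially[OF closed_nonneg_Reals_complex, of "\<lambda>k. L 0 - L k" "L 0"] diff by simp
  thus ?thesis
    by (simp add: L_def C_def)
qed

lemma positive_matrix_bound:
  fixes A :: "nat \<Rightarrow> nat \<Rightarrow> 'h :: complex_inner bop"
  shows "tuple_inner n (matrix_apply n A x) x \<le> (\<Sum>i<n. \<Sum>j<n. norm (A i j)) * tuple_inner n x x"
proof -
  have "inner (A i j \<cdot> x j) (x i) \<le> norm (A i j) * tuple_inner n x x" if "i < n" "j < n" for i j
  proof -
    have sq: "(norm (x l))\<^sup>2 \<le> tuple_inner n x x" if "l < n" for l
      unfolding tuple_inner_self using that by (intro member_le_sum) auto
    have "norm (x j) * norm (x i) \<le> tuple_inner n x x"
      using sum_squares_bound[of "norm (x j)" "norm (x i)"] sq[OF that(1)] sq[OF that(2)] by simp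
    hence "norm (A i j) * (norm (x j) * norm (x i)) \<le> norm (A i j) * tuple_inner n x x"
      by (intro mult_left_mono) auto
    moreover have "inner (A i j \<cdot> x j) (x i) \<le> norm (A i j \<cdot> x j) * norm (x i)"
      by (rule norm_cauchy_schwarz)
    moreover have "norm (A i j \<cdot> x j) * norm (x i) \<le> (norm (A i j) * norm (x j)) * norm (x i)"
      by (intro mult_right_mono norm_bop_apply_le) auto
    ultimately show ?thesis
      by (simp add: mult.assoc)
  qed
  hence "tuple_inner n (matrix_apply n A x) x \<le> (\<Sum>i<n. \<Sum>j<n. norm (A i j) * tuple_inner n x x)"
    unfolding tuple_inner_def[of n "matrix_apply n A x"] matrix_apply_def inner_sum_left
    by (intro sum_mono) auto
  thus ?thesis
    by (simp add: sum_distrib_right)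
qed

lemma positive_matrix_tuple_inner_nonneg:
  assumes "positive_matrix n A"
  shows "0 \<le> tuple_inner n (matrix_apply n A x) x"
proof -
  have "Re (\<Sum>i<n. cinner (\<Sum>j<n. A i j \<cdot> x j) (x i)) \<ge> 0"
    using assms by (simp add: positive_matrix_def complex_nonneg_Reals_iff del: Re_sum)
  thus ?thesis
    by (simp add: tuple_inner_def matrix_apply_def Re_cinner)
qed

text \<open>
  A Schur product theorem for operator matrices: if the entries of the positive matrices \<open>A\<close> and \<open>B\<close>
  commute with each other, then \<open>\<Sum>\<^sub>i\<^sub>j B\<^sub>i\<^sub>j A\<^sub>i\<^sub>j \<ge> 0\<close>.  After scaling to \<open>0 \<le> A \<le> 1\<close> one has
  \<open>A = \<Sum>\<^sub>k A\<^sub>k\<^sup>2\<close> strongly, with \<open>A\<^sub>k\<close> the iterates of \<open>square_defect\<close>, and each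
  Hermitian square \<open>A\<^sub>k\<^sup>2\<close> contributes a nonnegative amount.  The case \<open>n = 1\<close> is the positivity
  of a product of commuting positive operators.
\<close>

lemma commuting_product_nonneg:
  fixes A B :: "nat \<Rightarrow> nat \<Rightarrow> 'h :: complex_inner bop"
  assumes A: "positive_matrix n A" and B: "positive_matrix n B"
    and A_in: "\<And>i j. i < n \<Longrightarrow> j < n \<Longrightarrow> A i j \<in> commutant X"
    and B_in: "\<And>i j. i < n \<Longrightarrow> j < n \<Longrightarrow> B i j \<in> commutant (commutant X)"
  shows "(\<Sum>i<n. \<Sum>j<n. cinner (B i j \<cdot> A i j \<cdot> \<zeta>) \<zeta>) \<in> \<real>\<^sub>\<ge>\<^sub>0"
proof -
  define K where "K = (\<Sum>i<n. \<Sum>j<n. norm (A i j)) + 1"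
  have K: "K > 0"
    unfolding K_def by (intro add_nonneg_pos sum_nonneg) auto
  define C where "C = (\<lambda>i j. (1 / K) *\<^sub>R A i j)"
  have mC: "tuple_inner n (matrix_apply n C x) x = (1 / K) * tuple_inner n (matrix_apply n A x) x" for x
    by (simp add: C_def tuple_inner_def matrix_apply_def flip: scaleR_sum_right sum_divide_distrib)
  have "unit_interval_matrix n C"
    unfolding unit_interval_matrix_def
  proof (intro conjI allI)
    show "hermitian_matrix n C"
      using positive_matrix_hermitian[OF A] by (simp add: hermitian_matrix_def C_def cinner_simps)
    show "0 \<le> tuple_inner n (matrix_apply n C x) x" for x
      using positive_matrix_tuple_inner_nonneg[OF A] K by (simp add: mC)
    show "tuple_inner n (matrix_apply n C x) x \<le> tuple_inner n x x" for x
    proof -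
      have "0 \<le> tuple_inner n x x"
        by (simp add: tuple_inner_def sum_nonneg)
      hence "tuple_inner n (matrix_apply n A x) x \<le> K * tuple_inner n x x"
        using positive_matrix_bound[of n A x] by (simp add: K_def ring_distribs)
      thus ?thesis
        using K by (simp add: mC field_simps)
    qed
  qed
  hence "(\<Sum>i<n. \<Sum>j<n. cinner (B i j \<cdot> C i j \<cdot> \<zeta>) \<zeta>) \<in> \<real>\<^sub>\<ge>\<^sub>0"
    by (rule commuting_product_nonneg_unit[OF _ B _ B_in]) (auto simp: C_def A_in commutant_scaleR)
  hence "of_real K * (\<Sum>i<n. \<Sum>j<n. cinner (B i j \<cdot> C i j \<cdot> \<zeta>) \<zeta>) \<in> \<real>\<^sub>\<ge>\<^sub>0"
    using K by (intro nonneg_Reals_mult_I) auto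
  also have "of_real K * (\<Sum>i<n. \<Sum>j<n. cinner (B i j \<cdot> C i j \<cdot> \<zeta>) \<zeta>)
      = (\<Sum>i<n. \<Sum>j<n. cinner (B i j \<cdot> A i j \<cdot> \<zeta>) \<zeta>)"
    using K by (simp add: C_def bop_scaleR cinner_simps sum_distrib_left)
  finally show ?thesis .
qed

section \<open>The dual of a state-preserving positive map\<close>

lemma positive_matrix_1: "positive_matrix (Suc 0) A \<longleftrightarrow> positive_op (A 0 0)"
proof
  assume "positive_matrix (Suc 0) A"
  hence "cinner (A 0 0 \<cdot> (\<lambda>_. x) 0) ((\<lambda>_. x) 0) \<in> \<real>\<^sub>\<ge>\<^sub>0" for x
    unfolding positive_matrix_def lessThan_Suc by (drule_tac spec[of _ "\<lambda>_. x"]) simp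
  thus "positive_op (A 0 0)"
    by (simp add: positive_op_def)
qed (simp add: positive_matrix_def positive_op_def lessThan_Suc)

lemma n_positive_1:
  "n_positive (Suc 0) M \<Phi> \<longleftrightarrow> (\<forall>a\<in>M. positive_op a \<longrightarrow> positive_op (\<Phi> a))"
proof
  assume \<Phi>: "n_positive (Suc 0) M \<Phi>"
  show "\<forall>a\<in>M. positive_op a \<longrightarrow> positive_op (\<Phi> a)"
    using \<Phi>[unfolded n_positive_def positive_matrix_1, THEN spec, of "\<lambda>_ _. _"] by blast
qed (simp add: n_positive_def positive_matrix_1)

lemma positive_matrix_gram: "positive_matrix n (\<lambda>i j. adj (a i) * (a j :: 'h :: chilbert_space bop))"
  unfolding positive_matrix_def
proof
  fix x :: "nat \<Rightarrow> 'h"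
  have "(\<Sum>i<n. cinner (\<Sum>j<n. (adj (a i) * a j) \<cdot> x j) (x i)) =
      (\<Sum>i<n. cinner (\<Sum>j<n. a j \<cdot> x j) (a i \<cdot> x i))"
    by (simp add: cinner_adj_left cinner_sum_left)
  also have "\<dots> = cinner (\<Sum>j<n. a j \<cdot> x j) (\<Sum>i<n. a i \<cdot> x i)"
    by (simp add: cinner_sum_right)
  also have "\<dots> \<in> \<real>\<^sub>\<ge>\<^sub>0"
    by (simp only: cinner_self nonneg_Reals_of_real_iff zero_le_power2)
  finally show "(\<Sum>i<n. cinner (\<Sum>j<n. (adj (a i) * a j) \<cdot> x j) (x i)) \<in> \<real>\<^sub>\<ge>\<^sub>0" .
qed

lemma positive_op_norm_diff:
  assumes "adj b = b"
  shows "positive_op (norm b *\<^sub>R 1 - b)" "positive_op (norm b *\<^sub>R 1 + b)"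
proof -
  have *: "cinner (b \<cdot> x) x = of_real (Re (cinner (b \<cdot> x) x))" "\<bar>Re (cinner (b \<cdot> x) x)\<bar> \<le> norm b * (norm x)\<^sup>2"
    for x
  proof -
    have "cinner (b \<cdot> x) x = cnj (cinner (b \<cdot> x) x)"
      by (metis assms cinner_adj_right cinner_commute)
    hence "Im (cinner (b \<cdot> x) x) = Im (cnj (cinner (b \<cdot> x) x))"
      by (rule arg_cong)
    hence "Im (cinner (b \<cdot> x) x) = 0"
      by simp
    thus "cinner (b \<cdot> x) x = of_real (Re (cinner (b \<cdot> x) x))"
      by (simp add: complex_eq_iff)
    have "norm (b \<cdot> x) * norm x \<le> (norm b * norm x) * norm x"
      by (intro mult_right_mono norm_bop_apply_le) simp
    thus "\<bar>Re (cinner (b \<cdot> x) x)\<bar> \<le> norm b * (norm x)\<^sup>2"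
      using abs_Re_le_cmod[of "cinner (b \<cdot> x) x"] cmod_cinner_le[of "b \<cdot> x" x]
      by (simp add: power2_eq_square mult.assoc)
  qed
  have "cinner ((norm b *\<^sub>R 1 - b) \<cdot> x) x = of_real (norm b * (norm x)\<^sup>2 - Re (cinner (b \<cdot> x) x))"
    "cinner ((norm b *\<^sub>R 1 + b) \<cdot> x) x = of_real (norm b * (norm x)\<^sup>2 + Re (cinner (b \<cdot> x) x))" for x
    using *(1)[of x] by (simp_all add: cinner_simps cinner_self)
  moreover have "0 \<le> norm b * (norm x)\<^sup>2 - Re (cinner (b \<cdot> x) x)"
    "0 \<le> norm b * (norm x)\<^sup>2 + Re (cinner (b \<cdot> x) x)" for x
    using *(2)[of x] by linarith+
  ultimately show "positive_op (norm b *\<^sub>R 1 - b)" "positive_op (norm b *\<^sub>R 1 + b)"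
    unfolding positive_op_def by (simp_all only: nonneg_Reals_of_real_iff simp_thms)
qed

lemma positive_op_self_adjoint:
  fixes b :: "'h :: chilbert_space bop"
  assumes "positive_op b"
  shows "adj b = b"
proof (rule adj_eqI)
  have "hermitian_matrix (Suc 0) (\<lambda>_ _. b)"
    using assms by (intro positive_matrix_hermitian) (simp add: positive_matrix_1)
  thus "cinner (b \<cdot> x) y = cinner x (b \<cdot> y)" for x y
    by (simp add: hermitian_matrix_def)
qed

text \<open>
  A positive map that intertwines the vector functionals of \<open>\<xi>\<close> and \<open>\<zeta>\<close>.  It need not be unital, and
  \<open>\<zeta>\<close> need not be cyclic.
\<close>

locale state_preserving_map =
  fixes M :: "'h :: chilbert_space bop set" and N :: "'k :: chilbert_space bop set"
    and \<xi> :: 'h and \<zeta> :: 'k and \<Psi> :: "'h bop \<Rightarrow> 'k bop"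
  assumes M: "von_neumann_algebra M" and N: "von_neumann_algebra N"
    and cyclic: "cyclic_vector M \<xi>"
    and positive: "positive_map M N \<Psi>"
    and state: "\<And>a. a \<in> M \<Longrightarrow> vector_state \<zeta> (\<Psi> a) = vector_state \<xi> a"
begin

abbreviation "is_dual \<equiv> is_dual_value M \<xi> \<zeta> \<Psi>"
abbreviation "dual \<equiv> dual_map M \<xi> \<zeta> \<Psi>"

lemma
  shows map_in: "a \<in> M \<Longrightarrow> \<Psi> a \<in> N"
    and map_add: "a \<in> M \<Longrightarrow> b \<in> M \<Longrightarrow> \<Psi> (a + b) = \<Psi> a + \<Psi> b"
    and map_scaleC: "a \<in> M \<Longrightarrow> \<Psi> (c *\<^sub>C a) = c *\<^sub>C \<Psi> a"
  using positive by (auto simp: positive_map_def linear_map_on_def)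

lemma map_1_positive: "n_positive 1 M \<Psi>"
  using positive by (simp add: n_positive_1 positive_map_def)

lemma gram_pairing_nonneg:
  assumes \<Psi>: "n_positive n M \<Psi>" and a: "\<And>i. i < n \<Longrightarrow> a i \<in> M"
    and B: "positive_matrix n B" "\<And>i j. i < n \<Longrightarrow> j < n \<Longrightarrow> B i j \<in> commutant N"
  shows "(\<Sum>i<n. \<Sum>j<n. cinner (B i j \<cdot> \<Psi> (adj (a i) * a j) \<cdot> \<zeta>) \<zeta>) \<in> \<real>\<^sub>\<ge>\<^sub>0"
proof (rule commuting_product_nonneg[where X = "commutant N"])
  show "positive_matrix n (\<lambda>i j. \<Psi> (adj (a i) * a j))"
    using \<Psi> a positive_matrix_gram[of n a] unfolding n_positive_def
    by (auto simp: von_neumann_closed[OF M])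
qed (use a B in \<open>auto simp: von_neumann_bicommutant[OF N] triple_commutant
      intro!: map_in von_neumann_closed[OF M]\<close>)

lemma is_dual_unique:
  assumes "is_dual b c" "is_dual b c'"
  shows "c = c'"
proof (rule bop_eq_on_cyclic[OF cyclic], rule eq_on_cyclic[OF cyclic])
  fix a e assume ae: "a \<in> M" "e \<in> M"
  have "cinner (d \<cdot> a \<cdot> \<xi>) (e \<cdot> \<xi>) = cinner (b \<cdot> \<Psi> (adj e * a) \<cdot> \<zeta>) \<zeta>" if d: "is_dual b d" for d
  proof -
    have "cinner (d \<cdot> a \<cdot> \<xi>) (e \<cdot> \<xi>) = cinner (adj e \<cdot> d \<cdot> a \<cdot> \<xi>) \<xi>"
      by (simp add: cinner_adj_left)
    also have "adj e \<cdot> d \<cdot> a \<cdot> \<xi> = d \<cdot> (adj e * a) \<cdot> \<xi>"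
      using d commutant_apply[of d M "adj e" "a \<cdot> \<xi>"] von_neumann_adj[OF M ae(2)]
      by (simp add: is_dual_value_def)
    also have "cinner \<dots> \<xi> = cinner (b \<cdot> \<Psi> (adj e * a) \<cdot> \<zeta>) \<zeta>"
      using d von_neumann_mult[OF M von_neumann_adj[OF M ae(2)] ae(1)]
      unfolding is_dual_value_def by blast
    finally show ?thesis .
  qed
  thus "cinner (c \<cdot> a \<cdot> \<xi>) (e \<cdot> \<xi>) = cinner (c' \<cdot> a \<cdot> \<xi>) (e \<cdot> \<xi>)"
    using assms by simp
qed

lemma is_dual_add: "is_dual b c \<Longrightarrow> is_dual b' c' \<Longrightarrow> is_dual (b + b') (c + c')"
  by (simp add: is_dual_value_def commutant_add cinner_simps)

lemma is_dual_scaleC: "is_dual b c \<Longrightarrow> is_dual (z *\<^sub>C b) (z *\<^sub>C c)"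
  by (simp add: is_dual_value_def commutant_scaleC cinner_simps)

lemma is_dual_one: "is_dual 1 1"
  using state by (simp add: is_dual_value_def commutant_one vector_state_def)

text \<open>
  The Radon--Nikodym argument: for \<open>b \<ge> 0\<close> in the commutant of \<open>N\<close>, the form
  \<open>(a, c) \<mapsto> \<langle>b \<Psi>(c\<^sup>* a) \<zeta>, \<zeta>\<rangle>\<close> lies between \<open>0\<close> and \<open>\<parallel>b\<parallel>\<close> times \<open>\<langle>a \<xi>, c \<xi>\<rangle>\<close>.
\<close>

lemma is_dual_exists_positive:
  assumes b: "b \<in> commutant N" "positive_op b"
  shows "\<exists>c. is_dual b c"
proof -
  define s where "s = (\<lambda>d a c. cinner (d \<cdot> \<Psi> (adj c * a) \<cdot> \<zeta>) \<zeta>)"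
  have s_nonneg: "s d a a \<in> \<real>\<^sub>\<ge>\<^sub>0" if "d \<in> commutant N" "positive_op d" "a \<in> M" for d a
    using gram_pairing_nonneg[OF map_1_positive, of "\<lambda>_. a" "\<lambda>_ _. d"] that
    by (simp add: s_def positive_matrix_1)
  have s_simps: "s d (x + y) z = s d x z + s d y z" "s d z (x + y) = s d z x + s d z y"
    "s d (c *\<^sub>C x) y = c * s d x y" "s d x (c *\<^sub>C y) = cnj c * s d x y"
    if "x \<in> M" "y \<in> M" "z \<in> M" for d x y z c
    using that
    by (auto simp: s_def adj_add adj_scaleC ring_distribs map_add map_scaleC cinner_simps
        bop_linear_simps von_neumann_closed[OF M])
  have s_one: "s 1 a a = of_real ((norm (a \<cdot> \<xi>))\<^sup>2)" if "a \<in> M" for a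
  proof -
    have "s 1 a a = vector_state \<zeta> (\<Psi> (adj a * a))"
      by (simp add: s_def vector_state_def)
    also have "\<dots> = vector_state \<xi> (adj a * a)"
      using that by (intro state) (simp add: von_neumann_closed[OF M])
    also have "\<dots> = of_real ((norm (a \<cdot> \<xi>))\<^sup>2)"
      by (simp only: vector_state_def times_bop.rep_eq cinner_adj_left cinner_self)
    finally show ?thesis .
  qed
  have s_le: "Re (s b a a) \<le> norm b * (norm (a \<cdot> \<xi>))\<^sup>2" if "a \<in> M" for a
  proof -
    have "s (norm b *\<^sub>R 1 - b) a a \<in> \<real>\<^sub>\<ge>\<^sub>0"
      using b that by (intro s_nonneg commutant_closed positive_op_norm_diff positive_op_self_adjoint)
    moreover have "s (norm b *\<^sub>R 1 - b) a a = of_real (norm b) * s 1 a a - s b a a"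
      by (simp add: s_def cinner_simps)
    ultimately show ?thesis
      using s_one[OF that] by (simp add: complex_nonneg_Reals_iff)
  qed
  have bound: "cmod (s b a c) \<le> norm b * norm (a \<cdot> \<xi>) * norm (c \<cdot> \<xi>)" if ac: "a \<in> M" "c \<in> M" for a c
  proof -
    have "(cmod (s b a c))\<^sup>2 \<le> Re (s b a a) * Re (s b c c)"
      using ac b
      by (intro nonneg_form_Cauchy_Schwarz[where S = M])
        (auto simp: von_neumann_closed[OF M] s_simps s_nonneg)
    also have "\<dots> \<le> (norm b * (norm (a \<cdot> \<xi>))\<^sup>2) * (norm b * (norm (c \<cdot> \<xi>))\<^sup>2)"
      using s_nonneg[OF b ac(2)] by (intro mult_mono s_le ac) (auto simp: complex_nonneg_Reals_iff)
    also have "\<dots> = (norm b * norm (a \<cdot> \<xi>) * norm (c \<cdot> \<xi>))\<^sup>2"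
      by (simp add: power2_eq_square mult_ac)
    finally show ?thesis
      by (rule power2_le_imp_le) simp
  qed
  have "\<exists>T. \<forall>a\<in>M. \<forall>c\<in>M. cinner (T \<cdot> a \<cdot> \<xi>) (c \<cdot> \<xi>) = s b a c"
    by (rule form_operator_exists[OF M cyclic, where K = "norm b"]) (simp_all add: s_simps bound)
  then obtain T where T: "\<And>a c. a \<in> M \<Longrightarrow> c \<in> M \<Longrightarrow> cinner (T \<cdot> a \<cdot> \<xi>) (c \<cdot> \<xi>) = s b a c"
    by blast
  have "d * T = T * d" if d: "d \<in> M" for d
  proof (rule bop_eq_on_cyclic[OF cyclic], rule eq_on_cyclic[OF cyclic])
    fix a c assume ac: "a \<in> M" "c \<in> M"
    have "cinner ((d * T) \<cdot> a \<cdot> \<xi>) (c \<cdot> \<xi>) = cinner (T \<cdot> a \<cdot> \<xi>) ((adj d * c) \<cdot> \<xi>)"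
      by (simp add: cinner_adj_right)
    also have "\<dots> = s b a (adj d * c)"
      using ac d by (intro T von_neumann_closed[OF M])
    also have "\<dots> = s b (d * a) c"
      by (simp add: s_def adj_mult mult.assoc)
    also have "\<dots> = cinner (T \<cdot> (d * a) \<cdot> \<xi>) (c \<cdot> \<xi>)"
      using ac d by (intro T[symmetric] von_neumann_closed[OF M])
    finally show "cinner ((d * T) \<cdot> a \<cdot> \<xi>) (c \<cdot> \<xi>) = cinner ((T * d) \<cdot> a \<cdot> \<xi>) (c \<cdot> \<xi>)"
      by simp
  qed
  hence "T \<in> commutant M"
    by (simp add: commutant_def)
  moreover have "cinner (T \<cdot> a \<cdot> \<xi>) \<xi> = cinner (b \<cdot> \<Psi> a \<cdot> \<zeta>) \<zeta>" if "a \<in> M" for a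
    using T[OF that von_neumann_one[OF M]] by (simp add: s_def)
  ultimately show ?thesis
    by (auto simp: is_dual_value_def)
qed

text \<open>
  A self-adjoint \<open>h\<close> is the difference of the positive operators \<open>\<parallel>h\<parallel> + h\<close> and \<open>\<parallel>h\<parallel>\<close>.
\<close>

lemma is_dual_exists:
  assumes b: "b \<in> commutant N"
  shows "\<exists>c. is_dual b c"
proof -
  have N': "von_neumann_algebra (commutant N)"
    by (rule von_neumann_commutant[OF N])
  have self_adjoint: "\<exists>c. is_dual h c" if h: "h \<in> commutant N" "adj h = h" for h
  proof -
    obtain c where "is_dual (norm h *\<^sub>R 1 + h) c"
      using is_dual_exists_positive[of "norm h *\<^sub>R 1 + h"] h
      by (auto simp: positive_op_norm_diff von_neumann_closed[OF N'])
    hence "is_dual (norm h *\<^sub>R 1 + h + complex_of_real (- norm h) *\<^sub>C 1) (c + complex_of_real (- norm h) *\<^sub>C 1)"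
      by (intro is_dual_add is_dual_scaleC is_dual_one)
    thus ?thesis
      by (auto simp only: scaleC_of_real) (auto simp: algebra_simps)
  qed
  define h where "h = (1 / 2) *\<^sub>R (b + adj b)"
  define k where "k = (- \<i> / 2) *\<^sub>C (b - adj b)"
  obtain c where c: "is_dual h c"
    using self_adjoint[of h] b
    by (auto simp: h_def von_neumann_closed[OF N'] adj_scaleR adj_add add.commute)
  have "adj k = k"
    by (simp add: k_def adj_scaleC adj_diff) (simp add: scaleC_diff_right scaleC_minus_left)
  then obtain d where d: "is_dual k d"
    using self_adjoint[of k] b by (auto simp: k_def von_neumann_closed[OF N'])
  have "h + \<i> *\<^sub>C k = b"
    by (rule bop_eqI) (simp add: h_def k_def scaleC_scaleC scaleC_of_real[symmetric]
        scaleC_add_right scaleC_diff_right scaleR_scaleC scaleC_add_left[symmetric] scaleC_one)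
  thus ?thesis
    using is_dual_add[OF c is_dual_scaleC[OF d, of \<i>]] by auto
qed

lemma dual_eqI: "is_dual b c \<Longrightarrow> dual b = c"
  unfolding dual_map_def by (rule the_equality) (auto intro: is_dual_unique)

lemma is_dual_dual: "b \<in> commutant N \<Longrightarrow> is_dual b (dual b)"
  using is_dual_exists dual_eqI by metis

lemma dual_in: "b \<in> commutant N \<Longrightarrow> dual b \<in> commutant M"
  using is_dual_dual by (simp add: is_dual_value_def)

lemma dual_pairing:
  "b \<in> commutant N \<Longrightarrow> a \<in> M \<Longrightarrow> cinner (dual b \<cdot> a \<cdot> \<xi>) \<xi> = cinner (b \<cdot> \<Psi> a \<cdot> \<zeta>) \<zeta>"
  using is_dual_dual by (simp add: is_dual_value_def)

lemma dual_add: "b \<in> commutant N \<Longrightarrow> b' \<in> commutant N \<Longrightarrow> dual (b + b') = dual b + dual b'"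
  by (intro dual_eqI is_dual_add is_dual_dual)

lemma dual_scaleC: "b \<in> commutant N \<Longrightarrow> dual (c *\<^sub>C b) = c *\<^sub>C dual b"
  by (intro dual_eqI is_dual_scaleC is_dual_dual)

lemma dual_one: "dual 1 = 1"
  by (intro dual_eqI is_dual_one)

lemma dual_n_positive:
  assumes \<Psi>: "n_positive n M \<Psi>"
  shows "n_positive n (commutant N) dual"
  unfolding n_positive_def
proof safe
  fix B :: "nat \<Rightarrow> nat \<Rightarrow> 'k bop"
  assume B: "\<forall>i<n. \<forall>j<n. B i j \<in> commutant N" "positive_matrix n B"
  have orbit: "(\<Sum>i<n. cinner (\<Sum>j<n. dual (B i j) \<cdot> a j \<cdot> \<xi>) (a i \<cdot> \<xi>)) \<in> \<real>\<^sub>\<ge>\<^sub>0"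
    if a: "\<And>i. i < n \<Longrightarrow> a i \<in> M" for a
  proof -
    have "cinner (dual (B i j) \<cdot> a j \<cdot> \<xi>) (a i \<cdot> \<xi>) = cinner (B i j \<cdot> \<Psi> (adj (a i) * a j) \<cdot> \<zeta>) \<zeta>"
      if ij: "i < n" "j < n" for i j
    proof -
      have "cinner (dual (B i j) \<cdot> a j \<cdot> \<xi>) (a i \<cdot> \<xi>) = cinner (adj (a i) \<cdot> dual (B i j) \<cdot> a j \<cdot> \<xi>) \<xi>"
        by (simp add: cinner_adj_left)
      also have "adj (a i) \<cdot> dual (B i j) \<cdot> a j \<cdot> \<xi> = dual (B i j) \<cdot> (adj (a i) * a j) \<cdot> \<xi>"
        using ij a B dual_in[of "B i j"] by (simp add: commutant_apply[of _ M] von_neumann_adj[OF M])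
      also have "cinner \<dots> \<xi> = cinner (B i j \<cdot> \<Psi> (adj (a i) * a j) \<cdot> \<zeta>) \<zeta>"
        using ij a B by (intro dual_pairing) (auto intro!: von_neumann_closed[OF M])
      finally show ?thesis .
    qed
    thus ?thesis
      using gram_pairing_nonneg[OF \<Psi> a B(2)] B(1) by (simp add: cinner_sum_left)
  qed
  show "positive_matrix n (\<lambda>i j. dual (B i j))"
    unfolding positive_matrix_def
  proof
    fix x :: "nat \<Rightarrow> 'h"
    have "\<exists>a. (\<forall>k. a k \<in> M) \<and> (\<lambda>k. a k \<cdot> \<xi>) \<longlonglongrightarrow> x i" for i
    proof -
      have "x i \<in> closure ((\<lambda>a. a \<cdot> \<xi>) ` M)"
        using cyclic by (simp add: cyclic_vector_def)
      then obtain v where v: "\<And>k. v k \<in> (\<lambda>a. a \<cdot> \<xi>) ` M" "v \<longlonglongrightarrow> x i"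
        by (auto simp: closure_sequential)
      have "\<forall>k. \<exists>a. a \<in> M \<and> v k = a \<cdot> \<xi>"
        using v(1) by auto
      then obtain a where "\<And>k. a k \<in> M" and "\<And>k. v k = a k \<cdot> \<xi>"
        by (auto dest!: choice)
      moreover from this have "v = (\<lambda>k. a k \<cdot> \<xi>)"
        by (intro ext)
      ultimately show ?thesis
        using v(2) by auto
    qed
    then obtain a where a: "\<And>i k. a i k \<in> M" "\<And>i. (\<lambda>k. a i k \<cdot> \<xi>) \<longlonglongrightarrow> x i"
      by metis
    have "(\<lambda>k. \<Sum>i<n. cinner (\<Sum>j<n. dual (B i j) \<cdot> a j k \<cdot> \<xi>) (a i k \<cdot> \<xi>))
        \<longlonglongrightarrow> (\<Sum>i<n. cinner (\<Sum>j<n. dual (B i j) \<cdot> x j) (x i))"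
      by (intro tendsto_sum tendsto_cinner bounded_linear.tendsto[OF bounded_linear_bop] a)
    thus "(\<Sum>i<n. cinner (\<Sum>j<n. dual (B i j) \<cdot> x j) (x i)) \<in> \<real>\<^sub>\<ge>\<^sub>0"
      by (rule closed_sequentially[OF closed_nonneg_Reals_complex, rotated]) (intro orbit a)
  qed
qed

end

section \<open>Positive unital maps are contractive\<close>

lemma power_scaleC: "(c *\<^sub>C a) ^ n = c ^ n *\<^sub>C (a :: 'h :: complex_inner bop) ^ n"
  by (induction n) (simp_all add: scaleC_scaleC scaleC_one mult.commute[of _ c])

lemma scaleC_zero_left [simp]: "0 *\<^sub>C x = (0 :: 'a :: complex_vector)"
  using scaleC_add_left[of 0 0 x] by simp

lemma scaleC_sum_left: "(\<Sum>i\<in>I. f i) *\<^sub>C x = (\<Sum>i\<in>I. f i *\<^sub>C (x :: 'a :: complex_vector))"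
  by (induction I rule: infinite_finite_induct) (auto simp: scaleC_add_left)

lemma scaleC_sum_right: "c *\<^sub>C (\<Sum>i\<in>I. f i) = (\<Sum>i\<in>I. c *\<^sub>C (f i :: 'a :: complex_vector))"
  by (induction I rule: infinite_finite_induct) (auto simp: scaleC_add_right)

text \<open>
  The sum over \<open>i < n\<close> of \<open>1 + \<Sum>\<^sub>1\<^sub>\<le>\<^sub>j\<^sub>\<le>\<^sub>i (z\<^sup>j + z\<^sup>*\<^sup>j)\<close>, i.e. \<open>n\<close> times the Fejer kernel with the
  exponential replaced by the operator \<open>z\<close>.  The summand for \<open>j = 0\<close> is \<open>2\<close>, which is corrected by
  the final \<open>- 1\<close>.
\<close>

definition fejer :: "nat \<Rightarrow> 'h :: chilbert_space bop \<Rightarrow> 'h bop" where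
  "fejer n z = (\<Sum>i<n. (\<Sum>j\<le>i. z ^ j + adj (z ^ j)) - 1)"

text \<open>
  With \<open>s\<^sub>i = x + z x + \<dots> + z\<^sup>i x\<close> one has \<open>x = s\<^sub>i - z s\<^sub>i\<^sub>-\<^sub>1\<close>, so that
  \<open>2 Re \<langle>s\<^sub>i, x\<rangle> - \<parallel>x\<parallel>\<^sup>2 = \<parallel>s\<^sub>i\<parallel>\<^sup>2 - \<parallel>z s\<^sub>i\<^sub>-\<^sub>1\<parallel>\<^sup>2 \<ge> \<parallel>s\<^sub>i\<parallel>\<^sup>2 - \<parallel>s\<^sub>i\<^sub>-\<^sub>1\<parallel>\<^sup>2\<close>,
  and the sum of the lower bounds telescopes.
\<close>

lemma fejer_partial_sums:
  fixes z :: "'h :: complex_inner bop"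
  assumes z: "norm z \<le> 1"
  shows "(norm ((\<Sum>j<n. z ^ j) \<cdot> x))\<^sup>2 \<le> (\<Sum>i<n. 2 * inner ((\<Sum>j\<le>i. z ^ j) \<cdot> x) x - (norm x)\<^sup>2)"
proof (induction n)
  case (Suc n)
  define s where "s = (\<Sum>j<n. z ^ j) \<cdot> x"
  define s' where "s' = (\<Sum>j\<le>n. z ^ j) \<cdot> x"
  have "(\<Sum>j\<le>n. z ^ j) = 1 + z * (\<Sum>j<n. z ^ j)"
    unfolding lessThan_Suc_atMost[symmetric] sum.lessThan_Suc_shift
    by (simp add: sum_distrib_left)
  hence x: "x = s' - z \<cdot> s"
    by (simp add: s_def s'_def)
  have "norm (z \<cdot> s) \<le> norm s"
    using norm_bop_apply_le[of z s] mult_right_mono[OF z norm_ge_zero[of s]] by simp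
  hence "(norm (z \<cdot> s))\<^sup>2 \<le> (norm s)\<^sup>2"
    by (intro power_mono) auto
  moreover have "2 * inner s' x - (norm x)\<^sup>2 = (norm s')\<^sup>2 - (norm (z \<cdot> s))\<^sup>2"
    unfolding x by (simp add: power2_norm_eq_inner inner_simps inner_commute)
  moreover have "(norm s)\<^sup>2 \<le> (\<Sum>i<n. 2 * inner ((\<Sum>j\<le>i. z ^ j) \<cdot> x) x - (norm x)\<^sup>2)"
    unfolding s_def by (rule Suc)
  ultimately have "(norm s')\<^sup>2 \<le> (\<Sum>i<Suc n. 2 * inner ((\<Sum>j\<le>i. z ^ j) \<cdot> x) x - (norm x)\<^sup>2)"
    unfolding sum.lessThan_Suc s'_def[symmetric] by linarith
  thus ?case
    by (simp only: s'_def lessThan_Suc_atMost)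
qed simp

lemma fejer_positive:
  assumes "norm z \<le> 1"
  shows "positive_op (fejer n z)"
  unfolding positive_op_def
proof
  fix x
  have "cinner ((z ^ j + adj (z ^ j)) \<cdot> x) x = of_real (2 * inner (z ^ j \<cdot> x) x)" for j
  proof -
    have "cinner ((z ^ j + adj (z ^ j)) \<cdot> x) x = cinner (z ^ j \<cdot> x) x + cnj (cinner (z ^ j \<cdot> x) x)"
      by (simp add: cinner_simps cinner_adj_left flip: cinner_commute)
    thus ?thesis
      by (simp only: complex_add_cnj Re_cinner)
  qed
  hence "cinner (fejer n z \<cdot> x) x =
      of_real (\<Sum>i<n. 2 * inner ((\<Sum>j\<le>i. z ^ j) \<cdot> x) x - (norm x)\<^sup>2)"
    by (simp add: fejer_def sum_bop_apply cinner_sum_left cinner_diff_left cinner_self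
        inner_sum_left sum_distrib_left del: plus_bop.rep_eq)
  moreover have "0 \<le> (\<Sum>i<n. 2 * inner ((\<Sum>j\<le>i. z ^ j) \<cdot> x) x - (norm x)\<^sup>2)"
    by (rule order_trans[OF _ fejer_partial_sums[OF assms]]) simp
  ultimately show "cinner (fejer n z \<cdot> x) x \<in> \<real>\<^sub>\<ge>\<^sub>0"
    by (simp only: nonneg_Reals_of_real_iff)
qed

lemma roots_of_unity_sum:
  fixes m :: nat and k :: int
  assumes "\<bar>k\<bar> < int m"
  shows "(\<Sum>l<m. cis (real l * (of_int k * (2 * pi / m)))) = (if k = 0 then of_nat m else 0)"
proof (cases "k = 0")
  case False
  define w where "w = cis (of_int k * (2 * pi / m))"
  have m: "real m > 0"
    using assms by (cases "m = 0") auto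
  have "w ^ m = cis (2 * pi * of_int k)"
    unfolding w_def Complex.DeMoivre using m by (intro arg_cong[where f = cis]) simp
  hence "w ^ m = 1"
    by (simp add: cis_multiple_2pi)
  have "w \<noteq> 1"
  proof
    assume "w = 1"
    hence "cos (of_int k * (2 * pi / m)) = 1"
      by (simp add: w_def complex_eq_iff)
    then obtain j :: int where "of_int k * (2 * pi / m) = of_int j * 2 * pi"
      by (auto simp: cos_one_2pi_int)
    hence "real_of_int k = real_of_int (j * int m)"
      using m by (simp add: field_simps)
    hence kj: "k = j * int m"
      by linarith
    hence "j \<noteq> 0"
      using False by auto
    hence "int m \<le> \<bar>j\<bar> * int m"
      using mult_right_mono[of 1 "\<bar>j\<bar>" "int m"] by simp
    thus False
      using assms kj by (simp add: abs_mult)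
  qed
  have "(\<Sum>l<m. cis (real l * (of_int k * (2 * pi / m)))) = (\<Sum>l<m. w ^ l)"
    by (simp add: w_def Complex.DeMoivre)
  also have "\<dots> = 0"
    using \<open>w \<noteq> 1\<close> \<open>w ^ m = 1\<close> by (simp add: geometric_sum)
  finally show ?thesis
    using False by simp
qed simp

text \<open>
  Fourier coefficients of \<open>\<theta> \<mapsto> fejer (Suc n) (e\<^sup>-\<^sup>i\<^sup>\<theta> a)\<close>, up to the factor \<open>m\<close>.  Since only the frequencies between
  \<open>- n\<close> and \<open>n\<close> occur, an average over \<open>n + 2\<close> roots of unity suffices for the coefficients of
  orders 0 and 1.
\<close>

lemma
  fixes a :: "'h :: chilbert_space bop" and n :: nat
  defines "m \<equiv> n + 2"
  defines "\<omega> \<equiv> \<lambda>l :: nat. cis (real l * (2 * pi / m))"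
  shows fejer_average_0: "(\<Sum>l<m. fejer (Suc n) (cnj (\<omega> l) *\<^sub>C a)) = of_nat (m * Suc n) *\<^sub>C 1"
    and fejer_average_1: "(\<Sum>l<m. \<omega> l *\<^sub>C fejer (Suc n) (cnj (\<omega> l) *\<^sub>C a)) = of_nat (m * n) *\<^sub>C a"
proof -
  define r where "r = (\<lambda>k :: int. \<Sum>l<m. cis (real l * (of_int k * (2 * pi / m))))"
  have r: "r k = (if k = 0 then of_nat m else 0)" if "\<bar>k\<bar> < int m" for k
    unfolding r_def by (rule roots_of_unity_sum[OF that])
  have \<omega>: "\<omega> l ^ k = cis (real l * (of_nat k * (2 * pi / m)))" for l k
    unfolding \<omega>_def Complex.DeMoivre by (intro arg_cong[where f = cis]) simp
  have key: "(\<Sum>l<m. \<omega> l ^ k *\<^sub>C fejer (Suc n) (cnj (\<omega> l) *\<^sub>C a)) = (\<Sum>i<Suc n.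
      (\<Sum>j\<le>i. r (int k - int j) *\<^sub>C a ^ j + r (int k + int j) *\<^sub>C adj (a ^ j)) - r (int k) *\<^sub>C 1)" for k
  proof -
    have minus: "\<omega> l ^ k * cnj (\<omega> l) ^ j = cis (real l * (of_int (int k - int j) * (2 * pi / m)))" for l j
      by (simp only: \<omega> cis_cnj cis_mult complex_cnj_power[symmetric])
        (intro arg_cong[where f = cis], simp add: left_diff_distrib right_diff_distrib diff_divide_distrib)
    have plus: "\<omega> l ^ k * \<omega> l ^ j = cis (real l * (of_int (int k + int j) * (2 * pi / m)))" for l j
      by (simp only: \<omega> cis_mult) (intro arg_cong[where f = cis], simp add: distrib_left distrib_right add_divide_distrib)
    have "(\<Sum>l<m. \<omega> l ^ k *\<^sub>C fejer (Suc n) (cnj (\<omega> l) *\<^sub>C a)) = (\<Sum>l<m. \<Sum>i<Suc n.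
        (\<Sum>j\<le>i. (\<omega> l ^ k * cnj (\<omega> l) ^ j) *\<^sub>C a ^ j + (\<omega> l ^ k * \<omega> l ^ j) *\<^sub>C adj (a ^ j))
        - \<omega> l ^ k *\<^sub>C 1)"
      by (simp add: fejer_def scaleC_sum_right scaleC_diff_right scaleC_add_right power_scaleC
          adj_scaleC scaleC_scaleC del: sum.lessThan_Suc)
    also have "\<dots> = (\<Sum>i<Suc n. \<Sum>l<m.
        (\<Sum>j\<le>i. (\<omega> l ^ k * cnj (\<omega> l) ^ j) *\<^sub>C a ^ j + (\<omega> l ^ k * \<omega> l ^ j) *\<^sub>C adj (a ^ j))
        - \<omega> l ^ k *\<^sub>C 1)"
      by (rule sum.swap)
    also have "\<dots> = (\<Sum>i<Suc n. (\<Sum>l<m. \<Sum>j\<le>i. (\<omega> l ^ k * cnj (\<omega> l) ^ j) *\<^sub>C a ^ j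
        + (\<omega> l ^ k * \<omega> l ^ j) *\<^sub>C adj (a ^ j)) - (\<Sum>l<m. \<omega> l ^ k *\<^sub>C 1))"
      by (simp only: sum_subtractf)
    also have "\<dots> = (\<Sum>i<Suc n. (\<Sum>j\<le>i. \<Sum>l<m. (\<omega> l ^ k * cnj (\<omega> l) ^ j) *\<^sub>C a ^ j
        + (\<omega> l ^ k * \<omega> l ^ j) *\<^sub>C adj (a ^ j)) - (\<Sum>l<m. \<omega> l ^ k *\<^sub>C 1))"
      by (rule sum.cong[OF refl], rule arg_cong2[where f = minus, OF sum.swap refl])
    also have "\<dots> = (\<Sum>i<Suc n.
        (\<Sum>j\<le>i. r (int k - int j) *\<^sub>C a ^ j + r (int k + int j) *\<^sub>C adj (a ^ j)) - r (int k) *\<^sub>C 1)"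
      by (simp only: sum.distrib scaleC_sum_left[symmetric] minus plus)
        (simp only: r_def \<omega> of_int_of_nat_eq)
    finally show ?thesis .
  qed
  have "(\<Sum>l<m. fejer (Suc n) (cnj (\<omega> l) *\<^sub>C a)) = (\<Sum>i<Suc n. of_nat m *\<^sub>C (1 :: 'h bop))"
  proof -
    have "(\<Sum>j\<le>i. r (int 0 - int j) *\<^sub>C a ^ j + r (int 0 + int j) *\<^sub>C adj (a ^ j)) - r (int 0) *\<^sub>C 1
        = of_nat m *\<^sub>C 1" if "i < Suc n" for i
    proof -
      have "(\<Sum>j\<le>i. r (int 0 - int j) *\<^sub>C a ^ j + r (int 0 + int j) *\<^sub>C adj (a ^ j))
        = (\<Sum>j\<le>i. if j = 0 then of_nat m *\<^sub>C 1 + of_nat m *\<^sub>C 1 else 0)"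
      proof (rule sum.cong[OF refl])
        fix j assume "j \<in> {..i}"
        hence "j < m"
          using that by (simp add: m_def)
        thus "r (int 0 - int j) *\<^sub>C a ^ j + r (int 0 + int j) *\<^sub>C adj (a ^ j)
            = (if j = 0 then of_nat m *\<^sub>C 1 + of_nat m *\<^sub>C 1 else 0)"
          by (cases "j = 0") (simp_all add: r)
      qed
      also have "\<dots> = of_nat m *\<^sub>C 1 + of_nat m *\<^sub>C 1"
        by (subst sum.delta) auto
      finally show ?thesis
        using r[of 0] by (simp add: m_def)
    qed
    thus ?thesis
      using key[of 0] by (simp add: scaleC_one del: sum.lessThan_Suc)
  qed
  thus "(\<Sum>l<m. fejer (Suc n) (cnj (\<omega> l) *\<^sub>C a)) = of_nat (m * Suc n) *\<^sub>C 1"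
    by (simp only: scaleC_sum_left[symmetric] sum_constant card_lessThan of_nat_mult mult.commute)
  have "(\<Sum>l<m. \<omega> l *\<^sub>C fejer (Suc n) (cnj (\<omega> l) *\<^sub>C a)) = (\<Sum>i<Suc n. if i = 0 then 0 else of_nat m *\<^sub>C a)"
  proof -
    have "(\<Sum>j\<le>i. r (int 1 - int j) *\<^sub>C a ^ j + r (int 1 + int j) *\<^sub>C adj (a ^ j)) - r (int 1) *\<^sub>C 1
        = (if i = 0 then 0 else of_nat m *\<^sub>C a)" if "i < Suc n" for i
    proof -
      have "(\<Sum>j\<le>i. r (int 1 - int j) *\<^sub>C a ^ j + r (int 1 + int j) *\<^sub>C adj (a ^ j))
        = (\<Sum>j\<le>i. if j = 1 then of_nat m *\<^sub>C a else 0)"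
      proof (rule sum.cong[OF refl])
        fix j assume "j \<in> {..i}"
        hence "j \<le> n"
          using that by simp
        hence "r (int 1 - int j) = (if j = 1 then of_nat m else 0)" "r (int 1 + int j) = 0"
          by (auto simp: r m_def)
        thus "r (int 1 - int j) *\<^sub>C a ^ j + r (int 1 + int j) *\<^sub>C adj (a ^ j)
            = (if j = 1 then of_nat m *\<^sub>C a else 0)"
          by simp
      qed
      also have "\<dots> = (if i = 0 then 0 else of_nat m *\<^sub>C a)"
        by (subst sum.delta) auto
      finally show ?thesis
        using r[of 1] by (simp add: m_def)
    qed
    thus ?thesis
      using key[of 1] by (simp del: sum.lessThan_Suc)
  qed
  also have "\<dots> = (\<Sum>i<n. of_nat m *\<^sub>C a)"
    by (simp add: sum.lessThan_Suc_shift del: sum.lessThan_Suc)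
  finally show "(\<Sum>l<m. \<omega> l *\<^sub>C fejer (Suc n) (cnj (\<omega> l) *\<^sub>C a)) = of_nat (m * n) *\<^sub>C a"
    by (simp only: scaleC_sum_left[symmetric] sum_constant card_lessThan of_nat_mult mult.commute)
qed

lemma positive_op_cinner_bound:
  assumes "positive_op b"
  shows "cmod (cinner (b \<cdot> x) y) \<le> (Re (cinner (b \<cdot> x) x) + Re (cinner (b \<cdot> y) y)) / 2"
proof (rule power2_le_imp_le)
  have nonneg: "cinner (b \<cdot> x) x \<in> \<real>\<^sub>\<ge>\<^sub>0" for x
    using assms by (simp add: positive_op_def)
  have "(cmod (cinner (b \<cdot> x) y))\<^sup>2 \<le> Re (cinner (b \<cdot> x) x) * Re (cinner (b \<cdot> y) y)"
    by (rule nonneg_form_Cauchy_Schwarz[where S = UNIV]) (auto simp: bop_linear_simps cinner_simps nonneg)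
  also have "\<dots> \<le> ((Re (cinner (b \<cdot> x) x) + Re (cinner (b \<cdot> y) y)) / 2)\<^sup>2"
    using sum_squares_bound[of "Re (cinner (b \<cdot> x) x)" "Re (cinner (b \<cdot> y) y)"]
    by (simp add: power2_eq_square field_simps)
  finally show "(cmod (cinner (b \<cdot> x) y))\<^sup>2 \<le> \<dots>" .
  show "0 \<le> (Re (cinner (b \<cdot> x) x) + Re (cinner (b \<cdot> y) y)) / 2"
    using nonneg[of x] nonneg[of y] by (simp add: complex_nonneg_Reals_iff)
qed

text \<open>
  The Russo--Dye theorem for contractions \<open>a\<close> that need not be unitary.  The positive operators
  \<open>fejer (Suc n) (e\<^sup>-\<^sup>i\<^sup>\<theta> a)\<close>, divided by \<open>n + 1\<close>, have the average \<open>1\<close>, and their multiples by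
  \<open>e\<^sup>i\<^sup>\<theta>\<close> have the average \<open>n / (n + 1) a\<close>.  The Cauchy--Schwarz inequality for their images bounds the
  matrix coefficients of the image of \<open>a\<close>.
\<close>

lemma positive_unital_contractive:
  fixes \<Phi> :: "'k :: chilbert_space bop \<Rightarrow> 'h :: chilbert_space bop"
  assumes A: "von_neumann_algebra A" and positive: "positive_map A B \<Phi>" and unital: "\<Phi> 1 = 1"
    and a: "a \<in> A" "norm a \<le> 1"
  shows "norm (\<Phi> a) \<le> 1"
proof (rule norm_bop_leI)
  have \<Phi>_add: "\<Phi> (b + c) = \<Phi> b + \<Phi> c" if "b \<in> A" "c \<in> A" for b c
    using positive that by (simp add: positive_map_def linear_map_on_def)
  have \<Phi>_scaleC: "\<Phi> (z *\<^sub>C b) = z *\<^sub>C \<Phi> b"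
    and \<Phi>_pos: "positive_op b \<Longrightarrow> positive_op (\<Phi> b)" if "b \<in> A" for b z
    using positive that by (auto simp: positive_map_def linear_map_on_def)
  have \<Phi>_sum: "\<Phi> (\<Sum>i\<in>I. f i) = (\<Sum>i\<in>I. \<Phi> (f i))" if "\<And>i. i \<in> I \<Longrightarrow> f i \<in> A"
    for I :: "nat set" and f
    using that
  proof (induction I rule: infinite_finite_induct)
    case empty
    show ?case
      using \<Phi>_scaleC[of 0 0] by (simp add: von_neumann_zero[OF A])
  next
    case (infinite I)
    thus ?case
      using \<Phi>_scaleC[of 0 0] by (simp add: von_neumann_zero[OF A])
  qed (simp add: \<Phi>_add von_neumann_sum[OF A])
  have half: "cmod (cinner (\<Phi> a \<cdot> x) y) \<le> ((norm x)\<^sup>2 + (norm y)\<^sup>2) / 2" for x y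
  proof -
    define d where "d = ((norm x)\<^sup>2 + (norm y)\<^sup>2) / 2"
    have bound: "cmod (cinner (\<Phi> a \<cdot> x) y) \<le> (1 + inverse (real (Suc k))) * d" for k
    proof -
      define n where "n = Suc k"
      define m where "m = n + 2"
      define \<omega> where "\<omega> = (\<lambda>l :: nat. cis (real l * (2 * pi / m)))"
      define P where "P = (\<lambda>l. fejer (Suc n) (cnj (\<omega> l) *\<^sub>C a))"
      have P_in: "P l \<in> A" for l
        unfolding P_def fejer_def
        by (intro von_neumann_closed[OF A] a)
      have "norm (cnj (\<omega> l) *\<^sub>C a) \<le> 1" for l
      proof (rule norm_bop_leI)
        show "norm ((cnj (\<omega> l) *\<^sub>C a) \<cdot> v) \<le> 1 * norm v" for v
          using norm_bop_apply_le[of a v] mult_right_mono[OF a(2) norm_ge_zero[of v]]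
          by (simp add: norm_scaleC \<omega>_def)
      qed simp
      hence P_pos: "positive_op (\<Phi> (P l))" for l
        using P_in by (intro \<Phi>_pos) (auto simp: P_def intro: fejer_positive)
      have "(\<Sum>l<m. \<Phi> (P l)) = \<Phi> (\<Sum>l<m. P l)"
        by (rule \<Phi>_sum[symmetric]) (rule P_in)
      also have "(\<Sum>l<m. P l) = of_nat (m * Suc n) *\<^sub>C 1"
        unfolding P_def \<omega>_def m_def by (rule fejer_average_0)
      finally have average_0: "(\<Sum>l<m. \<Phi> (P l)) = of_nat (m * Suc n) *\<^sub>C 1"
        using von_neumann_one[OF A] by (simp only: \<Phi>_scaleC unital)
      have diag: "(\<Sum>l<m. Re (cinner (\<Phi> (P l) \<cdot> v) v)) = real (m * Suc n) * (norm v)\<^sup>2" for v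
      proof -
        have "cinner ((\<Sum>l<m. \<Phi> (P l)) \<cdot> v) v = of_nat (m * Suc n) * of_real ((norm v)\<^sup>2)"
          by (simp only: average_0 scaleC_bop.rep_eq one_bop.rep_eq cinner_scaleC_left cinner_self)
        also have "\<dots> = of_real (real (m * Suc n) * (norm v)\<^sup>2)"
          by (simp only: of_real_mult of_real_of_nat_eq)
        finally have "Re (cinner ((\<Sum>l<m. \<Phi> (P l)) \<cdot> v) v) = real (m * Suc n) * (norm v)\<^sup>2"
          by (simp only: Re_complex_of_real)
        thus ?thesis
          by (simp add: sum_bop_apply cinner_sum_left)
      qed
      have "(\<Sum>l<m. \<omega> l *\<^sub>C P l) = of_nat (m * n) *\<^sub>C a"
        unfolding P_def \<omega>_def m_def by (rule fejer_average_1)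
      hence "of_nat (m * n) *\<^sub>C \<Phi> a = \<Phi> (\<Sum>l<m. \<omega> l *\<^sub>C P l)"
        using a by (simp only: \<Phi>_scaleC)
      also have "\<dots> = (\<Sum>l<m. \<omega> l *\<^sub>C \<Phi> (P l))"
        using P_in by (simp add: \<Phi>_sum \<Phi>_scaleC von_neumann_scaleC[OF A])
      finally have average_1: "of_nat (m * n) *\<^sub>C \<Phi> a = (\<Sum>l<m. \<omega> l *\<^sub>C \<Phi> (P l))" .
      have "real (m * n) * cmod (cinner (\<Phi> a \<cdot> x) y) = cmod (cinner ((of_nat (m * n) *\<^sub>C \<Phi> a) \<cdot> x) y)"
        by (simp only: scaleC_bop.rep_eq cinner_scaleC_left norm_mult norm_of_nat)
      also have "\<dots> = cmod (\<Sum>l<m. \<omega> l * cinner (\<Phi> (P l) \<cdot> x) y)"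
        by (simp only: average_1 sum_bop_apply scaleC_bop.rep_eq cinner_sum_left cinner_scaleC_left)
      also have "\<dots> \<le> (\<Sum>l<m. cmod (cinner (\<Phi> (P l) \<cdot> x) y))"
        by (rule order_trans[OF norm_sum]) (simp add: norm_mult \<omega>_def)
      also have "\<dots> \<le> (\<Sum>l<m. (Re (cinner (\<Phi> (P l) \<cdot> x) x) + Re (cinner (\<Phi> (P l) \<cdot> y) y)) / 2)"
        by (intro sum_mono positive_op_cinner_bound P_pos)
      also have "\<dots> = real (m * Suc n) * d"
        by (simp only: sum_divide_distrib[symmetric] sum.distrib diag d_def)
          (simp add: algebra_simps add_divide_distrib)
      finally have "real m * (real n * cmod (cinner (\<Phi> a \<cdot> x) y)) \<le> real m * (real (Suc n) * d)"
        by (simp only: of_nat_mult mult.assoc)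
      hence "real n * cmod (cinner (\<Phi> a \<cdot> x) y) \<le> real (Suc n) * d"
        by (simp add: m_def)
      thus ?thesis
        by (simp add: n_def field_simps)
    qed
    have "(\<lambda>k. (1 + inverse (real (Suc k))) * d) \<longlonglongrightarrow> (1 + 0) * d"
      by (intro tendsto_mult tendsto_add tendsto_const LIMSEQ_inverse_real_of_nat)
    thus ?thesis
      using bound unfolding d_def by (intro LIMSEQ_le_const) auto
  qed
  show "norm (\<Phi> a \<cdot> x) \<le> 1 * norm x" for x
  proof (cases "\<Phi> a \<cdot> x = 0")
    case False
    define v where "v = \<Phi> a \<cdot> x"
    have v: "norm v > 0"
      using False by (simp add: v_def)
    \<comment> \<open>Rescaling \<open>v\<close> to the length of \<open>x\<close> balances the two squares.\<close>
    have "cmod (cinner v ((norm x / norm v) *\<^sub>R v)) = norm x * norm v"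
      using v by (simp add: cinner_simps cinner_self norm_mult power2_eq_square)
    moreover have "cmod (cinner v ((norm x / norm v) *\<^sub>R v)) \<le> (norm x)\<^sup>2"
      using half[of x "(norm x / norm v) *\<^sub>R v"] v by (simp add: v_def)
    ultimately have "norm x * norm v \<le> norm x * norm x"
      by (simp add: power2_eq_square)
    moreover have "norm x > 0"
      using False by auto
    ultimately show ?thesis
      by (simp add: v_def)
  qed simp
qed simp

section \<open>Gradings and twists\<close>

lemma bop_cinner_eqI: "(\<And>x y. cinner (a \<cdot> x) y = cinner (b \<cdot> x) y) \<Longrightarrow> a = (b :: 'h :: complex_inner bop)"
  by (intro bop_eqI cinner_ext)

text \<open>
  The maps \<open>a \<mapsto> a\<^sub>+ + c \<Gamma> a\<^sub>-\<close>, which comprise \<open>kappa\<close> (for \<open>c = 1\<close>), \<open>eta\<close> (for \<open>c = \<i>\<close>) and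
  the inverse of \<open>eta\<close> (for \<open>c = - \<i>\<close>).
\<close>

definition twist :: "'h :: complex_inner bop \<Rightarrow> complex \<Rightarrow> 'h bop \<Rightarrow> 'h bop" where
  "twist \<Gamma> c a = even_part \<Gamma> a + c *\<^sub>C (\<Gamma> * odd_part \<Gamma> a)"

lemma kappa_eq_twist: "kappa \<Gamma> = twist \<Gamma> 1"
  by (simp add: fun_eq_iff kappa_def twist_def scaleC_one)

lemma eta_eq_twist: "eta \<Gamma> = twist \<Gamma> \<i>"
  by (simp add: fun_eq_iff eta_def twist_def)

text \<open>The unitary that implements \<open>eta\<close>: \<open>1\<close> on the even and \<open>- \<i>\<close> on the odd vectors.\<close>

definition eta_unitary :: "'h :: complex_inner bop \<Rightarrow> 'h bop" where
  "eta_unitary \<Gamma> = ((1 - \<i>) / 2) *\<^sub>C 1 + ((1 + \<i>) / 2) *\<^sub>C \<Gamma>"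

text \<open>A self-adjoint unitary, regarded as the grading \<open>\<Gamma> (\<cdot>) \<Gamma>\<close> of the bounded operators.\<close>

locale grading_operator =
  fixes \<Gamma> :: "'h :: chilbert_space bop"
  assumes self_adjoint_unitary: "self_adjoint_unitary \<Gamma>"
begin

lemma adj_grading_operator: "adj \<Gamma> = \<Gamma>"
  using self_adjoint_unitary by (simp add: self_adjoint_unitary_def)

lemma involution: "\<Gamma> * \<Gamma> = 1"
  using self_adjoint_unitary by (simp add: self_adjoint_unitary_def)

lemma involution_apply [simp]: "\<Gamma> \<cdot> \<Gamma> \<cdot> x = x"
  using involution by (metis one_bop.rep_eq times_bop.rep_eq)

lemma cinner_grading_operator: "cinner (\<Gamma> \<cdot> x) y = cinner x (\<Gamma> \<cdot> y)"
  by (metis adj_grading_operator cinner_adj_left)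

abbreviation "V \<equiv> eta_unitary \<Gamma>"

lemmas part_defs = even_part_def odd_part_def grading_def twist_def

lemma grading_grading [simp]: "grading \<Gamma> (grading \<Gamma> a) = a"
  by (rule bop_eqI) (simp add: grading_def)

lemma grading_add: "grading \<Gamma> (a + b) = grading \<Gamma> a + grading \<Gamma> b"
  by (simp add: grading_def algebra_simps)

lemma grading_scaleC: "grading \<Gamma> (c *\<^sub>C a) = c *\<^sub>C grading \<Gamma> a"
  by (simp add: grading_def)

lemma grading_mult: "grading \<Gamma> (a * b) = grading \<Gamma> a * grading \<Gamma> b"
  by (rule bop_eqI) (simp add: grading_def)

lemma grading_adj: "grading \<Gamma> (adj a) = adj (grading \<Gamma> a)"
  by (simp add: grading_def adj_mult adj_grading_operator mult.assoc)

lemma even_add_odd: "even_part \<Gamma> a + odd_part \<Gamma> a = a"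
  by (rule bop_cinner_eqI) (simp add: part_defs cinner_simps bop_linear_simps algebra_simps)

lemma even_part_twist: "even_part \<Gamma> (even_part \<Gamma> a + c *\<^sub>C odd_part \<Gamma> a) = even_part \<Gamma> a"
  and odd_part_twist: "odd_part \<Gamma> (even_part \<Gamma> a + c *\<^sub>C odd_part \<Gamma> a) = c *\<^sub>C odd_part \<Gamma> a"
  by (rule bop_cinner_eqI, simp add: part_defs cinner_simps bop_linear_simps algebra_simps)+

lemma twist_twist: "twist \<Gamma> c (twist \<Gamma> d a) = even_part \<Gamma> a + (c * d) *\<^sub>C odd_part \<Gamma> a"
  by (rule bop_cinner_eqI) (simp add: part_defs cinner_simps bop_linear_simps algebra_simps)

lemma twist_twist_inverse: "c * d = 1 \<Longrightarrow> twist \<Gamma> c (twist \<Gamma> d a) = a"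
  by (simp add: twist_twist scaleC_one even_add_odd)

lemma twist_parts: "twist \<Gamma> c (even_part \<Gamma> a + d *\<^sub>C odd_part \<Gamma> a) = twist \<Gamma> (c * d) a"
  by (simp add: twist_def even_part_twist odd_part_twist scaleC_scaleC)

lemma twist_add: "twist \<Gamma> c (a + b) = twist \<Gamma> c a + twist \<Gamma> c b"
  by (rule bop_cinner_eqI) (simp add: part_defs cinner_simps bop_linear_simps algebra_simps)

lemma twist_scaleC: "twist \<Gamma> c (d *\<^sub>C a) = d *\<^sub>C twist \<Gamma> c a"
  by (rule bop_cinner_eqI) (simp add: part_defs cinner_simps bop_linear_simps algebra_simps)

lemma twist_one: "twist \<Gamma> c 1 = 1"
  by (rule bop_cinner_eqI) (simp add: part_defs cinner_simps bop_linear_simps algebra_simps)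

lemma twist_grading: "twist \<Gamma> c (grading \<Gamma> a) = grading \<Gamma> (twist \<Gamma> c a)"
  by (rule bop_cinner_eqI) (simp add: part_defs cinner_simps bop_linear_simps algebra_simps)

lemma inv_eta: "inv (eta \<Gamma>) = twist \<Gamma> (- \<i>)"
  by (rule inv_equality) (simp_all add: eta_eq_twist twist_twist_inverse)

lemma adj_eta_unitary: "adj V = ((1 + \<i>) / 2) *\<^sub>C 1 + ((1 - \<i>) / 2) *\<^sub>C \<Gamma>"
  by (simp add: eta_unitary_def adj_add adj_scaleC adj_grading_operator)

lemma twist_expand: "twist \<Gamma> c a = (1 / 2) *\<^sub>C a + (- (c / 2)) *\<^sub>C (a * \<Gamma>) + (c / 2) *\<^sub>C (\<Gamma> * a)
    + (1 / 2) *\<^sub>C (\<Gamma> * a * \<Gamma>)"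
  by (rule bop_cinner_eqI) (simp add: part_defs cinner_simps bop_linear_simps algebra_simps)

lemma conjugation_expand:
  "(s *\<^sub>C 1 + t *\<^sub>C \<Gamma>) * a * (t *\<^sub>C 1 + s *\<^sub>C \<Gamma>) =
    (s * t) *\<^sub>C a + (s * s) *\<^sub>C (a * \<Gamma>) + (t * t) *\<^sub>C (\<Gamma> * a) + (s * t) *\<^sub>C (\<Gamma> * a * \<Gamma>)"
  by (rule bop_cinner_eqI) (simp add: cinner_simps bop_linear_simps algebra_simps)

lemma twist_eq_conjugation: "twist \<Gamma> \<i> a = V * a * adj V" "twist \<Gamma> (- \<i>) a = adj V * a * V"
proof -
  have "(1 - \<i>) / 2 * ((1 + \<i>) / 2) = 1 / 2" "(1 + \<i>) / 2 * ((1 - \<i>) / 2) = 1 / 2"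
    "(1 - \<i>) / 2 * ((1 - \<i>) / 2) = - (\<i> / 2)" "(1 + \<i>) / 2 * ((1 + \<i>) / 2) = \<i> / 2"
    "- (- \<i> / 2) = \<i> / 2" "- \<i> / 2 = - (\<i> / 2)"
    by (simp_all add: complex_eq_iff)
  thus "twist \<Gamma> \<i> a = V * a * adj V" "twist \<Gamma> (- \<i>) a = adj V * a * V"
    unfolding adj_eta_unitary unfolding eta_unitary_def conjugation_expand twist_expand
    by (simp_all only:)
qed

lemma eta_unitary_inverse: "V * adj V = 1" "adj V * V = 1"
  using twist_eq_conjugation[of 1] by (simp_all add: twist_one)

lemma twist_mult:
  "twist \<Gamma> (- \<i>) (a * b) = twist \<Gamma> (- \<i>) a * twist \<Gamma> (- \<i>) b"
proof -
  have "a * b = a * (V * adj V) * b"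
    by (simp add: eta_unitary_inverse)
  thus ?thesis
    by (simp add: twist_eq_conjugation mult.assoc)
qed

lemma twist_adj: "twist \<Gamma> (- \<i>) (adj a) = adj (twist \<Gamma> (- \<i>) a)"
  by (simp add: twist_eq_conjugation adj_mult mult.assoc)

end

lemma positive_matrix_conjugation:
  fixes W :: "'h :: chilbert_space bop"
  assumes "positive_matrix n A"
  shows "positive_matrix n (\<lambda>i j. W * A i j * adj W)"
  unfolding positive_matrix_def
proof
  fix x :: "nat \<Rightarrow> 'h"
  have "(\<Sum>i<n. cinner (\<Sum>j<n. A i j \<cdot> adj W \<cdot> x j) (adj W \<cdot> x i)) \<in> \<real>\<^sub>\<ge>\<^sub>0"
    using assms unfolding positive_matrix_def by (rule spec)
  thus "(\<Sum>i<n. cinner (\<Sum>j<n. (W * A i j * adj W) \<cdot> x j) (x i)) \<in> \<real>\<^sub>\<ge>\<^sub>0"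
    by (simp add: cinner_sum_left cinner_adj_right bop_sum_right)
qed

text \<open>A von Neumann algebra that is invariant under the grading defined by \<open>\<Gamma>\<close>.\<close>

locale invariant_algebra = grading_operator +
  fixes X :: "'a bop set"
  assumes vn: "von_neumann_algebra X"
    and invariant: "\<And>a. a \<in> X \<Longrightarrow> grading \<Gamma> a \<in> X"
begin

lemma even_part_in: "a \<in> X \<Longrightarrow> even_part \<Gamma> a \<in> X"
  by (auto simp: even_part_def invariant intro!: von_neumann_closed[OF vn])

lemma odd_part_in: "a \<in> X \<Longrightarrow> odd_part \<Gamma> a \<in> X"
  by (auto simp: odd_part_def invariant intro!: von_neumann_closed[OF vn])

lemma invariant_commutant: "invariant_algebra \<Gamma> (commutant X)"
proof
  show "von_neumann_algebra (commutant X)"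
    by (rule von_neumann_commutant[OF vn])
  fix b assume b: "b \<in> commutant X"
  have "a * grading \<Gamma> b = grading \<Gamma> b * a" if "a \<in> X" for a
    using commutantD[OF b invariant[OF that]] by (metis grading_grading grading_mult)
  thus "grading \<Gamma> b \<in> commutant X"
    by (simp add: commutant_def)
qed

lemma twist_in_kappa_image:
  assumes "a \<in> X"
  shows "twist \<Gamma> c a \<in> kappa \<Gamma> ` X"
proof
  show "twist \<Gamma> c a = kappa \<Gamma> (even_part \<Gamma> a + c *\<^sub>C odd_part \<Gamma> a)"
    by (simp add: kappa_eq_twist twist_parts)
  show "even_part \<Gamma> a + c *\<^sub>C odd_part \<Gamma> a \<in> X"
    by (intro von_neumann_closed[OF vn] even_part_in odd_part_in assms)
qed

lemma twist_kappa_image_in: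
  assumes "b \<in> kappa \<Gamma> ` X"
  shows "twist \<Gamma> c b \<in> X"
proof -
  obtain a where "a \<in> X" "b = twist \<Gamma> 1 a"
    using assms by (auto simp: kappa_eq_twist)
  thus ?thesis
    by (auto simp: twist_twist intro!: von_neumann_closed[OF vn] even_part_in odd_part_in)
qed

lemma kappa_image_iff: "b \<in> kappa \<Gamma> ` X \<longleftrightarrow> twist \<Gamma> (- \<i>) b \<in> X"
proof
  assume "twist \<Gamma> (- \<i>) b \<in> X"
  hence "twist \<Gamma> \<i> (twist \<Gamma> (- \<i>) b) \<in> kappa \<Gamma> ` X"
    by (rule twist_in_kappa_image)
  thus "b \<in> kappa \<Gamma> ` X"
    by (simp add: twist_twist_inverse)
qed (rule twist_kappa_image_in)

text \<open>
  Twisting commutes with passage to the commutant, because the image of \<open>X\<close> under \<open>kappa\<close> is also its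
  image under the automorphism \<open>eta\<close>.
\<close>

lemma commutant_kappa_image: "commutant (kappa \<Gamma> ` X) = kappa \<Gamma> ` commutant X"
proof -
  interpret commutant: invariant_algebra \<Gamma> "commutant X"
    by (rule invariant_commutant)
  have "c \<in> commutant (kappa \<Gamma> ` X) \<longleftrightarrow> twist \<Gamma> (- \<i>) c \<in> commutant X" for c
  proof
    assume c: "c \<in> commutant (kappa \<Gamma> ` X)"
    have "a * twist \<Gamma> (- \<i>) c = twist \<Gamma> (- \<i>) c * a" if "a \<in> X" for a
    proof -
      have "twist \<Gamma> (- \<i>) (twist \<Gamma> \<i> a * c) = twist \<Gamma> (- \<i>) (c * twist \<Gamma> \<i> a)"
        using commutantD[OF c twist_in_kappa_image[OF that, of \<i>]] by simp
      thus ?thesis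
        by (simp add: twist_mult twist_twist_inverse)
    qed
    thus "twist \<Gamma> (- \<i>) c \<in> commutant X"
      by (simp add: commutant_def)
  next
    assume c: "twist \<Gamma> (- \<i>) c \<in> commutant X"
    have "b * c = c * b" if "b \<in> kappa \<Gamma> ` X" for b
    proof -
      have "twist \<Gamma> (- \<i>) (b * c) = twist \<Gamma> (- \<i>) (c * b)"
        using commutantD[OF c twist_kappa_image_in[OF that, of "- \<i>"]] by (simp add: twist_mult)
      hence "twist \<Gamma> \<i> (twist \<Gamma> (- \<i>) (b * c)) = twist \<Gamma> \<i> (twist \<Gamma> (- \<i>) (c * b))"
        by simp
      thus ?thesis
        by (simp add: twist_twist_inverse)
    qed
    thus "c \<in> commutant (kappa \<Gamma> ` X)"
      by (simp add: commutant_def)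
  qed
  thus ?thesis
    using commutant.kappa_image_iff by blast
qed

lemma invariant_kappa_image: "invariant_algebra \<Gamma> (kappa \<Gamma> ` X)"
proof
  interpret commutant: invariant_algebra \<Gamma> "commutant X"
    by (rule invariant_commutant)
  have "commutant (commutant (kappa \<Gamma> ` X)) = kappa \<Gamma> ` X"
    by (simp add: commutant_kappa_image commutant.commutant_kappa_image von_neumann_bicommutant[OF vn])
  moreover have "adj b \<in> kappa \<Gamma> ` X" if "b \<in> kappa \<Gamma> ` X" for b
    using that unfolding kappa_image_iff twist_adj by (rule von_neumann_adj[OF vn])
  ultimately show "von_neumann_algebra (kappa \<Gamma> ` X)"
    by (simp add: von_neumann_algebra_def)
  show "grading \<Gamma> b \<in> kappa \<Gamma> ` X" if "b \<in> kappa \<Gamma> ` X" for b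
    using that unfolding kappa_image_iff twist_grading by (rule invariant)
qed

text \<open>
  On a vector fixed by \<open>\<Gamma>\<close>, \<open>twist \<Gamma> 1 a\<close> agrees with \<open>grading \<Gamma> a\<close>, while its adjoint agrees with
  that of \<open>a\<close>; the latter is stated without adjoints.
\<close>

lemma twist_1_fixed_vector:
  assumes "\<Gamma> \<cdot> \<xi> = \<xi>"
  shows "twist \<Gamma> 1 a \<cdot> \<xi> = grading \<Gamma> a \<cdot> \<xi>"
    and "cinner (twist \<Gamma> 1 a \<cdot> v) \<xi> = cinner (a \<cdot> v) \<xi>"
proof -
  show "twist \<Gamma> 1 a \<cdot> \<xi> = grading \<Gamma> a \<cdot> \<xi>"
    by (rule cinner_ext)
      (simp add: part_defs assms bop_linear_simps scaleC_one cinner_simps algebra_simps)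
  have "cinner (\<Gamma> \<cdot> w) \<xi> = cinner w \<xi>" for w
    by (simp add: cinner_grading_operator assms)
  thus "cinner (twist \<Gamma> 1 a \<cdot> v) \<xi> = cinner (a \<cdot> v) \<xi>"
    by (simp add: part_defs bop_linear_simps scaleC_one cinner_simps algebra_simps)
qed

lemma kappa_image_orbit:
  assumes "\<Gamma> \<cdot> \<xi> = \<xi>"
  shows "(\<lambda>b. b \<cdot> \<xi>) ` kappa \<Gamma> ` X = (\<lambda>b. b \<cdot> \<xi>) ` X"
proof safe
  fix a assume a: "a \<in> X"
  show "kappa \<Gamma> a \<cdot> \<xi> \<in> (\<lambda>b. b \<cdot> \<xi>) ` X"
    using invariant[OF a] by (simp add: kappa_eq_twist twist_1_fixed_vector[OF assms])
  have "a \<cdot> \<xi> = kappa \<Gamma> (grading \<Gamma> a) \<cdot> \<xi>"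
    by (simp add: kappa_eq_twist twist_1_fixed_vector[OF assms])
  thus "a \<cdot> \<xi> \<in> (\<lambda>b. b \<cdot> \<xi>) ` kappa \<Gamma> ` X"
    using invariant[OF a] by blast
qed

lemma graded_vn_algebra_grading:
  assumes "\<Gamma> \<cdot> \<xi> = \<xi>" "norm \<xi> = 1" "cyclic_vector X \<xi>"
  shows "graded_vn_algebra X (grading \<Gamma>) \<xi>" "grading_unitary X (grading \<Gamma>) \<xi> = \<Gamma>"
proof -
  have "bij_betw (grading \<Gamma>) X X"
    by (rule bij_betw_byWitness[where f' = "grading \<Gamma>"]) (auto simp: invariant)
  moreover have "vector_state \<xi> (grading \<Gamma> a) = vector_state \<xi> a" for a
    by (simp add: vector_state_def grading_def assms cinner_grading_operator)
  ultimately show "graded_vn_algebra X (grading \<Gamma>) \<xi>"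
    using assms by (simp add: graded_vn_algebra_def vn star_automorphism_def linear_map_on_def
        grading_add grading_scaleC grading_mult grading_adj)
  show "grading_unitary X (grading \<Gamma>) \<xi> = \<Gamma>"
    unfolding grading_unitary_def
  proof (rule the_equality)
    show *: "self_adjoint_unitary \<Gamma> \<and> (\<forall>a\<in>X. \<Gamma> \<cdot> a \<cdot> \<xi> = grading \<Gamma> a \<cdot> \<xi>)"
      by (simp add: self_adjoint_unitary grading_def assms)
    show "\<Gamma>' = \<Gamma>" if "self_adjoint_unitary \<Gamma>' \<and> (\<forall>a\<in>X. \<Gamma>' \<cdot> a \<cdot> \<xi> = grading \<Gamma> a \<cdot> \<xi>)" for \<Gamma>'
      using that * by (intro bop_eq_on_cyclic[OF assms(3)]) auto
  qed
qed

end

section \<open>The grading unitary\<close>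

lemma grading_unitary:
  fixes M :: "'h :: chilbert_space bop set"
  assumes graded: "graded_vn_algebra M \<theta> \<xi>"
  defines "\<Gamma> \<equiv> grading_unitary M \<theta> \<xi>"
  shows "self_adjoint_unitary \<Gamma>" and "\<And>a. a \<in> M \<Longrightarrow> \<Gamma> \<cdot> a \<cdot> \<xi> = \<theta> a \<cdot> \<xi>"
proof -
  have M: "von_neumann_algebra M" and cyc: "cyclic_vector M \<xi>"
    and state: "\<And>a. a \<in> M \<Longrightarrow> vector_state \<xi> (\<theta> a) = vector_state \<xi> a"
    and \<theta>: "\<And>a. a \<in> M \<Longrightarrow> \<theta> a \<in> M" "\<And>a. a \<in> M \<Longrightarrow> \<theta> (\<theta> a) = a"
    "\<And>a b. a \<in> M \<Longrightarrow> b \<in> M \<Longrightarrow> \<theta> (a * b) = \<theta> a * \<theta> b" "\<And>a. a \<in> M \<Longrightarrow> \<theta> (adj a) = adj (\<theta> a)"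
    "\<And>a b. a \<in> M \<Longrightarrow> b \<in> M \<Longrightarrow> \<theta> (a + b) = \<theta> a + \<theta> b" "\<And>a c. a \<in> M \<Longrightarrow> \<theta> (c *\<^sub>C a) = c *\<^sub>C \<theta> a"
    using graded
    by (auto simp: graded_vn_algebra_def star_automorphism_def linear_map_on_def bij_betw_def)
  have preserve: "cinner (\<theta> a \<cdot> \<xi>) (\<theta> c \<cdot> \<xi>) = cinner (a \<cdot> \<xi>) (c \<cdot> \<xi>)" if "a \<in> M" "c \<in> M" for a c
  proof -
    have "vector_state \<xi> (\<theta> (adj c * a)) = vector_state \<xi> (adj c * a)"
      using that by (intro state von_neumann_closed[OF M])
    thus ?thesis
      using that by (simp add: vector_state_def \<theta> von_neumann_closed[OF M] cinner_adj_left)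
  qed
  have isometric: "norm (\<theta> a \<cdot> \<xi>) = norm (a \<cdot> \<xi>)" if "a \<in> M" for a
    using preserve[OF that that] by (simp add: norm_eq_sqrt_inner flip: Re_cinner)
  have "\<exists>T. \<forall>a\<in>M. \<forall>c\<in>M. cinner (T \<cdot> a \<cdot> \<xi>) (c \<cdot> \<xi>) = cinner (\<theta> a \<cdot> \<xi>) (c \<cdot> \<xi>)"
  proof (rule form_operator_exists[OF M cyc, where K = 1])
    show "cmod (cinner (\<theta> x \<cdot> \<xi>) (y \<cdot> \<xi>)) \<le> 1 * norm (x \<cdot> \<xi>) * norm (y \<cdot> \<xi>)" if "x \<in> M" for x y
      using cmod_cinner_le[of "\<theta> x \<cdot> \<xi>" "y \<cdot> \<xi>"] isometric[OF that] by simp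
  qed (auto simp: \<theta> cinner_simps)
  then obtain T where "\<And>a c. a \<in> M \<Longrightarrow> c \<in> M \<Longrightarrow> cinner (T \<cdot> a \<cdot> \<xi>) (c \<cdot> \<xi>) = cinner (\<theta> a \<cdot> \<xi>) (c \<cdot> \<xi>)"
    by blast
  hence T: "T \<cdot> a \<cdot> \<xi> = \<theta> a \<cdot> \<xi>" if "a \<in> M" for a
    using that by (intro eq_on_cyclic[OF cyc])
  have "T * T = 1"
    by (rule bop_eq_on_cyclic[OF cyc]) (simp add: T \<theta>)
  moreover have "adj T = T"
  proof (rule bop_eq_on_cyclic[OF cyc], rule eq_on_cyclic[OF cyc])
    fix c a assume ca: "c \<in> M" "a \<in> M"
    show "cinner (adj T \<cdot> c \<cdot> \<xi>) (a \<cdot> \<xi>) = cinner (T \<cdot> c \<cdot> \<xi>) (a \<cdot> \<xi>)"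
      using preserve[OF ca(1) \<theta>(1)[OF ca(2)]] ca by (simp add: cinner_adj_left T \<theta>)
  qed
  ultimately have T_unitary: "self_adjoint_unitary T"
    by (simp add: self_adjoint_unitary_def)
  have "\<Gamma> = T"
    unfolding \<Gamma>_def grading_unitary_def
  proof (rule the_equality)
    show "S = T" if "self_adjoint_unitary S \<and> (\<forall>a\<in>M. S \<cdot> a \<cdot> \<xi> = \<theta> a \<cdot> \<xi>)" for S
      using that by (intro bop_eq_on_cyclic[OF cyc]) (simp add: T)
  qed (simp add: T T_unitary)
  thus "self_adjoint_unitary \<Gamma>" and "\<And>a. a \<in> M \<Longrightarrow> \<Gamma> \<cdot> a \<cdot> \<xi> = \<theta> a \<cdot> \<xi>"
    using T T_unitary by simp_all
qed

lemma grading_unitary_spatial: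
  fixes M :: "'h :: chilbert_space bop set"
  assumes graded: "graded_vn_algebra M \<theta> \<xi>"
  defines "\<Gamma> \<equiv> grading_unitary M \<theta> \<xi>"
  shows "\<Gamma> \<cdot> \<xi> = \<xi>" and "invariant_algebra \<Gamma> M"
proof -
  have M: "von_neumann_algebra M" and cyc: "cyclic_vector M \<xi>"
    and \<theta>: "\<And>a. a \<in> M \<Longrightarrow> \<theta> a \<in> M" "\<And>a. a \<in> M \<Longrightarrow> \<theta> (\<theta> a) = a"
    "\<And>a b. a \<in> M \<Longrightarrow> b \<in> M \<Longrightarrow> \<theta> (a * b) = \<theta> a * \<theta> b"
    using graded by (auto simp: graded_vn_algebra_def star_automorphism_def bij_betw_def)
  note \<Gamma> = grading_unitary[OF graded, folded \<Gamma>_def]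
  have one: "1 \<in> M"
    by (rule von_neumann_one[OF M])
  have "\<theta> 1 = \<theta> (1 * \<theta> 1)"
    using \<theta>(3)[OF one \<theta>(1)[OF one]] \<theta>(2)[OF one] by simp
  hence "\<theta> 1 = 1"
    using \<theta>(2)[OF one] by simp
  thus "\<Gamma> \<cdot> \<xi> = \<xi>"
    using \<Gamma>(2)[OF one] by simp
  have "grading \<Gamma> a = \<theta> a" if a: "a \<in> M" for a
  proof (rule bop_eq_on_cyclic[OF cyc])
    fix c assume c: "c \<in> M"
    have "grading \<Gamma> a \<cdot> c \<cdot> \<xi> = \<Gamma> \<cdot> (a * \<theta> c) \<cdot> \<xi>"
      by (simp add: grading_def \<Gamma>(2)[OF c])
    also have "\<dots> = \<theta> (a * \<theta> c) \<cdot> \<xi>"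
      using a c by (intro \<Gamma>(2)) (auto intro: von_neumann_mult[OF M] \<theta>)
    finally show "grading \<Gamma> a \<cdot> c \<cdot> \<xi> = \<theta> a \<cdot> c \<cdot> \<xi>"
      using a c by (simp add: \<theta>)
  qed
  thus "invariant_algebra \<Gamma> M"
    using \<Gamma>(1) M \<theta>(1) by unfold_locales auto
qed

section \<open>Separating vectors\<close>

text \<open>
  The orthogonal projection onto the closure of \<open>M' \<xi>\<close> belongs to \<open>M'' = M\<close>, and its complement
  annihilates \<open>\<xi>\<close>.
\<close>

lemma separating_imp_cyclic_commutant:
  fixes M :: "'h :: chilbert_space bop set"
  assumes M: "von_neumann_algebra M" and sep: "separating_vector M \<xi>"
  shows "cyclic_vector (commutant M) \<xi>"
proof -
  define X where "X = commutant M"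
  define S where "S = (\<lambda>a. a \<cdot> \<xi>) ` X"
  have X: "von_neumann_algebra X"
    unfolding X_def by (rule von_neumann_commutant[OF M])
  have "\<exists>z. z \<in> closure S \<and> (\<forall>a\<in>X. cinner (a \<cdot> \<xi>) x = cinner (a \<cdot> \<xi>) z) \<and> norm z \<le> 1 * norm x" for x
  proof -
    obtain z where "z \<in> closure S" "\<And>a. a \<in> X \<Longrightarrow> cinner (a \<cdot> \<xi>) x = cinner (a \<cdot> \<xi>) z" "norm z \<le> \<bar>norm x\<bar>"
      unfolding S_def
    proof (rule riesz[of X "\<lambda>a. a \<cdot> \<xi>" "\<lambda>a. cinner (a \<cdot> \<xi>) x" "norm x"])
      show "cmod (cinner (a \<cdot> \<xi>) x) \<le> norm x * norm (a \<cdot> \<xi>)" for a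
        using cmod_cinner_le[of "a \<cdot> \<xi>" x] by (simp add: mult.commute)
    qed (auto simp: von_neumann_closed[OF X] cinner_simps)
    thus ?thesis
      by auto
  qed
  then obtain p where p: "\<And>x. p x \<in> closure S" "\<And>x a. a \<in> X \<Longrightarrow> cinner (a \<cdot> \<xi>) x = cinner (a \<cdot> \<xi>) (p x)"
    "\<And>x. norm (p x) \<le> 1 * norm x"
    by metis
  have orthogonal: "cinner (p x) z = 0" if z: "\<And>a. a \<in> X \<Longrightarrow> cinner (a \<cdot> \<xi>) z = 0" for x z
  proof -
    have "closed {v. cinner v z = 0}"
      by (intro closed_Collect_eq continuous_intros
          linear_continuous_on[OF bounded_bilinear.bounded_linear_left[OF bounded_bilinear_cinner]])
    moreover have "S \<subseteq> {v. cinner v z = 0}"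
      by (auto simp: S_def z)
    ultimately show ?thesis
      using closure_minimal p(1) by blast
  qed
  have zeroI: "z = 0" if "cinner z z = 0" for z :: 'h
    using that by (simp add: cinner_self)
  have "\<exists>P. \<forall>x. P \<cdot> x = p x"
  proof (rule bop_exists)
    show "p (x + y) = p x + p y" for x y
    proof -
      define z where "z = p (x + y) - (p x + p y)"
      have "cinner (a \<cdot> \<xi>) z = 0" if "a \<in> X" for a
        using that by (simp add: z_def cinner_simps flip: p(2))
      hence "cinner (p v) z = 0" for v
        by (rule orthogonal)
      hence "cinner z z = 0"
        by (subst z_def) (simp add: cinner_diff_left cinner_add_left)
      thus ?thesis
        using zeroI[of z] by (simp add: z_def)
    qed
    show "p (c *\<^sub>C x) = c *\<^sub>C p x" for c x
    proof -
      define z where "z = p (c *\<^sub>C x) - c *\<^sub>C p x"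
      have "cinner (a \<cdot> \<xi>) z = 0" if "a \<in> X" for a
        using that by (simp add: z_def cinner_simps flip: p(2))
      hence "cinner (p v) z = 0" for v
        by (rule orthogonal)
      hence "cinner z z = 0"
        by (subst z_def) (simp add: cinner_diff_left cinner_scaleC_left)
      thus ?thesis
        using zeroI[of z] by (simp add: z_def)
    qed
  qed (rule p(3))
  then obtain P where P: "\<And>x. P \<cdot> x = p x"
    by blast
  have "d * P = P * d" if d: "d \<in> X" for d
  proof (rule bop_eqI)
    fix x
    define z where "z = d \<cdot> p x - p (d \<cdot> x)"
    have orth: "cinner (a \<cdot> \<xi>) z = 0" if "a \<in> X" for a
    proof -
      have "cinner (a \<cdot> \<xi>) (d \<cdot> v) = cinner ((adj d * a) \<cdot> \<xi>) v" for v
        by (simp add: cinner_adj_left)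
      moreover have "adj d * a \<in> X"
        using d that by (intro von_neumann_closed[OF X])
      ultimately show ?thesis
        using p(2)[of "adj d * a" x] p(2)[OF that, of "d \<cdot> x"]
        by (simp add: z_def cinner_diff_right)
    qed
    have "cinner (a \<cdot> \<xi>) (adj d \<cdot> z) = 0" if "a \<in> X" for a
      using orth[of "d * a"] d that by (simp add: cinner_adj_right von_neumann_mult[OF X])
    hence "cinner (p x) (adj d \<cdot> z) = 0"
      by (rule orthogonal)
    hence "cinner (d \<cdot> p x) z = 0"
      by (simp add: cinner_adj_right)
    moreover have "cinner (p (d \<cdot> x)) z = 0"
      by (rule orthogonal) (rule orth)
    ultimately have "cinner z z = 0"
      by (subst z_def) (simp add: cinner_diff_left)
    thus "(d * P) \<cdot> x = (P * d) \<cdot> x"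
      using zeroI[of z] by (simp add: z_def P)
  qed
  hence "P \<in> commutant X"
    by (simp add: commutant_def)
  hence "1 - P \<in> M"
    using von_neumann_closed[OF M] by (simp add: X_def von_neumann_bicommutant[OF M])
  moreover have "(1 - P) \<cdot> \<xi> = 0"
  proof (rule zeroI)
    have orth: "cinner (a \<cdot> \<xi>) (\<xi> - p \<xi>) = 0" if "a \<in> X" for a
      using that by (simp add: cinner_diff_right flip: p(2))
    have "cinner \<xi> (\<xi> - p \<xi>) = 0"
      using orth[OF von_neumann_one[OF X]] by simp
    moreover have "cinner (p \<xi>) (\<xi> - p \<xi>) = 0"
      by (rule orthogonal) (rule orth)
    ultimately show "cinner ((1 - P) \<cdot> \<xi>) ((1 - P) \<cdot> \<xi>) = 0"
      by (simp add: P cinner_diff_left)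
  qed
  ultimately have "1 - P = 0"
    using sep unfolding separating_vector_def by blast
  hence "p x = x" for x
    using P[of x] by simp
  hence "closure S = UNIV"
    using p(1) by (metis UNIV_eq_I)
  thus ?thesis
    by (simp add: cyclic_vector_def S_def X_def)
qed

section \<open>The twisted dual\<close>

text \<open>
  An equivariant \<open>\<Psi> : M \<rightarrow> N\<close>, with the gradings given by self-adjoint unitaries \<open>\<Gamma>\<close>, \<open>\<Delta>\<close> that fix the
  unit vectors \<open>\<xi>\<close>, \<open>\<zeta>\<close>.
\<close>

locale graded_state_preserving_map =
  state_preserving_map M N \<xi> \<zeta> \<Psi> + dom: invariant_algebra \<Gamma> M + cod: invariant_algebra \<Delta> N
  for M :: "'h :: chilbert_space bop set" and N :: "'k :: chilbert_space bop set"
    and \<xi> :: 'h and \<zeta> :: 'k and \<Psi> :: "'h bop \<Rightarrow> 'k bop"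
    and \<Gamma> :: "'h bop" and \<Delta> :: "'k bop" +
  assumes fixed_dom: "\<Gamma> \<cdot> \<xi> = \<xi>" and fixed_cod: "\<Delta> \<cdot> \<zeta> = \<zeta>"
    and unit_dom: "norm \<xi> = 1" and unit_cod: "norm \<zeta> = 1"
    and equivariant: "\<And>a. a \<in> M \<Longrightarrow> \<Psi> (grading \<Gamma> a) = grading \<Delta> (\<Psi> a)"
begin

sublocale dom': invariant_algebra \<Gamma> "commutant M"
  by (rule dom.invariant_commutant)

sublocale cod': invariant_algebra \<Delta> "commutant N"
  by (rule cod.invariant_commutant)

abbreviation "M_tw \<equiv> kappa \<Gamma> ` commutant M"
abbreviation "N_tw \<equiv> kappa \<Delta> ` commutant N"
abbreviation "tdual \<equiv> twisted_dual M \<Gamma> \<xi> \<Delta> \<zeta> \<Psi>"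

sublocale dom_tw: invariant_algebra \<Gamma> M_tw
  by (rule dom'.invariant_kappa_image)

sublocale cod_tw: invariant_algebra \<Delta> N_tw
  by (rule cod'.invariant_kappa_image)

lemma commutant_M_tw: "commutant M_tw = kappa \<Gamma> ` M"
  by (simp add: dom'.commutant_kappa_image von_neumann_bicommutant[OF M])

lemma commutant_N_tw: "commutant N_tw = kappa \<Delta> ` N"
  by (simp add: cod'.commutant_kappa_image von_neumann_bicommutant[OF N])

lemma dual_grading:
  assumes b: "b \<in> commutant N"
  shows "dual (grading \<Delta> b) = grading \<Gamma> (dual b)"
proof (rule dual_eqI)
  have "cinner (grading \<Gamma> (dual b) \<cdot> a \<cdot> \<xi>) \<xi> = cinner (grading \<Delta> b \<cdot> \<Psi> a \<cdot> \<zeta>) \<zeta>" if a: "a \<in> M" for a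
  proof -
    have "cinner (grading \<Gamma> (dual b) \<cdot> a \<cdot> \<xi>) \<xi> = cinner (dual b \<cdot> grading \<Gamma> a \<cdot> \<xi>) \<xi>"
      by (simp add: grading_def dom.cinner_grading_operator fixed_dom)
    also have "\<dots> = cinner (b \<cdot> grading \<Delta> (\<Psi> a) \<cdot> \<zeta>) \<zeta>"
      by (simp add: dual_pairing[OF b dom.invariant[OF a]] equivariant[OF a])
    also have "\<dots> = cinner (grading \<Delta> b \<cdot> \<Psi> a \<cdot> \<zeta>) \<zeta>"
      by (simp add: grading_def cod.cinner_grading_operator fixed_cod)
    finally show ?thesis .
  qed
  thus "is_dual (grading \<Delta> b) (grading \<Gamma> (dual b))"
    using dom'.invariant[OF dual_in[OF b]] by (simp add: is_dual_value_def)
qed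

lemma dual_parts:
  assumes b: "b \<in> commutant N"
  shows "dual (even_part \<Delta> b + c *\<^sub>C odd_part \<Delta> b) = even_part \<Gamma> (dual b) + c *\<^sub>C odd_part \<Gamma> (dual b)"
proof -
  have diff: "x - y = x + (- 1) *\<^sub>C y" for x y :: "'g :: complex_vector"
    by (simp add: scaleC_minus_left scaleC_one)
  have "even_part \<Delta> b \<in> commutant N" "odd_part \<Delta> b \<in> commutant N" "grading \<Delta> b \<in> commutant N"
    using b by (rule cod'.even_part_in cod'.odd_part_in cod'.invariant)+
  thus ?thesis
    using b
    by (simp add: dual_add dual_scaleC commutant_closed)
      (simp add: even_part_def odd_part_def dual_add dual_scaleC dual_grading commutant_closed diff
        scaleC_of_real[symmetric] del: diff_conv_add_uminus)
qed

text \<open>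
  The scalars \<open>c = d = 1\<close> give the definition, and \<open>(c, d) = (\<i>, - \<i>), (- \<i>, \<i>)\<close> the two descriptions
  by the automorphism \<open>eta\<close>, from which positivity is read off.
\<close>

lemma tdual_eq_twist:
  assumes b: "b \<in> N_tw" and cd: "c * d = 1"
  shows "tdual b = twist \<Gamma> c (dual (twist \<Delta> d b))"
proof -
  obtain b' where b': "b' \<in> commutant N" "b = twist \<Delta> 1 b'"
    using b by (auto simp: kappa_eq_twist)
  have "tdual b = twist \<Gamma> 1 (dual b')"
    by (simp add: twisted_dual_def kappa_eq_twist b'(2) cod.twist_twist_inverse)
  also have "\<dots> = twist \<Gamma> c (dual (twist \<Delta> d b))"
    by (simp add: b'(2) cod.twist_twist dual_parts[OF b'(1)] dom.twist_parts cd)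
  finally show ?thesis .
qed

lemma tdual_in: "b \<in> N_tw \<Longrightarrow> tdual b \<in> M_tw"
  by (simp add: tdual_eq_twist[of b 1 1] dom'.twist_in_kappa_image dual_in cod'.twist_kappa_image_in)

lemma tdual_kappa: "b \<in> commutant N \<Longrightarrow> tdual (kappa \<Delta> b) = kappa \<Gamma> (dual b)"
  by (simp add: twisted_dual_def kappa_eq_twist cod.twist_twist_inverse)

lemma tdual_n_positive:
  assumes "n_positive n M \<Psi>"
  shows "n_positive n N_tw tdual"
  unfolding n_positive_def
proof safe
  fix B :: "nat \<Rightarrow> nat \<Rightarrow> 'k bop"
  assume B: "\<forall>i<n. \<forall>j<n. B i j \<in> N_tw" "positive_matrix n B"
  have "positive_matrix n (\<lambda>i j. adj cod.V * B i j * adj (adj cod.V))"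
    by (rule positive_matrix_conjugation[OF B(2)])
  hence "positive_matrix n (\<lambda>i j. twist \<Delta> (- \<i>) (B i j))"
    by (simp add: cod.twist_eq_conjugation)
  hence "positive_matrix n (\<lambda>i j. dual (twist \<Delta> (- \<i>) (B i j)))"
    using dual_n_positive[OF assms, unfolded n_positive_def, THEN spec,
        of "\<lambda>i j. twist \<Delta> (- \<i>) (B i j)"] B(1) cod'.twist_kappa_image_in by simp
  hence "positive_matrix n (\<lambda>i j. dom.V * dual (twist \<Delta> (- \<i>) (B i j)) * adj dom.V)"
    by (rule positive_matrix_conjugation)
  hence "positive_matrix n (\<lambda>i j. twist \<Gamma> \<i> (dual (twist \<Delta> (- \<i>) (B i j))))"
    by (simp add: dom.twist_eq_conjugation)
  thus "positive_matrix n (\<lambda>i j. tdual (B i j))"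
    using B(1) by (simp add: positive_matrix_def tdual_eq_twist[where c = \<i> and d = "- \<i>"])
qed

lemma tdual_positive: "positive_map N_tw M_tw tdual"
  unfolding positive_map_def
proof (intro conjI ballI impI)
  show "tdual ` N_tw \<subseteq> M_tw"
    using tdual_in by blast
  show "linear_map_on N_tw tdual"
    unfolding linear_map_on_def
  proof (intro conjI ballI allI)
    fix b b' c assume b: "b \<in> N_tw"
    show "tdual (c *\<^sub>C b) = c *\<^sub>C tdual b"
      using b by (simp add: tdual_eq_twist[where c = 1 and d = 1] von_neumann_scaleC[OF cod_tw.vn]
          cod.twist_scaleC dual_scaleC cod'.twist_kappa_image_in dom.twist_scaleC)
    assume b': "b' \<in> N_tw"
    show "tdual (b + b') = tdual b + tdual b'"
      using b b' by (simp add: tdual_eq_twist[where c = 1 and d = 1] von_neumann_add[OF cod_tw.vn]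
          cod.twist_add dual_add cod'.twist_kappa_image_in dom.twist_add)
  qed
  show "positive_op (tdual b)" if "b \<in> N_tw" "positive_op b" for b
    using tdual_n_positive[OF map_1_positive, unfolded One_nat_def n_positive_1] that by blast
qed

lemma tdual_one: "tdual 1 = 1"
  using tdual_kappa[OF commutant_one] by (simp add: kappa_eq_twist dom.twist_one cod.twist_one dual_one)

lemma tdual_grading:
  assumes b: "b \<in> N_tw"
  shows "tdual (grading \<Delta> b) = grading \<Gamma> (tdual b)"
proof -
  obtain b' where b': "b' \<in> commutant N" "b = kappa \<Delta> b'"
    using b by auto
  have "tdual (grading \<Delta> b) = tdual (kappa \<Delta> (grading \<Delta> b'))"
    by (simp add: b'(2) kappa_eq_twist cod.twist_grading)
  also have "\<dots> = kappa \<Gamma> (grading \<Gamma> (dual b'))"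
    using cod'.invariant[OF b'(1)] by (simp add: tdual_kappa dual_grading[OF b'(1)])
  also have "\<dots> = grading \<Gamma> (tdual b)"
    by (simp add: b'(2) tdual_kappa[OF b'(1)]) (simp add: kappa_eq_twist dom.twist_grading)
  finally show ?thesis .
qed

lemma map_norm_tdual: "map_norm N_tw tdual = 1"
  unfolding map_norm_def
proof (rule antisym)
  show "(SUP b\<in>{b \<in> N_tw. norm b \<le> 1}. ereal (norm (tdual b))) \<le> 1"
    using positive_unital_contractive[OF cod_tw.vn tdual_positive tdual_one]
    by (intro SUP_least) (simp add: one_ereal_def)
  have "norm (1 :: 'k bop) \<le> 1"
    by (rule norm_bop_leI) auto
  moreover have "1 \<le> norm (1 :: 'h bop)"
    using norm_bop_apply_le[of 1 \<xi>] by (simp add: unit_dom)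
  ultimately show "1 \<le> (SUP b\<in>{b \<in> N_tw. norm b \<le> 1}. ereal (norm (tdual b)))"
    using von_neumann_one[OF cod_tw.vn] tdual_one
    by (intro SUP_upper2[of 1]) (auto simp: one_ereal_def)
qed

lemma tdual_state:
  assumes unital: "\<Psi> 1 = 1" and b: "b \<in> N_tw"
  shows "vector_state \<xi> (tdual b) = vector_state \<zeta> b"
proof -
  obtain b' where b': "b' \<in> commutant N" "b = kappa \<Delta> b'"
    using b by auto
  have "vector_state \<xi> (tdual b) = cinner (dual b' \<cdot> 1 \<cdot> \<xi>) \<xi>"
    by (simp add: b' tdual_kappa vector_state_def)
      (simp add: kappa_eq_twist dom.twist_1_fixed_vector[OF fixed_dom] grading_def
        dom.cinner_grading_operator fixed_dom)
  also have "\<dots> = cinner (b' \<cdot> \<zeta>) \<zeta>"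
    using dual_pairing[OF b'(1) von_neumann_one[OF M]] by (simp add: unital)
  also have "\<dots> = vector_state \<zeta> b"
    by (simp add: b' vector_state_def kappa_eq_twist cod.twist_1_fixed_vector[OF fixed_cod]
        grading_def cod.cinner_grading_operator fixed_cod)
  finally show ?thesis .
qed

lemma cyclic_N_tw:
  assumes "separating_vector N \<zeta>"
  shows "cyclic_vector N_tw \<zeta>"
  using separating_imp_cyclic_commutant[OF N assms]
  by (simp add: cyclic_vector_def cod'.kappa_image_orbit[OF fixed_cod])

lemma cyclic_M_tw:
  assumes "separating_vector M \<xi>"
  shows "cyclic_vector M_tw \<xi>"
  using separating_imp_cyclic_commutant[OF M assms]
  by (simp add: cyclic_vector_def dom'.kappa_image_orbit[OF fixed_dom])

lemma state_preserving_tdual: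
  assumes "\<Psi> 1 = 1" "separating_vector N \<zeta>"
  shows "state_preserving_map N_tw M_tw \<zeta> \<xi> tdual"
  using assms by unfold_locales
    (simp_all add: cod_tw.vn dom_tw.vn cyclic_N_tw tdual_positive tdual_state)

text \<open>
  Both sides of the pairing that characterises the second dual reduce to
  \<open>\<langle>\<gamma>(b') \<Psi>(a) \<zeta>, \<zeta>\<rangle>\<close>, where \<open>b = kappa \<Delta> b'\<close> and \<open>\<gamma>\<close> is the grading defined by \<open>\<Delta>\<close>.
\<close>

lemma tdual_tdual:
  assumes unital: "\<Psi> 1 = 1" and sep: "separating_vector N \<zeta>" and a: "a \<in> M"
  shows "twisted_dual N_tw \<Delta> \<zeta> \<Gamma> \<xi> tdual a = \<Psi> a"
proof -
  interpret tw: state_preserving_map N_tw M_tw \<zeta> \<xi> tdual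
    by (rule state_preserving_tdual[OF unital sep])
  have "tw.is_dual (kappa \<Gamma> a) (kappa \<Delta> (\<Psi> a))"
    unfolding is_dual_value_def
  proof (intro conjI ballI)
    show "kappa \<Delta> (\<Psi> a) \<in> commutant N_tw"
      using map_in[OF a] by (simp add: commutant_N_tw)
    fix b assume "b \<in> N_tw"
    then obtain b' where b': "b' \<in> commutant N" "b = kappa \<Delta> b'"
      by auto
    have "cinner (kappa \<Gamma> a \<cdot> tdual b \<cdot> \<xi>) \<xi> = cinner (a \<cdot> grading \<Gamma> (dual b') \<cdot> \<xi>) \<xi>"
      by (simp add: b' tdual_kappa)
        (simp add: kappa_eq_twist dom.twist_1_fixed_vector[OF fixed_dom])
    also have "a \<cdot> grading \<Gamma> (dual b') \<cdot> \<xi> = dual (grading \<Delta> b') \<cdot> a \<cdot> \<xi>"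
      using commutant_apply[OF dual_in[OF cod'.invariant[OF b'(1)]] a] by (simp add: dual_grading[OF b'(1)])
    also have "cinner \<dots> \<xi> = cinner (grading \<Delta> b' \<cdot> \<Psi> a \<cdot> \<zeta>) \<zeta>"
      by (rule dual_pairing[OF cod'.invariant[OF b'(1)] a])
    also have "grading \<Delta> b' \<cdot> \<Psi> a \<cdot> \<zeta> = \<Psi> a \<cdot> grading \<Delta> b' \<cdot> \<zeta>"
      by (rule commutant_apply[OF cod'.invariant[OF b'(1)] map_in[OF a]])
    also have "cinner \<dots> \<zeta> = cinner (kappa \<Delta> (\<Psi> a) \<cdot> b \<cdot> \<zeta>) \<zeta>"
      by (simp add: b' kappa_eq_twist cod.twist_1_fixed_vector[OF fixed_cod])
    finally show "cinner (kappa \<Delta> (\<Psi> a) \<cdot> b \<cdot> \<zeta>) \<zeta> = cinner (kappa \<Gamma> a \<cdot> tdual b \<cdot> \<xi>) \<xi>"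
      by simp
  qed
  hence "tw.dual (kappa \<Gamma> a) = kappa \<Delta> (\<Psi> a)"
    by (rule tw.dual_eqI)
  thus ?thesis
    by (simp add: twisted_dual_def[of N_tw]) (simp add: kappa_eq_twist cod.twist_twist_inverse)
qed

end

section \<open>Twisted duality\<close>

theorem theorem11p2:
  fixes M :: "'h :: chilbert_space bop set" and N :: "'k :: chilbert_space bop set"
    and \<theta>\<^sub>\<mu> :: "'h bop \<Rightarrow> 'h bop" and \<theta>\<^sub>\<nu> :: "'k bop \<Rightarrow> 'k bop"
    and \<xi>\<^sub>\<mu> :: 'h and \<xi>\<^sub>\<nu> :: 'k
    and \<Gamma>\<^sub>\<mu> :: "'h bop" and \<Gamma>\<^sub>\<nu> :: "'k bop"
    and Mt :: "'h bop set" and Nt :: "'k bop set"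
    and \<Psi> :: "'h bop \<Rightarrow> 'k bop" and \<Psi>' \<Psi>t :: "'k bop \<Rightarrow> 'h bop" and \<Psi>tt :: "'h bop \<Rightarrow> 'k bop"
  assumes "graded_vn_algebra M \<theta>\<^sub>\<mu> \<xi>\<^sub>\<mu>"
    and "graded_vn_algebra N \<theta>\<^sub>\<nu> \<xi>\<^sub>\<nu>"
    and "\<Gamma>\<^sub>\<mu> = grading_unitary M \<theta>\<^sub>\<mu> \<xi>\<^sub>\<mu>"
    and "\<Gamma>\<^sub>\<nu> = grading_unitary N \<theta>\<^sub>\<nu> \<xi>\<^sub>\<nu>"
    and "Mt = twisted_commutant \<Gamma>\<^sub>\<mu> M"
    and "Nt = twisted_commutant \<Gamma>\<^sub>\<nu> N"
    and "positive_map M N \<Psi>"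
    and "\<forall>a\<in>M. \<Psi> (grading \<Gamma>\<^sub>\<mu> a) = grading \<Gamma>\<^sub>\<nu> (\<Psi> a)"
    and "\<forall>a\<in>M. vector_state \<xi>\<^sub>\<nu> (\<Psi> a) = vector_state \<xi>\<^sub>\<mu> a"
    and "\<Psi>' = dual_map M \<xi>\<^sub>\<mu> \<xi>\<^sub>\<nu> \<Psi>"
    and "\<Psi>t = twisted_dual M \<Gamma>\<^sub>\<mu> \<xi>\<^sub>\<mu> \<Gamma>\<^sub>\<nu> \<xi>\<^sub>\<nu> \<Psi>"
    and "\<Psi>tt = twisted_dual Nt \<Gamma>\<^sub>\<nu> \<xi>\<^sub>\<nu> \<Gamma>\<^sub>\<mu> \<xi>\<^sub>\<mu> \<Psi>t"
  shows "(positive_map Nt Mt \<Psi>t) \<and>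
    (\<forall>b\<in>Nt. \<Psi>t (grading \<Gamma>\<^sub>\<nu> b) = grading \<Gamma>\<^sub>\<mu> (\<Psi>t b)) \<and>
    (map_norm Nt \<Psi>t = 1) \<and>
    (\<forall>b\<in>Nt. \<Psi>t b = eta \<Gamma>\<^sub>\<mu> (\<Psi>' (inv (eta \<Gamma>\<^sub>\<nu>) b))) \<and>
    (\<forall>b\<in>Nt. \<Psi>t b = inv (eta \<Gamma>\<^sub>\<mu>) (\<Psi>' (eta \<Gamma>\<^sub>\<nu> b))) \<and>
    (\<forall>n\<ge>1. n_positive n M \<Psi> \<longrightarrow> n_positive n Nt \<Psi>t) \<and>
    (completely_positive M \<Psi> \<longrightarrow> completely_positive Nt \<Psi>t) \<and>
    (\<Psi> 1 = 1 \<and> separating_vector M \<xi>\<^sub>\<mu> \<and> separating_vector N \<xi>\<^sub>\<nu> \<longrightarrow>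
      graded_vn_algebra Nt (grading \<Gamma>\<^sub>\<nu>) \<xi>\<^sub>\<nu> \<and> graded_vn_algebra Mt (grading \<Gamma>\<^sub>\<mu>) \<xi>\<^sub>\<mu> \<and>
      grading_unitary Nt (grading \<Gamma>\<^sub>\<nu>) \<xi>\<^sub>\<nu> = \<Gamma>\<^sub>\<nu> \<and> grading_unitary Mt (grading \<Gamma>\<^sub>\<mu>) \<xi>\<^sub>\<mu> = \<Gamma>\<^sub>\<mu> \<and>
      (\<forall>b\<in>Nt. vector_state \<xi>\<^sub>\<mu> (\<Psi>t b) = vector_state \<xi>\<^sub>\<nu> b) \<and>
      (\<forall>a'\<in>commutant Mt. \<exists>!c. is_dual_value Nt \<xi>\<^sub>\<nu> \<xi>\<^sub>\<mu> \<Psi>t a' c) \<and>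
      kappa \<Gamma>\<^sub>\<mu> ` M = commutant Mt \<and>
      (\<forall>a\<in>M. \<Psi>tt a = \<Psi> a))"
proof -
  note graded_M = assms(1) and graded_N = assms(2) and \<Gamma>\<^sub>\<mu> = assms(3) and \<Gamma>\<^sub>\<nu> = assms(4)
    and Mt = assms(5) and Nt = assms(6) and \<Psi>' = assms(10) and \<Psi>t = assms(11) and \<Psi>tt = assms(12)
  interpret inv_M: invariant_algebra \<Gamma>\<^sub>\<mu> M
    unfolding \<Gamma>\<^sub>\<mu> by (rule grading_unitary_spatial(2)[OF graded_M])
  interpret inv_N: invariant_algebra \<Gamma>\<^sub>\<nu> N
    unfolding \<Gamma>\<^sub>\<nu> by (rule grading_unitary_spatial(2)[OF graded_N])
  interpret graded_state_preserving_map M N \<xi>\<^sub>\<mu> \<xi>\<^sub>\<nu> \<Psi> \<Gamma>\<^sub>\<mu> \<Gamma>\<^sub>\<nu>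
  proof
    show "\<Gamma>\<^sub>\<mu> \<cdot> \<xi>\<^sub>\<mu> = \<xi>\<^sub>\<mu>" "\<Gamma>\<^sub>\<nu> \<cdot> \<xi>\<^sub>\<nu> = \<xi>\<^sub>\<nu>"
      unfolding \<Gamma>\<^sub>\<mu> \<Gamma>\<^sub>\<nu> by (rule grading_unitary_spatial(1)[OF graded_M] grading_unitary_spatial(1)[OF graded_N])+
  qed (use assms in \<open>auto simp: graded_vn_algebra_def\<close>)
  have Mt: "Mt = M_tw" and Nt: "Nt = N_tw"
    by (simp_all add: Mt Nt twisted_commutant_def)
  show ?thesis
    unfolding Mt Nt
  proof (intro conjI)
    show "positive_map N_tw M_tw \<Psi>t"
      unfolding \<Psi>t by (rule tdual_positive)
    show "\<forall>b\<in>N_tw. \<Psi>t (grading \<Gamma>\<^sub>\<nu> b) = grading \<Gamma>\<^sub>\<mu> (\<Psi>t b)"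
      unfolding \<Psi>t using tdual_grading by blast
    show "map_norm N_tw \<Psi>t = 1"
      unfolding \<Psi>t by (rule map_norm_tdual)
    show "\<forall>b\<in>N_tw. \<Psi>t b = eta \<Gamma>\<^sub>\<mu> (\<Psi>' (inv (eta \<Gamma>\<^sub>\<nu>) b))"
      unfolding \<Psi>t \<Psi>' inv_N.inv_eta unfolding eta_eq_twist
      by (intro ballI tdual_eq_twist) simp_all
    show "\<forall>b\<in>N_tw. \<Psi>t b = inv (eta \<Gamma>\<^sub>\<mu>) (\<Psi>' (eta \<Gamma>\<^sub>\<nu> b))"
      unfolding \<Psi>t \<Psi>' inv_M.inv_eta unfolding eta_eq_twist
      by (intro ballI tdual_eq_twist) simp_all
    show "\<forall>n\<ge>1. n_positive n M \<Psi> \<longrightarrow> n_positive n N_tw \<Psi>t"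
      unfolding \<Psi>t using tdual_n_positive by blast
    show "completely_positive M \<Psi> \<longrightarrow> completely_positive N_tw \<Psi>t"
      unfolding \<Psi>t completely_positive_def using tdual_n_positive by blast
    show "\<Psi> 1 = 1 \<and> separating_vector M \<xi>\<^sub>\<mu> \<and> separating_vector N \<xi>\<^sub>\<nu> \<longrightarrow>
      graded_vn_algebra N_tw (grading \<Gamma>\<^sub>\<nu>) \<xi>\<^sub>\<nu> \<and> graded_vn_algebra M_tw (grading \<Gamma>\<^sub>\<mu>) \<xi>\<^sub>\<mu> \<and>
      grading_unitary N_tw (grading \<Gamma>\<^sub>\<nu>) \<xi>\<^sub>\<nu> = \<Gamma>\<^sub>\<nu> \<and> grading_unitary M_tw (grading \<Gamma>\<^sub>\<mu>) \<xi>\<^sub>\<mu> = \<Gamma>\<^sub>\<mu> \<and>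
      (\<forall>b\<in>N_tw. vector_state \<xi>\<^sub>\<mu> (\<Psi>t b) = vector_state \<xi>\<^sub>\<nu> b) \<and>
      (\<forall>a'\<in>commutant M_tw. \<exists>!c. is_dual_value N_tw \<xi>\<^sub>\<nu> \<xi>\<^sub>\<mu> \<Psi>t a' c) \<and>
      kappa \<Gamma>\<^sub>\<mu> ` M = commutant M_tw \<and>
      (\<forall>a\<in>M. \<Psi>tt a = \<Psi> a)" (is "_ \<longrightarrow> ?conclusion")
    proof (intro impI, elim conjE)
      assume unital: "\<Psi> 1 = 1" and sep: "separating_vector M \<xi>\<^sub>\<mu>" "separating_vector N \<xi>\<^sub>\<nu>"
      interpret tw: state_preserving_map N_tw M_tw \<xi>\<^sub>\<nu> \<xi>\<^sub>\<mu> tdual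
        by (rule state_preserving_tdual[OF unital sep(2)])
      show ?conclusion
      proof (intro conjI ballI)
        show "graded_vn_algebra N_tw (grading \<Gamma>\<^sub>\<nu>) \<xi>\<^sub>\<nu>" "grading_unitary N_tw (grading \<Gamma>\<^sub>\<nu>) \<xi>\<^sub>\<nu> = \<Gamma>\<^sub>\<nu>"
          by (rule cod_tw.graded_vn_algebra_grading[OF fixed_cod unit_cod cyclic_N_tw[OF sep(2)]])+
        show "graded_vn_algebra M_tw (grading \<Gamma>\<^sub>\<mu>) \<xi>\<^sub>\<mu>" "grading_unitary M_tw (grading \<Gamma>\<^sub>\<mu>) \<xi>\<^sub>\<mu> = \<Gamma>\<^sub>\<mu>"
          by (rule dom_tw.graded_vn_algebra_grading[OF fixed_dom unit_dom cyclic_M_tw[OF sep(1)]])+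
        show "vector_state \<xi>\<^sub>\<mu> (\<Psi>t b) = vector_state \<xi>\<^sub>\<nu> b" if "b \<in> N_tw" for b
          unfolding \<Psi>t by (rule tdual_state[OF unital that])
        show "\<exists>!c. is_dual_value N_tw \<xi>\<^sub>\<nu> \<xi>\<^sub>\<mu> \<Psi>t a' c" if "a' \<in> commutant M_tw" for a'
          unfolding \<Psi>t using tw.is_dual_exists[OF that] tw.is_dual_unique by blast
        show "kappa \<Gamma>\<^sub>\<mu> ` M = commutant M_tw"
          by (simp only: commutant_M_tw)
        show "\<Psi>tt a = \<Psi> a" if "a \<in> M" for a
          unfolding \<Psi>tt \<Psi>t Nt by (rule tdual_tdual[OF unital sep(2) that])
      qed
    qed
  qed
qed

end
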